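(* As $n\to\infty$, \[ r_{1,1}(n)\sim r_{1,2}(n)\sim \frac{3^{1/4}\phi^{1/2}\log(\phi)}{2\pi}\, n^{-1/4} e^{2\pi\sqrt{n/15}}, \] where $\phi=\frac{1+\sqrt5}{2}$ is the golden ratio.
   Context: A partition $\lambda=(\lambda_1\ge \lambda_2\ge\cdots\ge\lambda_k)$ of $n$ is a weakly decreasing sequence of positive integers summing to $n$; its conjugate is $\lambda'$ with $\lambda'_j=\#\{i:\lambda_i\ge j\}$. For the cell in row $i$ and column $j$ of the Young diagram of $\lambda$, its hook length is $h(i,j)=\lambda_i+\lambda'_j-i-j+1$. A $t$-hook is a cell with hook length $t$. For a positive integer $t$, $r_{1,t}(n)$ denotes the total number of $t$-hooks, summed over all partitions of $n$ whose consecutive parts differ by at least $2$ (i.e. $\lambda_i-\lambda_{i+1}\ge 2$ for all $1\le i<k$). *)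

theory Defs
  imports Complex_Main "HOL-Library.Landau_Symbols"
begin

definition is_partition :: "nat \<Rightarrow> nat list \<Rightarrow> bool" where
  "is_partition n xs \<longleftrightarrow>
     sorted_wrt (\<ge>) xs \<and> (\<forall>x\<in>set xs. 0 < x) \<and> sum_list xs = n"

text \<open>Rows and columns are numbered from 1, whereas list positions start at 0;
  \<open>part xs i\<close> is only meant for \<open>1 \<le> i \<le> length xs\<close>.\<close>

definition part :: "nat list \<Rightarrow> nat \<Rightarrow> nat" where
  "part xs i = xs ! (i - 1)"

definition conj_part :: "nat list \<Rightarrow> nat \<Rightarrow> nat" where
  "conj_part xs j = card {i \<in> {1..length xs}. part xs i \<ge> j}"

definition young_diagram :: "nat list \<Rightarrow> (nat \<times> nat) set" where
  "young_diagram xs = {(i, j). i \<in> {1..length xs} \<and> j \<in> {1..part xs i}}"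

text \<open>Integer-valued, so that no subtraction is truncated.\<close>

definition hook_length :: "nat list \<Rightarrow> nat \<Rightarrow> nat \<Rightarrow> int" where
  "hook_length xs i j = int (part xs i) + int (conj_part xs j) - int i - int j + 1"

definition hooks :: "nat \<Rightarrow> nat list \<Rightarrow> (nat \<times> nat) set" where
  "hooks t xs = {(i, j) \<in> young_diagram xs. hook_length xs i j = int t}"

definition gap2_partitions :: "nat \<Rightarrow> nat list set" where
  "gap2_partitions n =
     {xs. is_partition n xs \<and>
       (\<forall>i. 1 \<le> i \<and> i < length xs \<longrightarrow> int (part xs i) - int (part xs (i + 1)) \<ge> 2)}"

definition r1 :: "nat \<Rightarrow> nat \<Rightarrow> nat" where
  "r1 t n = (\<Sum>xs\<in>gap2_partitions n. card (hooks t xs))"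

definition golden_ratio :: real where
  "golden_ratio = (1 + sqrt 5) / 2"

text \<open>The sets being summed over and counted are finite, so \<open>sum\<close> and \<open>card\<close> do not
  collapse to their default value 0.\<close>

lemma finite_gap2_partitions: "finite (gap2_partitions n)"
proof (rule finite_subset)
  have len: "length xs \<le> sum_list xs" if "\<forall>x\<in>set xs. 0 < x" for xs :: "nat list"
    using that by (induction xs) auto
  show "gap2_partitions n \<subseteq> {xs. set xs \<subseteq> {..n} \<and> length xs \<le> n}"
    using len member_le_sum_list by (fastforce simp: gap2_partitions_def is_partition_def)
  show "finite {xs. set xs \<subseteq> {..n} \<and> length xs \<le> n}"
    by (rule finite_lists_length_le) simp
qed

lemma finite_hooks: "finite (hooks t xs)"
proof (rule finite_subset)
  show "hooks t xs \<subseteq> (SIGMA i:{1..length xs}. {1..part xs i})"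
    by (auto simp: hooks_def young_diagram_def)
  show "finite (SIGMA i:{1..length xs}. {1..part xs i})"
    by simp
qed

end

(* Every part of a partition with gaps at least 2 ends in exactly one 1-hook, and every part
   other than 1 contains exactly one 2-hook. Hence r1 1 n is the total number of parts, and r1 2 n
   differs from it by at most the number of partitions, which is of smaller order.

   With q = exp (-x), G v = (SUM k. exp (-v)^k q^(k^2) / ((1-q)...(1-q^k))) satisfies
   G v = G (v+x) + exp (-(v+x)) G (v+2x). An explicit approximate solution whose relative error is
   O(x^2 exp (-v)) per step determines G v up to a factor 1 + O(x) by a maximum principle; the constant
   in its exponent is a dilogarithm value, pi^2/15. Convexity of ln G in v gives the mean number of
   parts, ln phi / x, and thus the generating function F of r1 1 on the real axis.

   At x = pi / sqrt (15 n), the real asymptotics of F say that the normalised moment generating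
   functions converge on a real interval to that of a Gaussian. They are bounded on a strip, so by
   Montel's theorem they converge on the imaginary axis too. The integral of F giving r1 1 n then
   converges by dominated convergence: each term of F with at least J parts gains the factors
   |(1-|q|^j)/(1-q^j)| for all j <= J off the real axis, and few parts are exponentially unlikely. *)

theory Submission
  imports Defs "HOL-Complex_Analysis.Complex_Analysis" "HOL-Probability.Probability" "HOL-Real_Asymp.Real_Asymp"
begin

section \<open>Hooks of partitions with gaps at least two\<close>

text \<open>The obstacle is that the maximum principle needs positive coefficients, hence real x:
  comparison with an explicit solution says nothing about complex q, and no modular transformation
  is used. Off the real axis, crude bounds suffice, because the pointwise limit is obtained by
  continuation from the real interval and the bounds only have to dominate.

  The approximate solution is a WKB ansatz exp (S v / x + P v). Order 1 makes exp (- S' v) the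
  positive root h of h^2 = h + exp (- v); order x determines P'. The factor exp (- v) in the error
  per step is essential: along v, v + x, v + 2 x, ... the errors form a geometric series with sum
  O(x), whereas bare errors O(x^2) would not be summable.

  The point x = pi / sqrt (15 n) minimises pi^2 / (15 x) + n x. The second derivative of pi^2 / (15
  x) is 2 pi^2 / (15 x^3), so fluctuations of the size have order x^(-3/2). After rescaling by
  x^(3/2) the limit is exp (pi^2 w^2 / 15), and its integral along the imaginary axis supplies the
  factor sqrt (15 / pi).\<close>

definition gap2 :: "nat list \<Rightarrow> bool" where
  "gap2 xs \<longleftrightarrow> sorted_wrt (\<lambda>a b. b + 2 \<le> a) xs \<and> (\<forall>x\<in>set xs. 0 < x)"

text \<open>The relation \<open>b + 2 <= a\<close> is transitive, so the condition on consecutive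
  parts extends to all pairs, as \<open>sorted_wrt\<close> requires, and it implies the weak
  decrease.\<close>

lemma gap2_partitions_eq: "gap2_partitions n = {xs. gap2 xs \<and> sum_list xs = n}"
proof -
  have *: "sorted_wrt (\<lambda>a b. b + 2 \<le> a) xs \<longleftrightarrow>
      (\<forall>i. Suc i < length xs \<longrightarrow> xs ! Suc i + 2 \<le> xs ! i)" for xs :: "nat list"
    by (rule sorted_wrt_iff_nth_Suc_transp) (auto simp: transp_def)
  have "(\<forall>i. 1 \<le> i \<and> i < length xs \<longrightarrow> int (Defs.part xs i) - int (Defs.part xs (i + 1)) \<ge> 2) \<longleftrightarrow>
      (\<forall>i. Suc i < length xs \<longrightarrow> xs ! Suc i + 2 \<le> xs ! i)" (is "?L \<longleftrightarrow> ?R") for xs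
  proof
    assume L: ?L
    show ?R
    proof (intro allI impI)
      fix i assume "Suc i < length xs"
      then have "int (Defs.part xs (Suc i)) - int (Defs.part xs (Suc i + 1)) \<ge> 2" using L by auto
      then show "xs ! Suc i + 2 \<le> xs ! i" by (simp add: Defs.part_def)
    qed
  next
    assume R: ?R
    show ?L
    proof (intro allI impI)
      fix i assume i: "1 \<le> i \<and> i < length xs"
      then have "xs ! Suc (i - 1) + 2 \<le> xs ! (i - 1)" using R[rule_format, of "i - 1"] by simp
      then show "int (Defs.part xs i) - int (Defs.part xs (i + 1)) \<ge> 2" using i by (simp add: Defs.part_def)
    qed
  qed
  moreover have "sorted_wrt (\<ge>) xs" if "sorted_wrt (\<lambda>a b. b + 2 \<le> a) xs" for xs :: "nat list"
    using that by (rule sorted_wrt_mono_rel[rotated]) auto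
  ultimately show ?thesis
    unfolding gap2_partitions_def is_partition_def gap2_def using * by auto
qed

lemma gap2_nth_less: "gap2 xs \<Longrightarrow> i < j \<Longrightarrow> j < length xs \<Longrightarrow> xs ! j + 2 \<le> xs ! i"
  by (auto simp: gap2_def sorted_wrt_iff_nth_less)

lemma gap2_nth_pos: "gap2 xs \<Longrightarrow> i < length xs \<Longrightarrow> 0 < xs ! i"
  by (auto simp: gap2_def)

lemma conj_part_ge:
  assumes "gap2 xs" "i \<in> {1..length xs}" "j \<le> Defs.part xs i"
  shows "i \<le> conj_part xs j"
proof -
  have "{1..i} \<subseteq> {i \<in> {1..length xs}. Defs.part xs i \<ge> j}"
  proof
    fix k assume k: "k \<in> {1..i}"
    show "k \<in> {i \<in> {1..length xs}. Defs.part xs i \<ge> j}"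
    proof (cases "k = i")
      case False
      then have "xs ! (i - 1) + 2 \<le> xs ! (k - 1)"
        using k assms by (intro gap2_nth_less) auto
      then show ?thesis using k assms by (auto simp: Defs.part_def)
    qed (use assms in auto)
  qed
  from card_mono[OF _ this] show ?thesis by (simp add: conj_part_def)
qed

text \<open>The hypotheses place j in one of the last two columns of row i. Rows further down are
  shorter by at least 2, so none of them reaches column j.\<close>

lemma conj_part_eq:
  assumes "gap2 xs" "i \<in> {1..length xs}" "j \<le> Defs.part xs i" "Defs.part xs i \<le> j + 1"
  shows "conj_part xs j = i"
proof -
  have "{i \<in> {1..length xs}. Defs.part xs i \<ge> j} \<subseteq> {1..i}"
  proof
    fix k assume k: "k \<in> {i \<in> {1..length xs}. Defs.part xs i \<ge> j}"
    show "k \<in> {1..i}"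
    proof (rule ccontr)
      assume "k \<notin> {1..i}"
      then have "xs ! (k - 1) + 2 \<le> xs ! (i - 1)"
        using k assms by (intro gap2_nth_less) auto
      then show False using k assms by (auto simp: Defs.part_def)
    qed
  qed
  from card_mono[OF _ this] have "conj_part xs j \<le> i" by (simp add: conj_part_def)
  with conj_part_ge[OF assms(1-3)] show ?thesis by simp
qed

text \<open>The last two cells of a row have no cell beneath them, so their hooks are pure arms, of
  length 1 and 2. Any cell further left has an arm of at least 2 and hence a hook of length at least
  3.\<close>

lemma hook_length_eq_iff:
  assumes "gap2 xs" "(i, j) \<in> young_diagram xs" "t \<in> {1, 2}"
  shows "hook_length xs i j = int t \<longleftrightarrow> j + t = Defs.part xs i + 1"
proof (cases "Defs.part xs i \<le> j + 1")
  case True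
  then have "conj_part xs j = i"
    using assms by (intro conj_part_eq) (auto simp: young_diagram_def)
  then show ?thesis by (auto simp: hook_length_def)
next
  case False
  moreover have "i \<le> conj_part xs j"
    using assms by (intro conj_part_ge) (auto simp: young_diagram_def)
  ultimately show ?thesis using assms by (auto simp: hook_length_def)
qed

lemma card_hooks:
  assumes "gap2 xs" "t \<in> {1, 2}"
  shows "card (hooks t xs) = card {i \<in> {1..length xs}. t \<le> Defs.part xs i}"
proof -
  have "bij_betw (\<lambda>i. (i, Defs.part xs i + 1 - t)) {i \<in> {1..length xs}. t \<le> Defs.part xs i} (hooks t xs)"
    using assms hook_length_eq_iff[OF assms(1) _ assms(2)]
    by (intro bij_betwI[where g = fst]) (auto simp: hooks_def young_diagram_def)
  from bij_betw_same_card[OF this] show ?thesis by simp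
qed

lemma card_hooks_1:
  assumes "gap2 xs" shows "card (hooks 1 xs) = length xs"
proof -
  have "{i \<in> {1..length xs}. 1 \<le> Defs.part xs i} = {1..length xs}"
    using gap2_nth_pos[OF assms] by (fastforce simp: Defs.part_def Suc_le_eq)
  with card_hooks[OF assms, of 1] show ?thesis by simp
qed

lemma card_hooks_2:
  assumes "gap2 xs"
  shows "card (hooks 2 xs) \<le> length xs" "length xs \<le> card (hooks 2 xs) + 1"
proof -
  let ?S = "{i \<in> {1..length xs}. 2 \<le> Defs.part xs i}"
  have c: "card (hooks 2 xs) = card ?S" using card_hooks[OF assms, of 2] by simp
  have "card ?S \<le> card {1..length xs}" by (rule card_mono) auto
  with c show "card (hooks 2 xs) \<le> length xs" by simp
  \<comment> \<open>Only the last part can be 1: every earlier part exceeds it by at least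
    2.\<close>
  have "i \<in> ?S" if "i \<in> {1..length xs - 1}" for i
  proof -
    have "xs ! (length xs - 1) + 2 \<le> xs ! (i - 1)"
      using that assms by (intro gap2_nth_less) auto
    then show ?thesis using that by (auto simp: Defs.part_def)
  qed
  then have "card {1..length xs - 1} \<le> card ?S" by (intro card_mono) auto
  with c show "length xs \<le> card (hooks 2 xs) + 1" by simp
qed

lemma r1_1_eq: "r1 1 n = (\<Sum>xs\<in>gap2_partitions n. length xs)"
  unfolding r1_def by (rule sum.cong) (auto simp: gap2_partitions_eq card_hooks_1[unfolded One_nat_def])

lemma r1_2_le: "r1 2 n \<le> r1 1 n"
  unfolding r1_1_eq unfolding r1_def
  by (rule sum_mono) (auto simp: gap2_partitions_eq card_hooks_2)

lemma r1_1_le: "r1 1 n \<le> r1 2 n + card (gap2_partitions n)"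
proof -
  have "(\<Sum>xs\<in>gap2_partitions n. length xs) \<le> (\<Sum>xs\<in>gap2_partitions n. card (hooks 2 xs) + 1)"
    by (rule sum_mono) (use card_hooks_2 in \<open>auto simp: gap2_partitions_eq\<close>)
  then show ?thesis unfolding r1_1_eq unfolding r1_def by (simp only: sum.distrib card_eq_sum)
qed

text \<open>Only polynomially many partitions of \<open>n\<close> have fewer than \<open>M\<close> parts, so almost all
  partitions contribute at least \<open>M\<close> to \<open>r1 1 n\<close>.\<close>

lemma card_gap2_partitions_le:
  "M * card (gap2_partitions n) \<le> r1 1 n + M * M * (n + 1) ^ M"
proof -
  let ?S = "gap2_partitions n" and ?F = "{xs \<in> gap2_partitions n. length xs < M}"
  have "?F \<subseteq> (\<Union>k<M. {xs. set xs \<subseteq> {..n} \<and> length xs = k})"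
    using member_le_sum_list by (fastforce simp: gap2_partitions_eq)
  then have "card ?F \<le> card (\<Union>k<M. {xs. set xs \<subseteq> {..n} \<and> length xs = k})"
    by (intro card_mono) (auto intro: finite_lists_length_eq)
  also have "\<dots> \<le> (\<Sum>k<M. card {xs. set xs \<subseteq> {..n} \<and> length xs = k})"
    by (rule card_UN_le) auto
  also have "\<dots> = (\<Sum>k<M. (n + 1) ^ k)" by (simp add: card_lists_length_eq)
  also have "\<dots> \<le> (\<Sum>k<M. (n + 1) ^ M)" by (intro sum_mono power_increasing) auto
  finally have F: "card ?F \<le> M * (n + 1) ^ M" by simp
  have "M * card ?S = (\<Sum>xs\<in>?S. M)" by simp
  also have "\<dots> \<le> (\<Sum>xs\<in>?S. length xs + (if length xs < M then M else 0))"
    by (rule sum_mono) auto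
  also have "\<dots> = r1 1 n + M * card ?F"
    by (simp add: sum.distrib r1_1_eq[unfolded One_nat_def] sum.If_cases finite_gap2_partitions Int_def)
  also have "\<dots> \<le> r1 1 n + M * (M * (n + 1) ^ M)" using F by (intro add_left_mono mult_left_mono) auto
  finally show ?thesis by (simp only: mult.assoc)
qed

section \<open>The generating function by number of parts\<close>

definition gap2_length :: "nat \<Rightarrow> nat list set" where
  "gap2_length k = {xs. gap2 xs \<and> length xs = k}"

text \<open>The k-th term of the Rogers-Ramanujan sum. The numerator is the weight of the smallest
  partition with k parts, 2 k - 1, ..., 3, 1. The type is left general because both real and complex
  q occur.\<close>

definition gap2_gf :: "nat \<Rightarrow> 'a \<Rightarrow> 'a::real_normed_field" where
  "gap2_gf k q = q ^ k\<^sup>2 / (\<Prod>j=1..k. 1 - q ^ j)"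

lemma gap2_gf_0 [simp]: "gap2_gf 0 q = 1"
  by (simp add: gap2_gf_def)

lemma gap2_gf_Suc: "gap2_gf (Suc k) q = q ^ (2 * k + 1) / (1 - q ^ Suc k) * gap2_gf k q"
proof -
  have "(Suc k)\<^sup>2 = 2 * k + 1 + k\<^sup>2" by (simp add: power2_eq_square)
  then have "q ^ (Suc k)\<^sup>2 = q ^ (2 * k + 1) * q ^ k\<^sup>2" by (simp only: power_add)
  then show ?thesis by (simp add: gap2_gf_def prod.atLeast_Suc_atMost_Suc_shift prod.nat_ivl_Suc')
qed

text \<open>A partition counted by \<open>gap2_length (Suc k)\<close> is determined by its smallest part \<open>i + 1\<close> and
  by what remains of the other parts after subtracting \<open>i + 2\<close> from each of them.\<close>

lemma bij_betw_gap2_length_Suc: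
  "bij_betw (\<lambda>(i, ys). map (\<lambda>a. a + (i + 2)) ys @ [i + 1])
     (UNIV \<times> gap2_length k) (gap2_length (Suc k))"
proof (rule bij_betwI[where g = "\<lambda>xs. (last xs - 1, map (\<lambda>a. a - (last xs + 1)) (butlast xs))"])
  have add: "gap2 (map (\<lambda>a. a + (i + 2)) ys @ [i + 1])" if "gap2 ys" for ys and i :: nat
  proof -
    have "Suc 0 \<le> x" if "x \<in> set ys" for x using \<open>gap2 ys\<close> that by (force simp: gap2_def)
    with that show ?thesis unfolding gap2_def sorted_wrt_append sorted_wrt_map by simp
  qed
  show "(\<lambda>(i, ys). map (\<lambda>a. a + (i + 2)) ys @ [i + 1]) \<in> UNIV \<times> gap2_length k \<rightarrow> gap2_length (Suc k)"
    using add by (simp add: gap2_length_def Pi_iff split_beta)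
  \<comment> \<open>The parts in \<open>ys\<close> are at least b + 2, so the truncated subtraction
    of b + 1 is reversible and leaves positive parts.\<close>
  have *: "gap2 (map (\<lambda>a. a - (b + 1)) ys) \<and> map (\<lambda>a. a - (b + 1) + (b + 1)) ys = ys"
    if "gap2 (ys @ [b])" for ys and b :: nat
  proof -
    have ys: "sorted_wrt (\<lambda>a c. c + 2 \<le> a) ys" "\<forall>x\<in>set ys. b + 2 \<le> x"
      using that unfolding gap2_def sorted_wrt_append by auto
    have "sorted_wrt (\<lambda>a c. c - (b + 1) + 2 \<le> a - (b + 1)) ys"
      by (rule sorted_wrt_mono_rel[OF _ ys(1)]) (use ys(2) in force)
    moreover have "\<forall>x\<in>set ys. 0 < x - (b + 1)" using ys(2) by force
    moreover have "map (\<lambda>a. a - (b + 1) + (b + 1)) ys = ys"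
      by (rule map_idI) (use ys(2) in force)
    ultimately show ?thesis unfolding gap2_def sorted_wrt_map by simp
  qed
  have snoc: "\<exists>ys b. xs = ys @ [b] \<and> 0 < b \<and> gap2 (ys @ [b]) \<and> length ys = k"
    if "xs \<in> gap2_length (Suc k)" for xs
    using that by (cases xs rule: rev_cases) (auto simp: gap2_length_def gap2_def)
  show "(\<lambda>xs. (last xs - 1, map (\<lambda>a. a - (last xs + 1)) (butlast xs))) \<in>
      gap2_length (Suc k) \<rightarrow> UNIV \<times> gap2_length k"
  proof
    fix xs assume "xs \<in> gap2_length (Suc k)"
    then obtain ys b where "xs = ys @ [b]" "gap2 (ys @ [b])" "length ys = k" using snoc by blast
    then show "(last xs - 1, map (\<lambda>a. a - (last xs + 1)) (butlast xs)) \<in> UNIV \<times> gap2_length k"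
      using *[of ys b] by (simp add: gap2_length_def)
  qed
  show "(case (last xs - 1, map (\<lambda>a. a - (last xs + 1)) (butlast xs)) of
      (i, ys) \<Rightarrow> map (\<lambda>a. a + (i + 2)) ys @ [i + 1]) = xs" if mem: "xs \<in> gap2_length (Suc k)" for xs
  proof -
    obtain ys b where xs: "xs = ys @ [b]" and b: "0 < b" and g: "gap2 (ys @ [b])"
      using snoc[OF mem] by blast
    have b: "b - 1 + 2 = b + 1" "b - 1 + 1 = b" using b by auto
    show ?thesis
      unfolding xs prod.case last_snoc butlast_snoc b map_map o_def conjunct2[OF *[OF g]] by (rule refl)
  qed
qed (simp add: split_beta o_def)

lemma sum_list_map_add: "sum_list (map (\<lambda>a. a + c) ys) = sum_list ys + length ys * (c::nat)"
  by (induction ys) auto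

text \<open>Raising the smallest part by i raises all k + 1 parts by i; summing over i produces the
  new denominator factor of \<open>gap2_gf (Suc k)\<close>.\<close>

lemma has_sum_geometric_mult:
  fixes r :: "'a :: {real_normed_field, banach}"
  assumes "norm r < 1"
  shows "((\<lambda>i. r ^ (i * Suc k)) has_sum 1 / (1 - r ^ Suc k)) UNIV"
proof -
  have "norm (r ^ Suc k) < 1" unfolding norm_power using power_strict_mono[of "norm r" 1 "Suc k"] assms by simp
  then have "(\<lambda>i. (r ^ Suc k) ^ i) sums (1 / (1 - r ^ Suc k))"
    "summable (\<lambda>i. norm ((r ^ Suc k) ^ i))"
    by (auto intro!: geometric_sums summable_geometric simp: norm_power simp del: power_Suc)
  then have "((\<lambda>i. (r ^ Suc k) ^ i) has_sum 1 / (1 - r ^ Suc k)) UNIV"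
    by (intro norm_summable_imp_has_sum)
  also have "(\<lambda>i. (r ^ Suc k) ^ i) = (\<lambda>i. r ^ (i * Suc k))"
    by (simp only: power_mult[symmetric] mult.commute)
  finally show ?thesis .
qed

text \<open>The size of \<open>f (i, ys)\<close> is a sum of a term in i and a term in
  \<open>ys\<close>, so the double sum factors into inner and outer sums. They are kept apart
  because merging them needs absolute summability, which is available only afterwards.\<close>

lemma has_sum_gap2_length_aux:
  fixes r :: "'a :: {real_normed_field, banach}"
  defines "f \<equiv> \<lambda>(i, ys). map (\<lambda>a. a + (i + 2)) ys @ [i + (1::nat)]"
  assumes r: "norm r < 1"
    and IH: "((\<lambda>ys. r ^ sum_list ys) has_sum gap2_gf k r) (gap2_length k)"
  shows "((\<lambda>ys. r ^ sum_list (f (i, ys))) has_sum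
       r ^ (i * Suc k) * (r ^ (2 * k + 1) * gap2_gf k r)) (gap2_length k)" (is ?inner)
    and "((\<lambda>i. r ^ (i * Suc k) * (r ^ (2 * k + 1) * gap2_gf k r)) has_sum gap2_gf (Suc k) r) UNIV" (is ?outer)
proof -
  have sl: "sum_list (f (i, ys)) = i * Suc k + (2 * k + 1 + sum_list ys)"
    if "ys \<in> gap2_length k" for ys
    unfolding f_def using that
    by (simp only: prod.case sum_list_append sum_list_map_add) (simp add: gap2_length_def algebra_simps)
  have "((\<lambda>ys. r ^ (i * Suc k) * (r ^ (2 * k + 1) * r ^ sum_list ys)) has_sum
       r ^ (i * Suc k) * (r ^ (2 * k + 1) * gap2_gf k r)) (gap2_length k)"
    using IH by (intro has_sum_cmult_right)
  then show ?inner
    by (rule has_sum_cong[THEN iffD1, rotated]) (simp only: sl power_add)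
  show ?outer
    using has_sum_cmult_left[OF has_sum_geometric_mult[OF r], of k "r ^ (2 * k + 1) * gap2_gf k r"]
    by (simp add: gap2_gf_Suc)
qed

text \<open>The two claims are proved together: the induction step at \<open>norm q\<close> has
  nonnegative terms and yields the absolute summability that lets the double sum at q be
  merged.\<close>

lemma has_sum_gap2_length:
  fixes q :: "'a :: {real_normed_field, banach}"
  assumes q: "norm q < 1"
  shows "((\<lambda>xs. norm q ^ sum_list xs) has_sum gap2_gf k (norm q)) (gap2_length k) \<and>
         ((\<lambda>xs. q ^ sum_list xs) has_sum gap2_gf k q) (gap2_length k)"
proof (induction k)
  case 0
  have "gap2_length 0 = {[]}" by (auto simp: gap2_length_def gap2_def)
  then show ?case using has_sum_finite[of "{[]}" "\<lambda>xs. norm q ^ sum_list xs"]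
      has_sum_finite[of "{[]}" "\<lambda>xs. q ^ sum_list xs"] by simp
next
  case (Suc k)
  define f :: "nat \<times> nat list \<Rightarrow> nat list"
    where "f = (\<lambda>(i, ys). map (\<lambda>a. a + (i + 2)) ys @ [i + 1])"
  have "norm (norm q) < 1" using q by simp
  note R = has_sum_gap2_length_aux[OF this conjunct1[OF Suc.IH], folded f_def]
  note C = has_sum_gap2_length_aux[OF q conjunct2[OF Suc.IH], folded f_def]
  have abs: "(\<lambda>p. norm q ^ sum_list (f p)) summable_on UNIV \<times> gap2_length k"
    by (rule summable_on_SigmaI[OF R(1) has_sum_imp_summable[OF R(2)]]) auto
  have "((\<lambda>p. norm q ^ sum_list (f p)) has_sum gap2_gf (Suc k) (norm q)) (UNIV \<times> gap2_length k)"
    by (rule has_sum_SigmaI[OF R(1) R(2) abs])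
  moreover have "(\<lambda>p. q ^ sum_list (f p)) summable_on UNIV \<times> gap2_length k"
    by (rule abs_summable_summable) (use abs in \<open>simp add: norm_power\<close>)
  then have "((\<lambda>p. q ^ sum_list (f p)) has_sum gap2_gf (Suc k) q) (UNIV \<times> gap2_length k)"
    by (rule has_sum_SigmaI[OF C(1) C(2)])
  ultimately show ?case
    using has_sum_reindex_bij_betw[OF bij_betw_gap2_length_Suc[of k, folded f_def], of "\<lambda>xs. norm q ^ sum_list xs"]
      has_sum_reindex_bij_betw[OF bij_betw_gap2_length_Suc[of k, folded f_def], of "\<lambda>xs. q ^ sum_list xs"]
    by simp
qed

lemma gap2_gf_pos: "0 < q \<Longrightarrow> q < 1 \<Longrightarrow> 0 < gap2_gf k (q::real)"
  unfolding gap2_gf_def by (intro divide_pos_pos prod_pos) (auto simp: power_less_one_iff)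

text \<open>The factor q^(2 k + 1) drives the ratio of consecutive terms to 0 whatever z is. Values
  z > 1 do occur, as exp (- v) with v negative.\<close>

lemma summable_gap2_gf:
  fixes q z :: real
  assumes "0 < q" "q < 1" "0 < z"
  shows "summable (\<lambda>k. real k * z ^ k * gap2_gf k q)" and "summable (\<lambda>k. z ^ k * gap2_gf k q)"
proof -
  have lim: "(\<lambda>k. (real (Suc k) + 1) / (real (Suc k)) * z * (q ^ (2 * Suc k + 1) / (1 - q ^ Suc (Suc k)))) \<longlonglongrightarrow> 1 * z * (0 / (1 - 0))"
  proof (intro tendsto_mult tendsto_divide tendsto_diff tendsto_const)
    show "(\<lambda>k. (real (Suc k) + 1) / real (Suc k)) \<longlonglongrightarrow> 1" by real_asymp
    show "(\<lambda>k. q ^ (2 * Suc k + 1)) \<longlonglongrightarrow> 0"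
      using assms by (intro LIMSEQ_power_zero[THEN filterlim_compose]) (auto simp: filterlim_subseq strict_mono_def)
    show "(\<lambda>k. q ^ Suc (Suc k)) \<longlonglongrightarrow> 0"
      using assms by (intro LIMSEQ_power_zero[THEN filterlim_compose]) (auto simp: filterlim_subseq strict_mono_def)
  qed auto
  then have "\<forall>\<^sub>F k in sequentially. (real (Suc k) + 1) / (real (Suc k)) * z * (q ^ (2 * Suc k + 1) / (1 - q ^ Suc (Suc k))) < 1/2"
    by (rule order_tendstoD) auto
  then obtain N where N: "\<And>k. k \<ge> N \<Longrightarrow> (real (Suc k) + 1) / (real (Suc k)) * z * (q ^ (2 * Suc k + 1) / (1 - q ^ Suc (Suc k))) < 1/2"
    by (auto simp: eventually_sequentially)
  show 1: "summable (\<lambda>k. real k * z ^ k * gap2_gf k q)"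
  proof (rule summable_ratio_test[of "1/2" "Suc N"])
    fix k assume "k \<ge> Suc N"
    then obtain m where k: "k = Suc m" and m: "m \<ge> N" by (cases k) auto
    have p: "0 < gap2_gf (Suc m) q" "0 < gap2_gf (Suc (Suc m)) q" using assms by (auto intro: gap2_gf_pos)
    have "real (Suc k) * z ^ Suc k * gap2_gf (Suc k) q =
       (real (Suc m) + 1) / (real (Suc m)) * z * (q ^ (2 * Suc m + 1) / (1 - q ^ Suc (Suc m))) * (real k * z ^ k * gap2_gf k q)"
      unfolding k gap2_gf_Suc[of "Suc m"] by (simp add: divide_simps del: power_Suc) (simp add: algebra_simps)
    also have "\<dots> \<le> 1/2 * (real k * z ^ k * gap2_gf k q)"
      using N[OF m] assms p k by (intro mult_right_mono) auto
    finally show "norm (real (Suc k) * z ^ Suc k * gap2_gf (Suc k) q) \<le> 1/2 * norm (real k * z ^ k * gap2_gf k q)"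
      using p k assms by simp
  qed auto
  show "summable (\<lambda>k. z ^ k * gap2_gf k q)"
  proof (rule summable_comparison_test'[OF 1, of 1])
    fix k :: nat assume "k \<ge> 1"
    then show "norm (z ^ k * gap2_gf k q) \<le> real k * z ^ k * gap2_gf k q"
      using gap2_gf_pos[of q k] assms by (simp add: mult_le_cancel_right1)
  qed
qed

text \<open>As a series in q, \<open>gap2_gf k\<close> has nonnegative coefficients, so this is the
  triangle inequality.\<close>

lemma norm_gap2_gf_le:
  fixes q :: "'a :: {real_normed_field, banach}"
  assumes "norm q < 1"
  shows "norm (gap2_gf k q) \<le> gap2_gf k (norm q)"
proof -
  from assms have "infsum (\<lambda>xs. q ^ sum_list xs) (gap2_length k) = gap2_gf k q"
    "infsum (\<lambda>xs. norm q ^ sum_list xs) (gap2_length k) = gap2_gf k (norm q)"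
    "(\<lambda>xs. norm q ^ sum_list xs) summable_on gap2_length k"
    using has_sum_gap2_length[of q k] by (auto simp: infsumI dest: has_sum_imp_summable)
  then show ?thesis
    using norm_infsum_bound[of "\<lambda>xs. q ^ sum_list xs" "gap2_length k"] by (simp add: norm_power)
qed

lemma summable_norm_gap2_gf:
  fixes q :: "'a :: {real_normed_field, banach}"
  assumes "0 < norm q" "norm q < 1"
  shows "summable (\<lambda>k. norm (of_nat k * gap2_gf k q))"
proof (rule summable_comparison_test')
  show "summable (\<lambda>k. real k * 1 ^ k * gap2_gf k (norm q))"
    using assms by (intro summable_gap2_gf) auto
  show "norm (norm (of_nat k * gap2_gf k q)) \<le> real k * 1 ^ k * gap2_gf k (norm q)" for k
    using norm_gap2_gf_le[OF assms(2)] by (simp add: norm_mult mult_left_mono)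
qed

text \<open>Every partition is weighted by its length. Grouping by length gives the right-hand side,
  grouping by size the left-hand side; summability at \<open>norm q\<close> justifies the
  regrouping.\<close>

lemma r1_gf:
  fixes q :: "'a :: {real_normed_field, banach}"
  assumes "0 < norm q" "norm q < 1"
  shows "(\<lambda>n. of_nat (r1 1 n) * q ^ n) sums (\<Sum>k. of_nat k * gap2_gf k q)"
proof -
  have S: "((\<lambda>k. of_nat k * gap2_gf k q) has_sum (\<Sum>k. of_nat k * gap2_gf k q)) UNIV"
    using assms by (intro norm_summable_imp_has_sum summable_sums summable_norm_gap2_gf summable_norm_cancel[OF summable_norm_gap2_gf]) auto
  have inner: "((\<lambda>xs. of_nat k * r ^ sum_list xs) has_sum of_nat k * gap2_gf k r) (gap2_length k)"
    if "norm r < 1" for k and r :: "'b :: {real_normed_field, banach}"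
    using has_sum_gap2_length[OF that] by (intro has_sum_cmult_right) auto
  have "(\<lambda>k. real k * gap2_gf k (norm q)) summable_on UNIV"
    using summable_norm_gap2_gf[of "norm q"] assms gap2_gf_pos[of "norm q"]
    by (intro norm_summable_imp_summable_on) (auto simp: abs_mult)
  then have abs: "(\<lambda>p. real (fst p) * norm q ^ sum_list (snd p)) summable_on Sigma UNIV gap2_length"
    using inner[of "norm q"] assms
    by (intro summable_on_SigmaI[where g = "\<lambda>k. real k * gap2_gf k (norm q)"]) auto
  have "(\<lambda>p. of_nat (fst p) * q ^ sum_list (snd p)) summable_on Sigma UNIV gap2_length"
    by (rule abs_summable_summable) (use abs in \<open>simp add: norm_mult norm_power\<close>)
  then have "((\<lambda>p. of_nat (fst p) * q ^ sum_list (snd p)) has_sum (\<Sum>k. of_nat k * gap2_gf k q))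
      (Sigma UNIV gap2_length)"
    using inner[of q] assms S
    by (intro has_sum_SigmaI[where g = "\<lambda>k. of_nat k * gap2_gf k q"]) auto
  also have "?this \<longleftrightarrow> ((\<lambda>p. of_nat (length (snd p)) * q ^ fst p) has_sum (\<Sum>k. of_nat k * gap2_gf k q))
      (Sigma UNIV gap2_partitions)"
    by (rule has_sum_reindex_bij_witness[of _ "\<lambda>(n, xs). (length xs, xs)" "\<lambda>(k, xs). (sum_list xs, xs)"])
      (auto simp: gap2_length_def gap2_partitions_eq)
  finally have 2: "((\<lambda>p. of_nat (length (snd p)) * q ^ fst p) has_sum (\<Sum>k. of_nat k * gap2_gf k q))
      (Sigma UNIV gap2_partitions)" .
  have "((\<lambda>n. of_nat (r1 1 n) * q ^ n) has_sum (\<Sum>k. of_nat k * gap2_gf k q)) UNIV"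
    by (rule has_sum_SigmaD[OF 2])
      (auto simp: r1_1_eq[unfolded One_nat_def] sum_distrib_right finite_gap2_partitions intro!: has_sum_finiteI)
  then show ?thesis by (rule has_sum_imp_sums)
qed

section \<open>The dilogarithm at the golden ratio\<close>

definition dilog :: "real \<Rightarrow> real" where
  "dilog y = (\<Sum>n. y ^ Suc n / (real (Suc n))\<^sup>2)"

lemma summable_inverse_Suc_squares: "summable (\<lambda>n. 1 / (real (Suc n))\<^sup>2)"
  using inverse_squares_sums by (auto simp: sums_iff add.commute)

lemma dilog_1: "dilog 1 = pi\<^sup>2 / 6"
  using inverse_squares_sums by (simp add: dilog_def sums_iff add.commute)

lemma dilog_0 [simp]: "dilog 0 = 0"
  by (simp add: dilog_def)

text \<open>The Weierstrass bound is uniform up to the endpoints, which \<open>DERIV_dilog\<close>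
  does not reach. The identities below are proved by a vanishing derivative in the interior and
  continuity at the ends.\<close>

lemma continuous_on_dilog: "continuous_on {-1..1} dilog"
proof (rule uniform_limit_theorem)
  show "uniform_limit {-1..1} (\<lambda>n y. \<Sum>k<n. y ^ Suc k / (real (Suc k))\<^sup>2) dilog sequentially"
    unfolding dilog_def
  proof (rule Weierstrass_m_test[OF _ summable_inverse_Suc_squares])
    fix n and y :: real assume "y \<in> {-1..1}"
    then have "\<bar>y\<bar> ^ Suc n \<le> 1" by (intro power_le_one) auto
    then show "norm (y ^ Suc n / (real (Suc n))\<^sup>2) \<le> 1 / (real (Suc n))\<^sup>2"
      by (simp add: power_abs abs_mult divide_right_mono del: power_Suc)
  qed
qed (auto intro!: always_eventually continuous_intros)

text \<open>Termwise differentiation gives the series of - ln (1 - y) / y. The point 0 is excluded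
  since the derivative there is 1, while the quotient evaluates to 0.\<close>

lemma DERIV_dilog:
  assumes "\<bar>y\<bar> < 1" "y \<noteq> 0"
  shows "(dilog has_real_derivative - ln (1 - y) / y) (at y)"
proof -
  let ?c = "\<lambda>n. if n = 0 then 0 else 1 / (real n)\<^sup>2"
  have *: "summable (\<lambda>n. ?c n * x ^ n)" if "\<bar>x\<bar> < 1" for x :: real
  proof (rule summable_comparison_test')
    show "summable (\<lambda>n. \<bar>x\<bar> ^ n)" using that by (intro summable_geometric) auto
    show "norm (?c n * x ^ n) \<le> \<bar>x\<bar> ^ n" for n
    proof (cases "n = 0")
      case False
      then have "1 \<le> (real n)\<^sup>2" by (intro one_le_power) auto
      then have "\<bar>?c n\<bar> \<le> 1" by (simp add: divide_le_eq)
      then have "\<bar>?c n\<bar> * \<bar>x\<bar> ^ n \<le> \<bar>x\<bar> ^ n" by (intro mult_left_le_one_le) auto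
      then show ?thesis by (simp only: real_norm_def abs_mult power_abs)
    qed simp
  qed
  have eq: "dilog x = (\<Sum>n. ?c n * x ^ n)" if "\<bar>x\<bar> < 1" for x
    using suminf_split_head[OF *[OF that]] by (simp add: dilog_def)
  have "((\<lambda>x. \<Sum>n. ?c n * x ^ n) has_real_derivative (\<Sum>n. diffs ?c n * y ^ n)) (at y)"
    by (rule termdiffs_strong'[of 1]) (use * assms in auto)
  moreover have "(\<lambda>n. diffs ?c n * y ^ n) sums (- ln (1 - y) / y)"
  proof -
    have "(\<lambda>n. - ((- (- y)) ^ n) / of_nat n) sums ln (1 + (- y))"
      using assms by (intro Complex_Transcendental.ln_series') auto
    from sums_minus[OF this] have "(\<lambda>n. y ^ n / of_nat n) sums - ln (1 - y)" by simp
    then have "(\<lambda>n. y ^ Suc n / of_nat (Suc n)) sums - ln (1 - y)"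
      by (subst sums_Suc_iff) simp
    then have "(\<lambda>n. y ^ Suc n / of_nat (Suc n) / y) sums (- ln (1 - y) / y)"
      by (rule sums_divide)
    then show ?thesis
      by (rule sums_cong[THEN iffD1, rotated])
        (use assms in \<open>simp add: diffs_def power2_eq_square divide_simps\<close>)
  qed
  ultimately have "((\<lambda>x. \<Sum>n. ?c n * x ^ n) has_real_derivative (- ln (1 - y) / y)) (at y)"
    by (simp add: sums_iff)
  moreover have "\<forall>\<^sub>F x in nhds y. dilog x = (\<Sum>n. ?c n * x ^ n)"
  proof (rule eventually_mono)
    show "\<forall>\<^sub>F x in nhds y. x \<in> {-1<..<1}"
      using assms by (intro eventually_nhds_in_open) auto
  qed (auto intro: eq)
  ultimately show ?thesis by (subst DERIV_cong_ev[OF refl _ refl])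
qed

lemma DERIV_dilog' [derivative_intros]:
  assumes "(f has_real_derivative f') (at x)" "\<bar>f x\<bar> < 1" "f x \<noteq> 0"
  shows "((\<lambda>x. dilog (f x)) has_real_derivative - ln (1 - f x) / f x * f') (at x)"
  using DERIV_chain2[OF DERIV_dilog assms(1)] assms by auto

text \<open>The derivatives of the three terms cancel, and all terms vanish at 0. The bound 1/2
  keeps - y / (1 - y) in the interval [-1, 0], where the series is continuous.\<close>

lemma dilog_landen:
  assumes "0 < y" "y \<le> 1/2"
  shows "dilog y + dilog (- y / (1 - y)) = - (ln (1 - y))\<^sup>2 / 2"
proof -
  let ?f = "\<lambda>y. dilog y + dilog (- y / (1 - y)) + (ln (1 - y))\<^sup>2 / 2"
  have "?f y = ?f 0"
  proof (rule DERIV_isconst_end[OF assms(1)])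
    show "continuous_on {0..y} ?f" using assms
      by (intro continuous_intros continuous_on_compose2[OF continuous_on_dilog]) (auto simp: field_simps)
    fix t assume t: "0 < t" "t < y"
    then have "ln (1 - (- t / (1 - t))) = - ln (1 - t)"
      using assms by (subst ln_inverse[symmetric]) (auto simp: field_simps)
    moreover have "((\<lambda>y. - y / (1 - y)) has_real_derivative - 1 / (1 - t)\<^sup>2) (at t)"
      using t assms by (auto intro!: derivative_eq_intros simp: power2_eq_square)
    then have "(?f has_real_derivative - ln (1 - t) / t * 1
        + - ln (1 - (- t / (1 - t))) / (- t / (1 - t)) * (- 1 / (1 - t)\<^sup>2)
        + 2 * ln (1 - t) * (- 1 / (1 - t)) / 2) (at t)"
      using t assms by (intro derivative_intros DERIV_dilog') (auto intro!: derivative_eq_intros simp: field_simps)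
    moreover have "- l / t * 1 + - (- l) / (- t / (1 - t)) * (- 1 / (1 - t)\<^sup>2)
        + 2 * l * (- 1 / (1 - t)) / 2 = 0" for l
      using t assms by (simp add: divide_simps power2_eq_square) (simp add: algebra_simps)
    ultimately show "(?f has_real_derivative 0) (at t)" by simp
  qed
  then show ?thesis by simp
qed

lemma dilog_duplication:
  assumes "0 < y" "y < 1"
  shows "dilog y + dilog (- y) = dilog (y\<^sup>2) / 2"
proof -
  let ?f = "\<lambda>y. dilog y + dilog (- y) - dilog (y\<^sup>2) / 2"
  have "?f y = ?f 0"
  proof (rule DERIV_isconst_end[OF assms(1)])
    have sq: "- 1 \<le> t\<^sup>2" for t :: real using zero_le_power2[of t] by linarith
    show "continuous_on {0..y} ?f" using assms
      by (intro continuous_intros continuous_on_compose2[OF continuous_on_dilog])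
        (auto simp: power_le_one sq)
    fix t assume t: "0 < t" "t < y"
    have "ln (1 - t\<^sup>2) = ln (1 - t) + ln (1 + t)"
      using t assms by (subst ln_mult_pos[symmetric]) (auto simp: field_simps power2_eq_square)
    moreover have "t\<^sup>2 < 1" using t assms by (simp add: power_less_one_iff)
    ultimately show "(?f has_real_derivative 0) (at t)" using t assms
      by (auto intro!: derivative_eq_intros simp: field_simps power2_eq_square)
  qed
  then show ?thesis by simp
qed

text \<open>Since ln y is singular at 0, constancy is shown on [a, y] and a is sent to 0. There ln a
  * ln (1 - a) vanishes in the limit and the constant becomes \<open>dilog 1\<close>.\<close>

lemma dilog_reflection:
  assumes "0 < y" "y < 1"
  shows "dilog y + dilog (1 - y) = pi\<^sup>2 / 6 - ln y * ln (1 - y)"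
proof -
  let ?f = "\<lambda>y. dilog y + dilog (1 - y) + ln y * ln (1 - y)"
  have const: "?f y = ?f a" if "0 < a" "a < y" for a
  proof (rule DERIV_isconst_end[OF that(2)])
    show "continuous_on {a..y} ?f" using assms that
      by (intro continuous_intros continuous_on_compose2[OF continuous_on_dilog]) auto
    fix t assume t: "a < t" "t < y"
    then have "(?f has_real_derivative - ln (1 - t) / t * 1 + - ln (1 - (1 - t)) / (1 - t) * (- 1)
        + (1 / t * ln (1 - t) + - 1 / (1 - t) * ln t)) (at t)" using that assms
      by (auto intro!: derivative_eq_intros)
    then show "(?f has_real_derivative 0) (at t)" using t by simp
  qed
  have dilog_lim: "(dilog \<longlongrightarrow> dilog c) (at c within {-1..1})" if "c \<in> {-1..1}" for c
    using continuous_on_dilog that by (auto simp: continuous_on_def)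
  have ev: "\<forall>\<^sub>F a in at_right 0. 0 < a \<and> a < y"
    using eventually_at_right_less eventually_at_right[OF assms(1)] assms by (auto simp: eventually_conj_iff)
  have "(?f \<longlongrightarrow> dilog 0 + dilog 1 + 0) (at_right 0)"
  proof (intro tendsto_add)
    show "(dilog \<longlongrightarrow> dilog 0) (at_right 0)"
      by (rule filterlim_compose[OF dilog_lim]) (use ev assms in \<open>auto simp: filterlim_at elim!: eventually_mono\<close>)
    show "((\<lambda>y. dilog (1 - y)) \<longlongrightarrow> dilog 1) (at_right 0)"
    proof (rule filterlim_compose[OF dilog_lim])
      have "((\<lambda>y. 1 - y) \<longlongrightarrow> 1 - 0) (at_right (0::real))" by (intro tendsto_intros)
      then show "filterlim (\<lambda>y. 1 - y) (at 1 within {-1..1}) (at_right (0::real))"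
        using ev assms by (auto simp: filterlim_at elim!: eventually_mono)
    qed auto
    show "((\<lambda>y. ln y * ln (1 - y)) \<longlongrightarrow> 0) (at_right (0::real))" by real_asymp
  qed
  moreover have "(?f \<longlongrightarrow> ?f y) (at_right 0)"
    by (rule tendsto_eventually) (use ev const in \<open>auto elim!: eventually_mono\<close>)
  ultimately have "?f y = dilog 0 + dilog 1 + 0"
    by (intro tendsto_unique[of "at_right 0"]) auto
  then show ?thesis by (simp add: dilog_1)
qed

section \<open>The golden ratio and its dilogarithm value\<close>

lemma golden_ratio_gt_1: "golden_ratio > 1" and golden_ratio_less_2: "golden_ratio < 2"
proof -
  have "sqrt 5 > 1" "sqrt 5 < 3" by (auto intro: real_less_rsqrt real_less_lsqrt)
  then show "golden_ratio > 1" "golden_ratio < 2" by (auto simp: golden_ratio_def)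
qed

lemma golden_ratio_square: "golden_ratio\<^sup>2 = golden_ratio + 1"
  by (simp add: golden_ratio_def power2_eq_square field_simps)

text \<open>Reflection at \<open>1/\<phi>\<close>, duplication at \<open>1/\<phi>\<close> and Landen's identity at \<open>1/\<phi>\<^sup>2\<close> are three
  linear equations for the dilogarithm at \<open>1/\<phi>\<close>, \<open>1/\<phi>\<^sup>2\<close> and \<open>-1/\<phi>\<close>.\<close>

lemma dilog_minus_inverse_golden_ratio:
  "dilog (1 - golden_ratio) = (ln golden_ratio)\<^sup>2 / 2 - pi\<^sup>2 / 15"
proof -
  define r L where "r = golden_ratio - 1" and "L = ln golden_ratio"
  note g = golden_ratio_gt_1 golden_ratio_less_2
  have r: "0 < r" "r < 1" and r2: "r\<^sup>2 = 1 - r"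
    using g golden_ratio_square by (auto simp: r_def power2_eq_square algebra_simps)
  have "r * golden_ratio = 1" using golden_ratio_square by (simp add: r_def power2_eq_square algebra_simps)
  then have "r = inverse golden_ratio" using g by (simp add: field_simps)
  then have lr: "ln r = - L" using g by (simp add: ln_inverse L_def)
  have l1r: "ln (1 - r) = - 2 * L" using r lr unfolding r2[symmetric] by (simp add: ln_realpow)
  have "1 - r \<le> 1/2"
  proof (rule ccontr)
    assume "\<not> 1 - r \<le> 1/2"
    then have "r * r < 1/2 * (1/2)" using r by (intro mult_strict_mono) auto
    with r2 show False using \<open>\<not> 1 - r \<le> 1/2\<close> by (simp add: power2_eq_square)
  qed
  then have "dilog (1 - r) + dilog (- (1 - r) / r) = - L\<^sup>2 / 2"
    using dilog_landen[of "1 - r"] r lr by simp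
  moreover have "- (1 - r) / r = - r" using r r2 by (simp add: field_simps power2_eq_square)
  moreover have "dilog r + dilog (- r) = dilog (1 - r) / 2" using dilog_duplication[of r] r r2 by simp
  moreover have "dilog r + dilog (1 - r) = pi\<^sup>2 / 6 - 2 * L\<^sup>2"
    using dilog_reflection[of r] r lr l1r by (simp add: power2_eq_square)
  ultimately have "dilog (- r) = L\<^sup>2 / 2 - pi\<^sup>2 / 15" by simp
  then show ?thesis by (simp add: r_def L_def)
qed

section \<open>The limiting ratio of the generating function\<close>

definition saddle :: "real \<Rightarrow> real" where
  "saddle v = (1 + sqrt (1 + 4 * exp (- v))) / 2"

lemma saddle_0: "saddle 0 = golden_ratio"
  by (simp add: saddle_def golden_ratio_def)

lemma saddle_gt_1: "1 < saddle v"
  by (simp add: saddle_def)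

lemma saddle_square: "saddle v * (saddle v - 1) = exp (- v)"
proof -
  have "(sqrt (1 + 4 * exp (- v)))\<^sup>2 = 1 + 4 * exp (- v)" by (intro real_sqrt_pow2) (simp add: add_nonneg_nonneg)
  then show ?thesis by (simp add: saddle_def power2_eq_square field_simps)
qed

lemma saddle_le: "saddle v - 1 \<le> exp (- v)"
  using saddle_gt_1[of v] unfolding saddle_square[symmetric] by simp

lemma exp_minus_less_2: "- 1 / 2 \<le> v \<Longrightarrow> exp (- v) < (2::real)"
proof -
  assume "- 1 / 2 \<le> v"
  then have "exp (- v) \<le> exp (1 / 2)" by simp
  also have "exp (1 / 2 :: real) \<le> 1 + 1 / 2 + (1 / 2)\<^sup>2" by (rule exp_bound) auto
  also have "\<dots> < 2" by (simp add: power2_eq_square)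
  finally show ?thesis .
qed

lemma saddle_less_2:
  assumes "- 1 / 2 \<le> v" shows "saddle v < 2"
proof (rule ccontr)
  assume "\<not> saddle v < 2"
  then have "2 * 1 \<le> saddle v * (saddle v - 1)" by (intro mult_mono) auto
  with exp_minus_less_2[OF assms] show False by (simp add: saddle_square)
qed

lemma DERIV_saddle: "(saddle has_real_derivative - exp (- v) / (2 * saddle v - 1)) (at v)"
proof -
  have "0 < 1 + 4 * exp (- v)" by (simp add: add_pos_pos)
  then have "((\<lambda>v. (1 + sqrt (1 + 4 * exp (- v))) / 2) has_real_derivative - exp (- v) / sqrt (1 + 4 * exp (- v))) (at v)"
    by (auto intro!: derivative_eq_intros simp: field_simps)
  moreover have "2 * saddle v - 1 = sqrt (1 + 4 * exp (- v))" by (simp add: saddle_def field_simps)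
  ultimately show ?thesis by (simp add: saddle_def[abs_def])
qed

lemma DERIV_saddle' [derivative_intros]:
  "(f has_real_derivative f') (at x) \<Longrightarrow>
   ((\<lambda>x. saddle (f x)) has_real_derivative - exp (- f x) / (2 * saddle (f x) - 1) * f') (at x)"
  by (rule DERIV_chain2[OF DERIV_saddle])

text \<open>\<open>saddle v\<close> is the positive root of \<open>h\<^sup>2 = h + exp (- v)\<close>, the limit as \<open>x\<close> tends to 0 of the ratio
  \<open>G v / G (v + x)\<close> for solutions of \<open>G v = G (v + x) + exp (- (v + x)) * G (v + 2 * x)\<close>.
  The factor \<open>exp (log_prefactor v)\<close> is the next-order correction: it makes the terms of order \<open>x\<close>
  cancel when \<open>exp (saddle_integral v / x + log_prefactor v)\<close> is substituted for \<open>G v\<close>.\<close>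

definition ln_saddle :: "real \<Rightarrow> real" where "ln_saddle v = ln (saddle v)"
definition ln_saddle_deriv :: "real \<Rightarrow> real" where "ln_saddle_deriv v = - (saddle v - 1) / (2 * saddle v - 1)"
definition log_prefactor :: "real \<Rightarrow> real" where "log_prefactor v = (ln (saddle v) - ln (2 * saddle v - 1)) / 2"
definition log_prefactor_deriv :: "real \<Rightarrow> real" where "log_prefactor_deriv v = (saddle v - 1) / (2 * (2 * saddle v - 1)\<^sup>2)"
text \<open>A closed form of the integral of \<open>ln_saddle\<close> over [v, infinity): for v at
  least -1/2 its derivative is \<open>- ln_saddle v\<close>, and it tends to 0 at infinity.\<close>

definition saddle_integral :: "real \<Rightarrow> real" where "saddle_integral v = (ln_saddle v)\<^sup>2 / 2 - dilog (1 - saddle v)"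

text \<open>The squared logarithm in the dilogarithm value cancels against the one in the
  definition.\<close>

lemma saddle_integral_0: "saddle_integral 0 = pi\<^sup>2 / 15"
  by (simp add: saddle_integral_def ln_saddle_def saddle_0 dilog_minus_inverse_golden_ratio)

lemma DERIV_ln_saddle: "(ln_saddle has_real_derivative ln_saddle_deriv v) (at v)"
proof -
  have "(ln_saddle has_real_derivative 1 / saddle v * (- exp (- v) / (2 * saddle v - 1))) (at v)"
    unfolding ln_saddle_def[abs_def] using saddle_gt_1[of v] by (auto intro!: derivative_eq_intros)
  also have "1 / saddle v * (- exp (- v) / (2 * saddle v - 1)) = ln_saddle_deriv v"
    using saddle_gt_1[of v] by (simp add: saddle_square[symmetric] ln_saddle_deriv_def field_simps)
  finally show ?thesis .
qed

lemma DERIV_ln_saddle_deriv: "(ln_saddle_deriv has_real_derivative exp (- v) / (2 * saddle v - 1) ^ 3) (at v)"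
proof -
  define h z where "h = saddle v" and "z = exp (- v)"
  have h: "h > 1" using saddle_gt_1 by (simp add: h_def)
  have "(ln_saddle_deriv has_real_derivative
      ((- (- z / (2 * h - 1))) * (2 * h - 1) - (- (h - 1)) * (2 * (- z / (2 * h - 1)))) / ((2 * h - 1) * (2 * h - 1))) (at v)"
    unfolding ln_saddle_deriv_def[abs_def] using h unfolding h_def z_def by (auto intro!: derivative_eq_intros)
  also have "((- (- z / (2 * h - 1))) * (2 * h - 1) - (- (h - 1)) * (2 * (- z / (2 * h - 1)))) / ((2 * h - 1) * (2 * h - 1)) = z / (2 * h - 1) ^ 3"
    using h by (simp add: divide_simps power3_eq_cube) (simp add: algebra_simps)
  finally show ?thesis by (simp add: h_def z_def)
qed

lemma DERIV_log_prefactor: "(log_prefactor has_real_derivative log_prefactor_deriv v) (at v)"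
proof -
  define h z where "h = saddle v" and "z = exp (- v)"
  have h: "h > 1" using saddle_gt_1 by (simp add: h_def)
  have z: "z = h * (h - 1)" by (simp add: z_def h_def saddle_square)
  have "(log_prefactor has_real_derivative
      (1 / h * (- z / (2 * h - 1)) - 1 / (2 * h - 1) * (2 * (- z / (2 * h - 1)))) / 2) (at v)"
    unfolding log_prefactor_def[abs_def] using h unfolding h_def z_def by (auto intro!: derivative_eq_intros)
  also have "(1 / h * (- z / (2 * h - 1)) - 1 / (2 * h - 1) * (2 * (- z / (2 * h - 1)))) / 2 = (h - 1) / (2 * (2 * h - 1)\<^sup>2)"
    using h unfolding z by (simp add: divide_simps power2_eq_square) (simp add: algebra_simps)
  finally show ?thesis by (simp add: h_def log_prefactor_deriv_def)
qed

lemma DERIV_log_prefactor_deriv: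
  "(log_prefactor_deriv has_real_derivative - exp (- v) * (3 - 2 * saddle v) / (2 * (2 * saddle v - 1) ^ 4)) (at v)"
proof -
  define h z where "h = saddle v" and "z = exp (- v)"
  have h: "h > 1" using saddle_gt_1 by (simp add: h_def)
  let ?h' = "- z / (2 * h - 1)"
  have "(log_prefactor_deriv has_real_derivative
      (?h' * (2 * (2 * h - 1)\<^sup>2) - (h - 1) * (2 * (2 * (2 * h - 1) * (2 * ?h')))) / ((2 * (2 * h - 1)\<^sup>2) * (2 * (2 * h - 1)\<^sup>2))) (at v)"
    unfolding log_prefactor_deriv_def[abs_def] using h unfolding h_def z_def by (auto intro!: derivative_eq_intros simp: field_simps)
  also have "(?h' * (2 * (2 * h - 1)\<^sup>2) - (h - 1) * (2 * (2 * (2 * h - 1) * (2 * ?h')))) / ((2 * (2 * h - 1)\<^sup>2) * (2 * (2 * h - 1)\<^sup>2))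
      = - z * (3 - 2 * h) / (2 * (2 * h - 1) ^ 4)"
  proof -
    \<comment> \<open>In terms of d all denominators are powers of a single variable, so clearing
      them leaves a polynomial identity.\<close>
    define d where "d = 2 * h - 1"
    have hd: "h = (d + 1) / 2" and "d > 0" using h by (auto simp: d_def)
    then show ?thesis unfolding d_def[symmetric] unfolding hd
      by (simp add: divide_simps power2_eq_square power4_eq_xxxx) (simp add: algebra_simps)
  qed
  finally show ?thesis by (simp add: h_def z_def)
qed

lemma DERIV_saddle_integral:
  assumes "- 1 / 2 \<le> v" shows "(saddle_integral has_real_derivative - ln_saddle v) (at v)"
proof -
  define h z where "h = saddle v" and "z = exp (- v)"
  have h: "h > 1" "h < 2" using saddle_gt_1 saddle_less_2[OF assms] by (simp_all add: h_def)
  have z: "z = h * (h - 1)" by (simp add: z_def h_def saddle_square)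
  have "((\<lambda>v. (ln_saddle v)\<^sup>2 / 2) has_real_derivative ln h * ln_saddle_deriv v) (at v)"
    using DERIV_cdivide[OF DERIV_power[OF DERIV_ln_saddle[of v], of 2], of 2] by (simp add: ln_saddle_def h_def mult.commute)
  moreover have "((\<lambda>v. dilog (1 - saddle v)) has_real_derivative
      - ln (1 - (1 - h)) / (1 - h) * (- (- z / (2 * h - 1)))) (at v)"
    using h unfolding h_def z_def by (auto intro!: derivative_eq_intros)
  ultimately have "(saddle_integral has_real_derivative
     ln h * ln_saddle_deriv v - - ln (1 - (1 - h)) / (1 - h) * (- (- z / (2 * h - 1)))) (at v)"
    unfolding saddle_integral_def[abs_def] by (rule DERIV_diff)
  also have "ln h * ln_saddle_deriv v - - ln (1 - (1 - h)) / (1 - h) * (- (- z / (2 * h - 1))) = - ln h"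
    using h unfolding z ln_saddle_deriv_def h_def[symmetric]
    by (simp add: divide_simps) (simp add: algebra_simps)
  finally show ?thesis by (simp add: h_def ln_saddle_def)
qed

lemma log_prefactor_0: "exp (log_prefactor 0) = sqrt (golden_ratio / sqrt 5)"
proof -
  have "2 * golden_ratio - 1 = sqrt 5" by (simp add: golden_ratio_def field_simps)
  then have "log_prefactor 0 = ln (golden_ratio / sqrt 5) / 2"
    using golden_ratio_gt_1 by (simp add: log_prefactor_def saddle_0 ln_div)
  moreover have "0 < golden_ratio / sqrt 5" using golden_ratio_gt_1 by simp
  ultimately show ?thesis using golden_ratio_gt_1 by (simp add: powr_half_sqrt[symmetric] powr_def mult.commute)
qed

section \<open>Taylor estimates with explicit remainders\<close>

lemma Taylor_bound_2:
  fixes g :: "real \<Rightarrow> real"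
  assumes "0 < y"
    and "\<And>t. v \<le> t \<Longrightarrow> t \<le> v + y \<Longrightarrow> (g has_real_derivative g1 t) (at t)"
    and "\<And>t. v \<le> t \<Longrightarrow> t \<le> v + y \<Longrightarrow> (g1 has_real_derivative g2 t) (at t)"
    and "\<And>t. v \<le> t \<Longrightarrow> t \<le> v + y \<Longrightarrow> \<bar>g2 t\<bar> \<le> M"
  shows "\<bar>g (v + y) - g v - y * g1 v\<bar> \<le> M * y\<^sup>2 / 2"
proof -
  define d where "d = (\<lambda>m::nat. if m = 0 then g else if m = 1 then g1 else g2)"
  have "\<exists>t>v. t < v + y \<and> g (v + y) = (\<Sum>m<2. d m v / fact m * (v + y - v) ^ m) + d 2 t / fact 2 * (v + y - v) ^ 2"
    by (rule Taylor_up[where a = v]) (use assms in \<open>auto simp: d_def less_2_cases_iff\<close>)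
  then obtain t where t: "v < t" "t < v + y" "g (v + y) = g v + y * g1 v + g2 t / 2 * y\<^sup>2"
    by (auto simp: d_def numeral_2_eq_2)
  have "\<bar>g2 t\<bar> * y\<^sup>2 \<le> M * y\<^sup>2" using assms(4)[of t] t by (intro mult_right_mono) auto
  then show ?thesis using t(3) by (simp add: abs_mult)
qed

lemma Taylor_bound_3:
  fixes g :: "real \<Rightarrow> real"
  assumes "0 < y"
    and "\<And>t. v \<le> t \<Longrightarrow> t \<le> v + y \<Longrightarrow> (g has_real_derivative g1 t) (at t)"
    and "\<And>t. v \<le> t \<Longrightarrow> t \<le> v + y \<Longrightarrow> (g1 has_real_derivative g2 t) (at t)"
    and "\<And>t. v \<le> t \<Longrightarrow> t \<le> v + y \<Longrightarrow> (g2 has_real_derivative g3 t) (at t)"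
    and "\<And>t. v \<le> t \<Longrightarrow> t \<le> v + y \<Longrightarrow> \<bar>g3 t\<bar> \<le> M"
  shows "\<bar>g (v + y) - g v - y * g1 v - y\<^sup>2 / 2 * g2 v\<bar> \<le> M * y ^ 3 / 6"
proof -
  define d where "d = (\<lambda>m::nat. if m = 0 then g else if m = 1 then g1 else if m = 2 then g2 else g3)"
  have "\<exists>t>v. t < v + y \<and> g (v + y) = (\<Sum>m<3. d m v / fact m * (v + y - v) ^ m) + d 3 t / fact 3 * (v + y - v) ^ 3"
  proof (rule Taylor_up[where a = v])
    have "m = 0 \<or> m = 1 \<or> m = 2" if "m < 3" for m :: nat using that by auto
    then show "\<forall>m t. m < 3 \<and> v \<le> t \<and> t \<le> v + y \<longrightarrow> (d m has_real_derivative d (Suc m) t) (at t)"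
      using assms by (fastforce simp: d_def)
  qed (use assms in \<open>auto simp: d_def\<close>)
  then obtain t where t: "v < t" "t < v + y" "g (v + y) = g v + y * g1 v + y\<^sup>2 / 2 * g2 v + g3 t / 6 * y ^ 3"
    by (auto simp: d_def numeral_2_eq_2 numeral_3_eq_3)
  have "\<bar>g3 t\<bar> * y ^ 3 \<le> M * y ^ 3" using assms(5)[of t] assms(1) t by (intro mult_right_mono) auto
  then show ?thesis using t(3) assms(1) by (simp add: abs_mult)
qed

lemma abs_exp_minus_1_minus_le:
  fixes y :: real
  assumes "\<bar>y\<bar> \<le> 1" shows "\<bar>exp y - 1 - y\<bar> \<le> y\<^sup>2"
proof -
  have "exp y \<le> 1 + y + y\<^sup>2"
  proof (cases "0 \<le> y")
    case False
    define s where "s = - y"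
    have s: "0 \<le> s" using False by (simp add: s_def)
    have pos: "0 < 1 - s + s\<^sup>2" using s assms False
      by (cases "s = 1") (auto simp: s_def add_pos_nonneg)
    \<comment> \<open>For y = - s the claim is 1 <= (1 - s + s^2) exp s; the quadratic Taylor
      polynomial of exp s already suffices.\<close>
    have "1 \<le> (1 - s + s\<^sup>2) * (1 + s + s\<^sup>2 / 2)"
    proof -
      have "(1 - s + s\<^sup>2) * (1 + s + s\<^sup>2 / 2) = 1 + (s\<^sup>2 + s ^ 3 + s ^ 4) / 2"
        by (simp add: field_simps power2_eq_square power3_eq_cube power4_eq_xxxx)
      then show ?thesis using s by simp
    qed
    also have "\<dots> \<le> (1 - s + s\<^sup>2) * exp s"
      using exp_lower_Taylor_quadratic[OF s] pos by (intro mult_left_mono) auto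
    finally have "exp (- s) \<le> 1 - s + s\<^sup>2" by (simp add: exp_minus field_simps)
    then show ?thesis by (simp add: s_def)
  qed (use exp_bound assms in auto)
  then show ?thesis using exp_ge_add_one_self[of y] zero_le_power2[of y] by linarith
qed

section \<open>Approximate solution of the recurrence\<close>

definition length_gf_approx :: "real \<Rightarrow> real \<Rightarrow> real" where
  "length_gf_approx x v = exp (saddle_integral v / x + log_prefactor v)"

text \<open>Expanding the exponent to order x turns the two quotients into (1/h)(1 + \<alpha>) and
  (z/h^2)(1 + \<beta>), which add up to exactly 1. All remainders carry a factor z = exp (- v): in
  the first quotient because the derivatives of \<open>ln_saddle\<close> and
  \<open>log_prefactor\<close> are O(z), in the second because z stands in front.\<close>

lemma length_gf_approx_recurrence:
  assumes x: "0 < x" "x \<le> 1 / 10" and v: "- 1 / 2 \<le> v"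
  shows "\<bar>length_gf_approx x (v + x) / length_gf_approx x v + exp (- (v + x)) * length_gf_approx x (v + 2 * x) / length_gf_approx x v - 1\<bar>
     \<le> 50 * x\<^sup>2 * exp (- v)"
proof -
  define h z where "h = saddle v" and "z = exp (- v)"
  have h: "h > 1" "h < 2" using saddle_gt_1 saddle_less_2[OF v] by (simp_all add: h_def)
  have z: "z = h * (h - 1)" by (simp add: z_def h_def saddle_square)
  have z0: "0 < z" "z < 2" using exp_minus_less_2[OF v] by (simp_all add: z_def)
  have le1: "exp (- t) \<le> z" if "v \<le> t" for t using that by (simp add: z_def)
  have b3: "\<bar>- exp (- t) / (2 * saddle t - 1) ^ 3\<bar> \<le> z" if "v \<le> t" for t
  proof -
    have "1 \<le> (2 * saddle t - 1) ^ 3" using saddle_gt_1[of t] by (intro one_le_power) auto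
    then have "exp (- t) / (2 * saddle t - 1) ^ 3 \<le> exp (- t) / 1" using saddle_gt_1[of t] by (intro divide_left_mono) auto
    with le1[OF that] saddle_gt_1[of t] show ?thesis by (simp add: abs_divide)
  qed
  have b2: "\<bar>- exp (- t) * (3 - 2 * saddle t) / (2 * (2 * saddle t - 1) ^ 4)\<bar> \<le> z" if "v \<le> t" for t
  proof -
    have P: "1 \<le> (2 * saddle t - 1) ^ 4" using saddle_gt_1[of t] by (intro one_le_power) auto
    have "\<bar>3 - 2 * saddle t\<bar> \<le> 1" using saddle_gt_1[of t] saddle_less_2[of t] v that by auto
    then have "\<bar>- exp (- t) * (3 - 2 * saddle t)\<bar> \<le> exp (- t)" by (simp add: abs_mult mult_left_le)
    moreover have "1 \<le> \<bar>2 * (2 * saddle t - 1) ^ 4\<bar>" using P by linarith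
    ultimately have "\<bar>- exp (- t) * (3 - 2 * saddle t)\<bar> / \<bar>2 * (2 * saddle t - 1) ^ 4\<bar> \<le> exp (- t) / 1"
      by (intro frac_le) auto
    with le1[OF that] show ?thesis by (simp only: abs_divide) 
  qed
  have Ti: "\<bar>saddle_integral (v + y) - saddle_integral v - y * (- ln_saddle v) - y\<^sup>2 / 2 * (- ln_saddle_deriv v)\<bar> \<le> z * y ^ 3 / 6" if "0 < y" for y
  proof (rule Taylor_bound_3[OF that])
    fix t assume t: "v \<le> t"
    show "(saddle_integral has_real_derivative - ln_saddle t) (at t)" using DERIV_saddle_integral t v by simp
    show "((\<lambda>t. - ln_saddle t) has_real_derivative - ln_saddle_deriv t) (at t)" by (intro DERIV_minus DERIV_ln_saddle)
    show "((\<lambda>t. - ln_saddle_deriv t) has_real_derivative - exp (- t) / (2 * saddle t - 1) ^ 3) (at t)"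
      using DERIV_minus[OF DERIV_ln_saddle_deriv[of t]] by simp
    show "\<bar>- exp (- t) / (2 * saddle t - 1) ^ 3\<bar> \<le> z" by (rule b3[OF t])
  qed
  have Tp: "\<bar>log_prefactor (v + y) - log_prefactor v - y * log_prefactor_deriv v\<bar> \<le> z * y\<^sup>2 / 2" if "0 < y" for y
    by (rule Taylor_bound_2[OF that DERIV_log_prefactor DERIV_log_prefactor_deriv b2])
  define l l1 p1 where "l = ln_saddle v" and "l1 = ln_saddle_deriv v" and "p1 = log_prefactor_deriv v"
  have el: "exp (- l) = 1 / h" using h by (simp add: l_def ln_saddle_def exp_minus h_def divide_inverse)
  have hz: "h - 1 \<le> z" using saddle_le[of v] by (simp add: h_def z_def)
  have l1: "\<bar>l1\<bar> \<le> h - 1" "\<bar>l1\<bar> \<le> 1 / 2"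
    using h unfolding l1_def ln_saddle_deriv_def h_def[symmetric] by (auto simp: abs_divide divide_simps mult_le_cancel_left1)
  have p1: "\<bar>p1\<bar> \<le> h - 1"
  proof -
    have "1 \<le> (2 * h - 1)\<^sup>2" using h by (intro one_le_power) auto
    then have "1 \<le> 2 * (2 * h - 1)\<^sup>2" by linarith
    then have "(h - 1) / (2 * (2 * h - 1)\<^sup>2) \<le> (h - 1) / 1" using h by (intro frac_le) auto
    with h show ?thesis by (simp add: p1_def log_prefactor_deriv_def h_def[symmetric])
  qed
  \<comment> \<open>These are the terms of order x in the exponents. The summand -1 in \<beta>
    accounts for the part exp (- x) of the factor exp (- (v + x)); this is why r2 subtracts \<beta>
    + x.\<close>
  define \<alpha> \<beta> where "\<alpha> = x * (- l1 / 2 + p1)" and "\<beta> = x * (- 2 * l1 + 2 * p1 - 1)"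
  define r1 r2 where
    "r1 = (saddle_integral (v + x) - saddle_integral v) / x + (log_prefactor (v + x) - log_prefactor v) + l - \<alpha>" and
    "r2 = (saddle_integral (v + 2 * x) - saddle_integral v) / x + (log_prefactor (v + 2 * x) - log_prefactor v) + 2 * l - (\<beta> + x)"
  have r1: "\<bar>r1\<bar> \<le> z * x\<^sup>2"
  proof -
    have "r1 = (saddle_integral (v + x) - saddle_integral v - x * (- ln_saddle v) - x\<^sup>2 / 2 * (- ln_saddle_deriv v)) / x + (log_prefactor (v + x) - log_prefactor v - x * log_prefactor_deriv v)"
      using x by (simp add: r1_def \<alpha>_def l_def l1_def p1_def field_simps power2_eq_square)
    also have "\<bar>\<dots>\<bar> \<le> (z * x ^ 3 / 6) / x + z * x\<^sup>2 / 2"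
      unfolding abs_divide abs_of_pos[OF x(1)]
      by (intro order_trans[OF abs_triangle_ineq] add_mono Tp[OF x(1)])
        (simp only: abs_divide abs_of_pos[OF x(1)], intro divide_right_mono Ti less_imp_le x)
    also have "\<dots> \<le> z * x\<^sup>2" using x z0 by (simp add: power3_eq_cube power2_eq_square)
    finally show ?thesis .
  qed
  have r2: "\<bar>r2\<bar> \<le> 4 * z * x\<^sup>2"
  proof -
    have x2: "0 < 2 * x" using x by simp
    have "r2 = (saddle_integral (v + 2 * x) - saddle_integral v - 2 * x * (- ln_saddle v) - (2 * x)\<^sup>2 / 2 * (- ln_saddle_deriv v)) / x + (log_prefactor (v + 2 * x) - log_prefactor v - 2 * x * log_prefactor_deriv v)"
      using x by (simp add: r2_def \<beta>_def l_def l1_def p1_def field_simps power2_eq_square)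
    also have "\<bar>\<dots>\<bar> \<le> (z * (2 * x) ^ 3 / 6) / x + z * (2 * x)\<^sup>2 / 2"
      unfolding abs_divide abs_of_pos[OF x(1)]
      by (intro order_trans[OF abs_triangle_ineq] add_mono Tp[OF x2])
        (simp only: abs_divide abs_of_pos[OF x(1)], intro divide_right_mono Ti[OF x2] less_imp_le x)
    also have "\<dots> \<le> 4 * z * x\<^sup>2" using x z0 by (simp add: power3_eq_cube power2_eq_square)
    finally show ?thesis .
  qed
  have \<alpha>: "\<bar>\<alpha>\<bar> \<le> x * (3 / 2 * z)"
  proof -
    have "\<bar>- l1 / 2 + p1\<bar> \<le> 3 / 2 * z" using l1 p1 hz by linarith
    then show ?thesis unfolding \<alpha>_def abs_mult using x by (intro mult_mono) auto
  qed
  have \<beta>: "\<bar>\<beta>\<bar> \<le> x * 4"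
    unfolding \<beta>_def abs_mult using x l1 p1 h by (intro mult_mono) auto
  have xx: "x\<^sup>2 \<le> x * (1 / 10)" using x by (simp add: power2_eq_square)
  have \<alpha>r: "\<bar>\<alpha> + r1\<bar> \<le> 2 * x * z"
  proof -
    have "z * x\<^sup>2 \<le> z * (x * (1 / 10))" using z0 xx by (intro mult_left_mono) auto
    then have "\<bar>\<alpha> + r1\<bar> \<le> x * (3 / 2 * z) + z * (x * (1 / 10))" using \<alpha> r1 by linarith
    also have "\<dots> \<le> 2 * x * z" using x z0 by simp
    finally show ?thesis .
  qed
  have \<beta>r: "\<bar>\<beta> + r2\<bar> \<le> 5 * x"
  proof -
    have "4 * z * x\<^sup>2 \<le> 4 * 2 * (x * (1 / 10))" using z0 xx x by (intro mult_mono) auto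
    then show ?thesis using \<beta> r2 x by linarith
  qed
  define a b where "a = length_gf_approx x (v + x) / length_gf_approx x v"
    and "b = exp (- (v + x)) * length_gf_approx x (v + 2 * x) / length_gf_approx x v"
  have a: "a = (1 / h) * exp (\<alpha> + r1)"
    unfolding a_def length_gf_approx_def exp_diff[symmetric] el[symmetric] exp_add[symmetric] r1_def
    by (simp add: diff_divide_distrib)
  have b: "b = (z / h\<^sup>2) * exp (\<beta> + r2)"
  proof -
    have "z / h\<^sup>2 = z * exp (- l) * exp (- l)" by (simp add: el power2_eq_square)
    also have "\<dots> = exp (- v - 2 * l)" by (simp add: z_def exp_add[symmetric])
    finally show ?thesis
      unfolding b_def length_gf_approx_def times_divide_eq_right[symmetric] exp_diff[symmetric]
      by (simp add: exp_add[symmetric] r2_def diff_divide_distrib)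
  qed
  \<comment> \<open>Order 1 is the equation h^2 = h + z; the vanishing of order x is what determines
    \<open>log_prefactor_deriv\<close>.\<close>
  have 1: "(1 / h) * (1 + \<alpha>) + (z / h\<^sup>2) * (1 + \<beta>) = 1"
  proof -
    define d where "d = 2 * h - 1"
    have hd: "h = (d + 1) / 2" and d: "d > 1" using h by (auto simp: d_def)
    have "(1 / h) * (- l1 / 2 + p1) + (z / h\<^sup>2) * (- 2 * l1 + 2 * p1 - 1) = 0"
      unfolding l1_def ln_saddle_deriv_def p1_def log_prefactor_deriv_def h_def[symmetric] z d_def[symmetric] unfolding hd
      using d by (simp add: divide_simps power2_eq_square) (simp add: algebra_simps)
    moreover have "1 / h + z / h\<^sup>2 = 1" using h unfolding z by (simp add: field_simps power2_eq_square)
    moreover have "(1 / h) * (1 + \<alpha>) + (z / h\<^sup>2) * (1 + \<beta>) =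
        (1 / h + z / h\<^sup>2) + x * ((1 / h) * (- l1 / 2 + p1) + (z / h\<^sup>2) * (- 2 * l1 + 2 * p1 - 1))"
      by (simp add: \<alpha>_def \<beta>_def algebra_simps add_divide_distrib)
    ultimately show ?thesis by simp
  qed
  \<comment> \<open>The square of the exponent is at most 4 x^2 z^2, hence 8 x^2 z, and r1 adds x^2
    z. In the next estimate the constants are 25 for the square and 8 for r2.\<close>
  have ea: "\<bar>a - (1 / h) * (1 + \<alpha>)\<bar> \<le> 9 * (x\<^sup>2 * z)"
  proof -
    have "2 * x * z \<le> 2 * (1/10) * 2" using x z0 by (intro mult_mono) auto
    then have "\<bar>exp (\<alpha> + r1) - 1 - (\<alpha> + r1)\<bar> \<le> (\<alpha> + r1)\<^sup>2"
      using \<alpha>r by (intro abs_exp_minus_1_minus_le) auto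
    also have "\<dots> \<le> (2 * x * z)\<^sup>2" using \<alpha>r by (metis abs_ge_zero power2_abs power_mono)
    also have "\<dots> = 4 * (x\<^sup>2 * z) * z" by (simp add: power2_eq_square)
    also have "\<dots> \<le> 4 * (x\<^sup>2 * z) * 2" using z0 by (intro mult_left_mono) auto
    finally have *: "\<bar>exp (\<alpha> + r1) - (1 + \<alpha>)\<bar> \<le> 9 * (x\<^sup>2 * z)"
      using r1 by (simp add: mult.commute)
    have "\<bar>a - (1 / h) * (1 + \<alpha>)\<bar> = (1 / h) * \<bar>exp (\<alpha> + r1) - (1 + \<alpha>)\<bar>"
      unfolding a right_diff_distrib[symmetric] abs_mult using h by simp
    also have "\<dots> \<le> 1 * \<bar>exp (\<alpha> + r1) - (1 + \<alpha>)\<bar>" using h by (intro mult_right_mono) auto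
    finally show ?thesis using * by simp
  qed
  have eb: "\<bar>b - (z / h\<^sup>2) * (1 + \<beta>)\<bar> \<le> 33 * (x\<^sup>2 * z)"
  proof -
    have "4 * z * x\<^sup>2 \<le> 4 * 2 * x\<^sup>2" using z0 by (intro mult_right_mono) auto
    then have r2': "\<bar>r2\<bar> \<le> 8 * x\<^sup>2" using r2 by linarith
    have "\<bar>exp (\<beta> + r2) - 1 - (\<beta> + r2)\<bar> \<le> (\<beta> + r2)\<^sup>2"
      using \<beta>r x by (intro abs_exp_minus_1_minus_le) auto
    also have "\<dots> \<le> (5 * x)\<^sup>2" using \<beta>r by (metis abs_ge_zero power2_abs power_mono)
    also have "\<dots> = 25 * x\<^sup>2" by (simp add: power2_eq_square)
    finally have *: "\<bar>exp (\<beta> + r2) - (1 + \<beta>)\<bar> \<le> 33 * x\<^sup>2"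
      using r2' by linarith
    have "\<bar>b - (z / h\<^sup>2) * (1 + \<beta>)\<bar> = (z / h\<^sup>2) * \<bar>exp (\<beta> + r2) - (1 + \<beta>)\<bar>"
      unfolding b right_diff_distrib[symmetric] abs_mult using h z0 by simp
    also have "\<dots> \<le> (z / 1) * (33 * x\<^sup>2)"
      using h z0 * by (intro mult_mono divide_left_mono) auto
    finally show ?thesis by (simp add: mult_ac)
  qed
  have "\<bar>a + b - 1\<bar> \<le> 42 * (x\<^sup>2 * z)" using ea eb 1 by linarith
  also have "\<dots> \<le> 50 * (x\<^sup>2 * z)" using z0 by simp
  finally show ?thesis by (simp add: a_def b_def z_def)
qed

lemma length_gf_approx_pos: "0 < length_gf_approx x v" by (simp add: length_gf_approx_def)

text \<open>A maximum principle: \<open>R m\<close> is nearly a weighted mean of the next two terms, hence controlled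
  by the limit of \<open>R\<close> up to the accumulated defects of the weights.\<close>

lemma recurrence_maximum_principle:
  fixes R a b E :: "nat \<Rightarrow> real"
  assumes rec: "\<And>m. R m = a m * R (m + 1) + b m * R (m + 2)"
    and nonneg: "\<And>m. 0 \<le> a m" "\<And>m. 0 \<le> b m"
    and defect: "\<And>m. \<bar>a m + b m - 1\<bar> \<le> E m - E (m + 1)" "\<And>m. E m - E (m + 1) \<le> 1 / 2"
    and E: "\<And>m. 0 \<le> E m" and lim: "R \<longlonglongrightarrow> 1"
  shows "exp (- 2 * E 0) \<le> R 0 \<and> R 0 \<le> exp (E 0)"
proof -
  have dec: "E (m + 1) \<le> E m" for m using defect(1)[of m] by linarith
  have dec2: "E (m + 2) \<le> E (m + 1)" for m using dec[of "m + 1"] by (simp add: numeral_2_eq_2)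
  \<comment> \<open>Downward induction from an index N past which R is within \<eta> of its limit;
    \<eta> is sent to 0 at the end.\<close>
  have *: "(1 - \<eta>) * exp (- 2 * E m) \<le> R m \<and> R m \<le> (1 + \<eta>) * exp (E m)"
    if \<eta>: "0 < \<eta>" "\<eta> < 1" and N: "\<And>m. m \<ge> N \<Longrightarrow> \<bar>R m - 1\<bar> < \<eta>" for \<eta> N m
  proof (induction "N - m" arbitrary: m rule: less_induct)
    case less
    show ?case
    proof (cases "m \<ge> N")
      case True
      have "(1 - \<eta>) * exp (- 2 * E m) \<le> (1 - \<eta>) * 1" "(1 + \<eta>) * 1 \<le> (1 + \<eta>) * exp (E m)"
        using \<eta> E[of m] by (intro mult_left_mono; simp)+
      moreover have "(1 - \<eta>) * 1 \<le> R m" "R m \<le> (1 + \<eta>) * 1"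
        using N[OF True] by (auto simp: abs_less_iff)
      ultimately show ?thesis by (blast intro: order_trans)
    next
      case False
      let ?e = "E m - E (m + 1)"
      have IH: "(1 - \<eta>) * exp (- 2 * E (m + 1)) \<le> R (m + 1) \<and> R (m + 1) \<le> (1 + \<eta>) * exp (E (m + 1))"
        "(1 - \<eta>) * exp (- 2 * E (m + 2)) \<le> R (m + 2) \<and> R (m + 2) \<le> (1 + \<eta>) * exp (E (m + 2))"
        using less[of "m + 1"] less[of "m + 2"] False by auto
      have "(1 + \<eta>) * exp (E (m + 2)) \<le> (1 + \<eta>) * exp (E (m + 1))"
        "(1 - \<eta>) * exp (- 2 * E (m + 1)) \<le> (1 - \<eta>) * exp (- 2 * E (m + 2))"
        using \<eta> dec2[of m] by (intro mult_left_mono; simp)+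
      with IH have b2: "(1 - \<eta>) * exp (- 2 * E (m + 1)) \<le> R (m + 2)" "R (m + 2) \<le> (1 + \<eta>) * exp (E (m + 1))"
        by linarith+
      have "R m \<le> a m * ((1 + \<eta>) * exp (E (m + 1))) + b m * ((1 + \<eta>) * exp (E (m + 1)))"
        unfolding rec[of m] using IH b2 nonneg by (intro add_mono mult_left_mono) auto
      also have "\<dots> = (a m + b m) * ((1 + \<eta>) * exp (E (m + 1)))" by (simp add: algebra_simps)
      also have "a m + b m \<le> exp ?e"
        using defect(1)[of m] exp_ge_add_one_self[of ?e] unfolding abs_le_iff by linarith
      also have "exp ?e * ((1 + \<eta>) * exp (E (m + 1))) = (1 + \<eta>) * exp (E m)" by (simp add: exp_diff)
      finally have upper: "R m \<le> (1 + \<eta>) * exp (E m)" using \<eta> by (simp add: mult_right_mono)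
      have "(1 - \<eta>) * exp (- 2 * E m) = exp (- 2 * ?e) * ((1 - \<eta>) * exp (- 2 * E (m + 1)))"
        by (simp add: exp_add[symmetric] algebra_simps)
      \<comment> \<open>The factor 2 in the lower bound arises here: exp (- 2 e) <= 1 - e holds for
        e in [0, 1/2], whence the assumption on the size of a defect.\<close>
      also have "exp (- 2 * ?e) \<le> 1 - ?e"
      proof -
        have e: "0 \<le> ?e" "?e \<le> 1 / 2" using defect[of m] by linarith+
        have "1 \<le> (1 - ?e) * (1 + 2 * ?e)"
        proof -
          have "?e * ?e \<le> ?e * (1 / 2)" using e by (intro mult_left_mono) auto
          then show ?thesis by (simp add: algebra_simps)
        qed
        also have "\<dots> \<le> (1 - ?e) * exp (2 * ?e)"
          using e exp_ge_add_one_self[of "2 * ?e"] by (intro mult_left_mono) auto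
        finally have "1 / exp (2 * ?e) \<le> 1 - ?e" by (simp add: pos_divide_le_eq)
        moreover have "- 2 * ?e = - (2 * ?e)" by simp
        ultimately show ?thesis by (simp only: exp_minus inverse_eq_divide)
      qed
      also have "\<dots> \<le> a m + b m" using defect(1)[of m] by linarith
      also have "(a m + b m) * ((1 - \<eta>) * exp (- 2 * E (m + 1))) =
          a m * ((1 - \<eta>) * exp (- 2 * E (m + 1))) + b m * ((1 - \<eta>) * exp (- 2 * E (m + 1)))"
        by (simp add: algebra_simps)
      also have "\<dots> \<le> R m"
        unfolding rec[of m] using IH b2 nonneg by (intro add_mono mult_left_mono) auto
      finally have "(1 - \<eta>) * exp (- 2 * E m) \<le> R m" using \<eta> by (simp add: mult_right_mono)
      with upper show ?thesis by simp
    qed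
  qed
  have **: "(1 - \<eta>) * exp (- 2 * E 0) \<le> R 0 \<and> R 0 \<le> (1 + \<eta>) * exp (E 0)" if "0 < \<eta>" "\<eta> < 1" for \<eta>
  proof -
    obtain N where "\<And>m. m \<ge> N \<Longrightarrow> \<bar>R m - 1\<bar> < \<eta>"
      using lim \<open>0 < \<eta>\<close> unfolding LIMSEQ_iff by (metis real_norm_def)
    from *[OF that this] show ?thesis by blast
  qed
  have ev: "\<forall>\<^sub>F \<eta> in at_right (0::real). 0 < \<eta> \<and> \<eta> < 1"
    using eventually_at_right[of 0 "1::real"] by (auto intro!: exI[of _ 1])
  have "((\<lambda>\<eta>. (1 + \<eta>) * exp (E 0)) \<longlongrightarrow> (1 + 0) * exp (E 0)) (at_right 0)" by (intro tendsto_intros)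
  then have "R 0 \<le> (1 + 0) * exp (E 0)"
    by (rule tendsto_lowerbound) (use ev ** in \<open>auto elim!: eventually_mono\<close>)
  then have upper: "R 0 \<le> exp (E 0)" by simp
  have "((\<lambda>\<eta>. (1 - \<eta>) * exp (- 2 * E 0)) \<longlongrightarrow> (1 - 0) * exp (- 2 * E 0)) (at_right 0)" by (intro tendsto_intros)
  then have "(1 - 0) * exp (- 2 * E 0) \<le> R 0"
    by (rule tendsto_upperbound) (use ev ** in \<open>auto elim!: eventually_mono\<close>)
  with upper show ?thesis by simp
qed

section \<open>The generating function G and its comparison with the approximation\<close>

definition length_gf :: "real \<Rightarrow> real \<Rightarrow> real" where
  "length_gf x v = (\<Sum>k. exp (- v) ^ k * gap2_gf k (exp (- x)))"

lemma summable_length_gf: "0 < x \<Longrightarrow> summable (\<lambda>k. exp (- v) ^ k * gap2_gf k (exp (- x :: real)) :: real)"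
  by (rule summable_gap2_gf(2)) auto

text \<open>The q-difference equation of the Rogers-Ramanujan function: subtracting the series at v
  + x multiplies term k by 1 - q^k, which cancels its last denominator factor and leaves the series
  at v + 2 x shifted by one index. Combinatorially, the two terms on the right separate the
  partitions without and with a part 1.\<close>

lemma length_gf_recurrence:
  assumes x: "0 < x"
  shows "length_gf x v = length_gf x (v + x) + exp (- (v + x)) * length_gf x (v + 2 * x)"
proof -
  define q z where "q = exp (- x)" and "z = exp (- v)"
  have q: "0 < q" "q < 1" using x by (simp_all add: q_def)
  have e: "exp (- (v + x)) = z * q" "exp (- (v + 2 * x)) = z * q ^ 2"
    by (simp_all add: q_def z_def exp_add[symmetric] power2_eq_square)
  have S: "summable (\<lambda>k. z ^ k * gap2_gf k q)" "summable (\<lambda>k. (z * q) ^ k * gap2_gf k q)"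
    "summable (\<lambda>k. (z * q ^ 2) ^ k * gap2_gf k q)"
    using summable_length_gf[OF x, of v] summable_length_gf[OF x, of "v + x"] summable_length_gf[OF x, of "v + 2 * x"]
    unfolding e by (simp_all add: q_def z_def)
  let ?f = "\<lambda>k. z ^ k * gap2_gf k q - (z * q) ^ k * gap2_gf k q"
  have step: "?f (Suc k) = (z * q) * ((z * q ^ 2) ^ k * gap2_gf k q)" for k
  proof -
    have "1 - q ^ Suc k \<noteq> 0" using q power_less_one_iff[of q "Suc k"] by simp
    moreover have "?f (Suc k) = z ^ Suc k * (1 - q ^ Suc k) * gap2_gf (Suc k) q"
      by (simp add: power_mult_distrib algebra_simps)
    ultimately have "?f (Suc k) = z ^ Suc k * q ^ (2 * k + 1) * gap2_gf k q"
      unfolding gap2_gf_Suc by (simp del: power_Suc)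
    then show ?thesis by (simp add: power_mult_distrib power_mult[symmetric] mult_ac)
  qed
  have "length_gf x v - length_gf x (v + x) = (\<Sum>k. ?f k)"
    unfolding length_gf_def e q_def[symmetric] z_def[symmetric] using S by (intro suminf_diff)
  also have "\<dots> = (\<Sum>k. ?f (Suc k))"
    using suminf_split_head[OF summable_diff[OF S(1,2)]] by simp
  also have "\<dots> = (z * q) * (\<Sum>k. (z * q ^ 2) ^ k * gap2_gf k q)"
    unfolding step using S by (intro suminf_mult)
  finally show ?thesis
    unfolding length_gf_def e q_def[symmetric] z_def[symmetric] by simp
qed

lemma length_gf_pos: "0 < x \<Longrightarrow> 0 < length_gf x v"
  unfolding length_gf_def by (intro suminf_pos summable_length_gf mult_pos_pos) (auto intro!: gap2_gf_pos)

text \<open>The boundary condition at infinity for the maximum principle. The term k = 0 is 1, and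
  for nonnegative v every other term is at most exp (- v) times its value at v = 0.\<close>

lemma length_gf_tendsto_1:
  assumes x: "0 < x" shows "(length_gf x \<longlongrightarrow> 1) at_top"
proof (rule tendsto_sandwich)
  show "\<forall>\<^sub>F v in at_top. 1 \<le> length_gf x v"
  proof (rule always_eventually, rule allI)
    fix v
    have "(\<Sum>k\<in>{0}. exp (- v) ^ k * gap2_gf k (exp (- x))) \<le> length_gf x v"
      unfolding length_gf_def using x gap2_gf_pos[of "exp (- x)"]
      by (intro sum_le_suminf summable_length_gf) (auto intro!: mult_nonneg_nonneg less_imp_le)
    then show "1 \<le> length_gf x v" by simp
  qed
  show "\<forall>\<^sub>F v in at_top. length_gf x v \<le> 1 + exp (- v) * length_gf x 0"
    using eventually_ge_at_top[of 0]
  proof eventually_elim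
    case (elim v)
    have S: "summable (\<lambda>k. exp (- v) * (exp (- 0) ^ k * gap2_gf k (exp (- x))))"
      by (intro summable_mult summable_length_gf x)
    have "length_gf x v = 1 + (\<Sum>k. exp (- v) ^ Suc k * gap2_gf (Suc k) (exp (- x)))"
      unfolding length_gf_def using suminf_split_head[OF summable_length_gf[OF x, of v]] by simp
    also have "(\<Sum>k. exp (- v) ^ Suc k * gap2_gf (Suc k) (exp (- x))) \<le>
        (\<Sum>k. exp (- v) * (exp (- 0) ^ Suc k * gap2_gf (Suc k) (exp (- x))))"
    proof (rule suminf_le)
      show "summable (\<lambda>k. exp (- v) ^ Suc k * gap2_gf (Suc k) (exp (- x)))"
        using summable_length_gf[OF x, of v] by (subst summable_Suc_iff)
      show "summable (\<lambda>k. exp (- v) * (exp (- 0) ^ Suc k * gap2_gf (Suc k) (exp (- x))))"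
        using S by (subst summable_Suc_iff)
      fix k
      have "exp (- v) ^ Suc k \<le> exp (- v) ^ 1" using elim by (intro power_decreasing) auto
      then show "exp (- v) ^ Suc k * gap2_gf (Suc k) (exp (- x)) \<le> exp (- v) * (exp (- 0) ^ Suc k * gap2_gf (Suc k) (exp (- x)))"
        using gap2_gf_pos[of "exp (- x)" "Suc k"] x by (simp add: mult_right_mono)
    qed
    also have "\<dots> \<le> (\<Sum>k. exp (- v) * (exp (- 0) ^ k * gap2_gf k (exp (- x))))"
      using suminf_split_head[OF S] by simp
    also have "\<dots> = exp (- v) * length_gf x 0"
      unfolding length_gf_def using summable_length_gf[OF x] by (intro suminf_mult)
    finally show ?case by simp
  qed
  have "((\<lambda>v::real. exp (- v)) \<longlongrightarrow> 0) at_top" by real_asymp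
  then have "((\<lambda>v. 1 + exp (- v) * length_gf x 0) \<longlongrightarrow> 1 + 0 * length_gf x 0) at_top" by (intro tendsto_intros)
  then show "((\<lambda>v. 1 + exp (- v) * length_gf x 0) \<longlongrightarrow> 1) at_top" by simp
qed auto

text \<open>The approximation satisfies the same boundary condition, because
  \<open>saddle_integral\<close> and \<open>log_prefactor\<close> both vanish in the limit. This
  fixes the normalisation without any unknown constant.\<close>

lemma length_gf_approx_tendsto_1: "(length_gf_approx x \<longlongrightarrow> 1) at_top"
proof -
  have s: "(saddle \<longlongrightarrow> 1) at_top" unfolding saddle_def by real_asymp
  then have l: "(ln_saddle \<longlongrightarrow> ln 1) at_top" unfolding ln_saddle_def[abs_def] by (intro tendsto_intros) auto
  have "isCont dilog 0"
    using continuous_on_dilog by (rule continuous_on_interior) auto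
  moreover have "((\<lambda>v. 1 - saddle v) \<longlongrightarrow> 1 - 1) at_top" by (intro tendsto_intros s)
  ultimately have "((\<lambda>v. dilog (1 - saddle v)) \<longlongrightarrow> dilog 0) at_top"
    by (intro isCont_tendsto_compose[of 0 dilog]) auto
  then have i: "(saddle_integral \<longlongrightarrow> (ln 1)\<^sup>2 / 2 - dilog 0) at_top"
    unfolding saddle_integral_def[abs_def] by (intro tendsto_intros l) auto
  have "((\<lambda>v. 2 * saddle v - 1) \<longlongrightarrow> 2 * 1 - 1) at_top" by (intro tendsto_intros s)
  then have "(log_prefactor \<longlongrightarrow> (ln 1 - ln 1) / 2) at_top"
    unfolding log_prefactor_def[abs_def] by (intro tendsto_intros s) auto
  then have "(length_gf_approx x \<longlongrightarrow> exp (((ln 1)\<^sup>2 / 2 - dilog 0) * inverse x + (ln 1 - ln 1) / 2)) at_top"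
    unfolding length_gf_approx_def[abs_def] divide_inverse[of "saddle_integral _"] by (intro tendsto_intros i)
  then show ?thesis by simp
qed

text \<open>The maximum principle is applied to the quotient R of exact and approximate solution
  along v, v + x, v + 2 x, ...; dividing the recurrence by the approximation makes its coefficients
  nearly a pair of weights.\<close>

lemma length_gf_approx:
  assumes x: "0 < x" "x \<le> 1 / 20" and v: "- 1 / 2 \<le> v"
  shows "\<bar>ln (length_gf x v) - ln (length_gf_approx x v)\<bar> \<le> 400 * x"
proof -
  define R where "R = (\<lambda>m. length_gf x (v + real m * x) / length_gf_approx x (v + real m * x))"
  define a where "a = (\<lambda>m. length_gf_approx x (v + real m * x + x) / length_gf_approx x (v + real m * x))"
  define b where "b = (\<lambda>m. exp (- (v + real m * x + x)) * length_gf_approx x (v + real m * x + 2 * x) / length_gf_approx x (v + real m * x))"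
  \<comment> \<open>\<open>E m\<close> is the sum of the geometric series of all errors from step m
    on, so consecutive values differ by exactly one error.\<close>
  define E where "E = (\<lambda>m. 50 * x\<^sup>2 * exp (- (v + real m * x)) / (1 - exp (- x)))"
  have ex: "exp (- x) < 1" using x by simp
  have Ed: "E m - E (m + 1) = 50 * x\<^sup>2 * exp (- (v + real m * x))" for m
  proof -
    have "exp (- (v + real (m + 1) * x)) = exp (- (v + real m * x)) * exp (- x)"
      by (simp add: exp_add[symmetric] algebra_simps)
    then have "E m - E (m + 1) = 50 * x\<^sup>2 * exp (- (v + real m * x)) * (1 - exp (- x)) / (1 - exp (- x))"
      unfolding E_def diff_divide_distrib[symmetric] by (simp add: algebra_simps)
    then show ?thesis using ex by simp
  qed
  have ge: "- 1 / 2 \<le> v + real m * x" for m using v x by (simp add: add_increasing2)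
  have R: "exp (- 2 * E 0) \<le> R 0 \<and> R 0 \<le> exp (E 0)"
  proof (rule recurrence_maximum_principle[of R a b E], goal_cases)
    case (1 m)
    have "v + real (m + 1) * x = v + real m * x + x" "v + real (m + 2) * x = v + real m * x + 2 * x"
      by (simp_all add: algebra_simps)
    then show ?case
      unfolding R_def a_def b_def length_gf_recurrence[OF x(1), of "v + real m * x"]
      using length_gf_approx_pos[of x "v + real m * x"] length_gf_approx_pos[of x "v + real m * x + x"] length_gf_approx_pos[of x "v + real m * x + 2 * x"]
      by (simp add: field_simps)
  next
    case (4 m)
    show ?case unfolding Ed a_def b_def using x ge[of m] by (intro length_gf_approx_recurrence) auto
  next
    case (5 m)
    have "50 * x\<^sup>2 * exp (- (v + real m * x)) \<le> 50 * (1 / 20)\<^sup>2 * 2"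
      using x exp_minus_less_2[OF ge[of m]] by (intro mult_mono power_mono) auto
    then show ?case unfolding Ed by (simp add: power2_eq_square)
  next
    case 7
    have "filterlim (\<lambda>m. v + real m * x) at_top sequentially" using x by real_asymp
    then have "R \<longlonglongrightarrow> 1 / 1"
      unfolding R_def by (intro tendsto_divide filterlim_compose[OF length_gf_tendsto_1[OF x(1)]]
        filterlim_compose[OF length_gf_approx_tendsto_1]) auto
    then show ?case by simp
  qed (use ex in \<open>auto simp: a_def b_def E_def length_gf_approx_pos intro!: divide_nonneg_nonneg mult_nonneg_nonneg less_imp_le[OF length_gf_approx_pos]\<close>)
  have "exp (- x) \<le> 1 - x / 2"
  proof -
    have "exp (- x) \<le> 1 - x + x\<^sup>2" using abs_exp_minus_1_minus_le[of "- x"] x by auto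
    moreover have "x\<^sup>2 \<le> x * (1 / 2)" using x by (simp add: power2_eq_square)
    ultimately show ?thesis by simp
  qed
  then have "E 0 \<le> 50 * x\<^sup>2 * 2 / (x / 2)"
    unfolding E_def using x ex exp_minus_less_2[OF v] by (intro frac_le mult_left_mono) auto
  also have "\<dots> = 200 * x" using x by (simp add: power2_eq_square)
  finally have E0: "E 0 \<le> 200 * x" .
  have R0: "R 0 = length_gf x v / length_gf_approx x v" by (simp add: R_def)
  then have R0p: "R 0 > 0" using length_gf_pos[OF x(1)] length_gf_approx_pos by simp
  have "ln (exp (- 2 * E 0)) \<le> ln (R 0)" "ln (R 0) \<le> ln (exp (E 0))"
    using R R0p by (simp_all del: ln_exp)
  then have "- 2 * E 0 \<le> ln (R 0)" "ln (R 0) \<le> E 0" by simp_all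
  moreover have "ln (R 0) = ln (length_gf x v) - ln (length_gf_approx x v)"
    unfolding R0 using length_gf_pos[OF x(1), of v] length_gf_approx_pos[of x v] by (simp add: ln_div)
  moreover have "0 \<le> E 0" unfolding E_def using ex by (intro divide_nonneg_nonneg mult_nonneg_nonneg) auto
  ultimately show ?thesis using E0 by linarith
qed

section \<open>The number of parts near the singularity\<close>

definition r1_gf_real :: "real \<Rightarrow> real" where
  "r1_gf_real x = (\<Sum>k. real k * gap2_gf k (exp (- x)))"

lemma summable_r1_gf_real: "0 < x \<Longrightarrow> summable (\<lambda>k. real k * gap2_gf k (exp (- x)))"
  using summable_gap2_gf(1)[of "exp (- x)" 1] by simp

text \<open>Jensen's inequality for the number of parts: \<open>r1_gf_real x / length_gf x 0\<close> is its mean.\<close>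

lemma length_gf_shift_ge:
  assumes x: "0 < x"
  shows "length_gf x 0 * exp (- v * (r1_gf_real x / length_gf x 0)) \<le> length_gf x v"
proof -
  define D where "D = r1_gf_real x / length_gf x 0"
  have S0: "summable (\<lambda>k. gap2_gf k (exp (- x)))" using summable_length_gf[OF x, of 0] by simp
  have G0: "length_gf x 0 = (\<Sum>k. gap2_gf k (exp (- x)))" by (simp add: length_gf_def)
  have S1: "summable (\<lambda>k. (1 + v * D) * gap2_gf k (exp (- x)))" "summable (\<lambda>k. v * (real k * gap2_gf k (exp (- x))))"
    by (intro summable_mult S0 summable_r1_gf_real x)+
  have "(\<Sum>k. exp (- v * D) * ((1 + v * D) * gap2_gf k (exp (- x)) - v * (real k * gap2_gf k (exp (- x))))) \<le> length_gf x v"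
    unfolding length_gf_def
  proof (rule suminf_le)
    fix k
    \<comment> \<open>The tangent line of the exponential at the mean D; after summation over k its
      linear part vanishes by the choice of D.\<close>
    have "exp (- v * D) * (1 + v * (D - real k)) \<le> exp (- v * D) * exp (v * (D - real k))"
      by (intro mult_left_mono exp_ge_add_one_self) auto
    also have "\<dots> = exp (- v) ^ k" by (simp add: exp_add[symmetric] exp_of_nat_mult[symmetric] algebra_simps)
    finally have "exp (- v * D) * (1 + v * (D - real k)) * gap2_gf k (exp (- x)) \<le> exp (- v) ^ k * gap2_gf k (exp (- x))"
      using gap2_gf_pos[of "exp (- x)" k] x by (intro mult_right_mono) auto
    then show "exp (- v * D) * ((1 + v * D) * gap2_gf k (exp (- x)) - v * (real k * gap2_gf k (exp (- x)))) \<le> exp (- v) ^ k * gap2_gf k (exp (- x))"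
      by (simp add: algebra_simps)
  qed (intro summable_mult summable_diff S1 summable_length_gf x)+
  also have "(\<Sum>k. exp (- v * D) * ((1 + v * D) * gap2_gf k (exp (- x)) - v * (real k * gap2_gf k (exp (- x))))) =
      exp (- v * D) * ((1 + v * D) * length_gf x 0 - v * r1_gf_real x)"
    using suminf_mult[OF summable_diff[OF S1]] suminf_diff[OF S1] suminf_mult[OF S0] suminf_mult[OF summable_r1_gf_real[OF x]]
    by (simp add: G0 r1_gf_real_def)
  also have "v * r1_gf_real x = v * D * length_gf x 0" using length_gf_pos[OF x, of 0] by (simp add: D_def)
  finally show ?thesis unfolding D_def[symmetric] by (simp add: algebra_simps)
qed

text \<open>As a function of v, ln G lies above its tangent at 0, whose slope is minus the mean.
  Evaluating at v = x and v = - x encloses the mean between two difference quotients.\<close>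

lemma length_gf_mean_bounds:
  assumes x: "0 < x"
  shows "ln (length_gf x 0) - ln (length_gf x x) \<le> x * (r1_gf_real x / length_gf x 0)"
    and "x * (r1_gf_real x / length_gf x 0) \<le> ln (length_gf x (- x)) - ln (length_gf x 0)"
proof -
  have *: "ln (length_gf x 0) - v * (r1_gf_real x / length_gf x 0) \<le> ln (length_gf x v)" for v
  proof -
    have "ln (length_gf x 0 * exp (- v * (r1_gf_real x / length_gf x 0))) \<le> ln (length_gf x v)"
      using length_gf_shift_ge[OF x, of v] length_gf_pos[OF x] by simp
    then show ?thesis using length_gf_pos[OF x, of 0] by (simp add: ln_mult)
  qed
  show "ln (length_gf x 0) - ln (length_gf x x) \<le> x * (r1_gf_real x / length_gf x 0)" using *[of x] by simp
  show "x * (r1_gf_real x / length_gf x 0) \<le> ln (length_gf x (- x)) - ln (length_gf x 0)" using *[of "- x"] by simp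
qed

lemma ev_at_right_0: "0 < c \<Longrightarrow> \<forall>\<^sub>F x in at_right (0::real). 0 < x \<and> x < c"
  using eventually_at_right[of 0 c] by auto

text \<open>The logarithms in \<open>length_gf_mean_bounds\<close> are replaced by their
  approximations. The division by x in the exponent turns the bounds into difference quotients of
  \<open>saddle_integral\<close> at 0, with limit \<open>ln_saddle 0\<close>; both the differences
  of \<open>log_prefactor\<close> and the errors 800 x vanish.\<close>

lemma tendsto_mean_parts: "((\<lambda>x. x * (r1_gf_real x / length_gf x 0)) \<longlongrightarrow> ln golden_ratio) (at_right 0)"
proof -
  have l0: "ln_saddle 0 = ln golden_ratio" by (simp add: ln_saddle_def saddle_0)
  have quot: "((\<lambda>y. (saddle_integral y - saddle_integral 0) / y) \<longlongrightarrow> - ln_saddle 0) (at 0)"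
    using DERIV_saddle_integral[of 0] by (simp add: has_field_derivative_iff)
  have q: "((\<lambda>x. (saddle_integral (c * x) - saddle_integral 0) / (c * x)) \<longlongrightarrow> - ln_saddle 0) (at_right 0)"
    and p: "((\<lambda>x. log_prefactor (c * x)) \<longlongrightarrow> log_prefactor 0) (at_right 0)" if "c \<noteq> 0" for c
  proof -
    have "((\<lambda>x. c * x) \<longlongrightarrow> c * 0) (at_right 0)" by (intro tendsto_intros)
    then have l: "((\<lambda>x. c * x) \<longlongrightarrow> 0) (at_right 0)" by simp
    have "\<forall>\<^sub>F x in at_right 0. c * x \<noteq> 0"
      using ev_at_right_0[of 1] that by (auto elim: eventually_mono)
    with l have "filterlim (\<lambda>x. c * x) (at 0) (at_right 0)" by (simp add: filterlim_at)
    from filterlim_compose[OF quot this] show "((\<lambda>x. (saddle_integral (c * x) - saddle_integral 0) / (c * x)) \<longlongrightarrow> - ln_saddle 0) (at_right 0)" .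
    show "((\<lambda>x. log_prefactor (c * x)) \<longlongrightarrow> log_prefactor 0) (at_right 0)"
      by (rule isCont_tendsto_compose[OF DERIV_isCont[OF DERIV_log_prefactor] l])
  qed
  show ?thesis
  proof (rule tendsto_sandwich)
    have "\<forall>\<^sub>F x in at_right (0::real). 0 < x \<and> x < 1 / 20" by (rule ev_at_right_0) simp
    then show "\<forall>\<^sub>F x in at_right 0. - ((saddle_integral (1 * x) - saddle_integral 0) / (1 * x)) - (log_prefactor (1 * x) - log_prefactor 0) - 800 * x \<le> x * (r1_gf_real x / length_gf x 0)"
    proof eventually_elim
      case (elim x)
      have "\<bar>ln (length_gf x 0) - ln (length_gf_approx x 0)\<bar> \<le> 400 * x" "\<bar>ln (length_gf x x) - ln (length_gf_approx x x)\<bar> \<le> 400 * x"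
        using elim by (intro length_gf_approx; simp)+
      moreover have "ln (length_gf_approx x x) = saddle_integral x / x + log_prefactor x" "ln (length_gf_approx x 0) = saddle_integral 0 / x + log_prefactor 0"
        by (simp_all add: length_gf_approx_def)
      ultimately show ?case using length_gf_mean_bounds(1)[of x] elim by (simp add: diff_divide_distrib)
    qed
    have "\<forall>\<^sub>F x in at_right (0::real). 0 < x \<and> x < 1 / 20" by (rule ev_at_right_0) simp
    then show "\<forall>\<^sub>F x in at_right 0. x * (r1_gf_real x / length_gf x 0) \<le> - ((saddle_integral (-1 * x) - saddle_integral 0) / (-1 * x)) + (log_prefactor (-1 * x) - log_prefactor 0) + 800 * x"
    proof eventually_elim
      case (elim x)
      have "\<bar>ln (length_gf x 0) - ln (length_gf_approx x 0)\<bar> \<le> 400 * x" "\<bar>ln (length_gf x (- x)) - ln (length_gf_approx x (- x))\<bar> \<le> 400 * x"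
        using elim by (intro length_gf_approx; simp)+
      moreover have "ln (length_gf_approx x (- x)) = saddle_integral (- x) / x + log_prefactor (- x)" "ln (length_gf_approx x 0) = saddle_integral 0 / x + log_prefactor 0"
        by (simp_all add: length_gf_approx_def)
      ultimately show ?case using length_gf_mean_bounds(2)[of x] elim by (simp add: diff_divide_distrib)
    qed
    have "((\<lambda>x. - ((saddle_integral (1 * x) - saddle_integral 0) / (1 * x)) - (log_prefactor (1 * x) - log_prefactor 0) - 800 * x)
       \<longlongrightarrow> - (- ln_saddle 0) - (log_prefactor 0 - log_prefactor 0) - 800 * 0) (at_right 0)"
      by (intro tendsto_intros q p) auto
    then show "((\<lambda>x. - ((saddle_integral (1 * x) - saddle_integral 0) / (1 * x)) - (log_prefactor (1 * x) - log_prefactor 0) - 800 * x) \<longlongrightarrow> ln golden_ratio) (at_right 0)"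
      by (simp add: l0)
    have "((\<lambda>x. - ((saddle_integral (-1 * x) - saddle_integral 0) / (-1 * x)) + (log_prefactor (-1 * x) - log_prefactor 0) + 800 * x)
       \<longlongrightarrow> - (- ln_saddle 0) + (log_prefactor 0 - log_prefactor 0) + 800 * 0) (at_right 0)"
      by (intro tendsto_intros q p) auto
    then show "((\<lambda>x. - ((saddle_integral (-1 * x) - saddle_integral 0) / (-1 * x)) + (log_prefactor (-1 * x) - log_prefactor 0) + 800 * x) \<longlongrightarrow> ln golden_ratio) (at_right 0)"
      by (simp add: l0)
  qed
qed

text \<open>\<open>r1_gf_real x\<close> is the mean number of parts times
  \<open>length_gf x 0\<close>; the first factor is \<open>tendsto_mean_parts\<close>, the second is
  known up to a factor tending to 1.\<close>

lemma r1_gf_real_asymp: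
  "((\<lambda>x. x * r1_gf_real x * exp (- (pi\<^sup>2 / 15) / x)) \<longlongrightarrow> ln golden_ratio * sqrt (golden_ratio / sqrt 5)) (at_right 0)"
proof -
  have ev: "\<forall>\<^sub>F x in at_right (0::real). 0 < x \<and> x < 1 / 20" by (rule ev_at_right_0) simp
  have "((\<lambda>x. ln (length_gf x 0) - ln (length_gf_approx x 0)) \<longlongrightarrow> 0) (at_right 0)"
  proof (rule Lim_null_comparison)
    show "\<forall>\<^sub>F x in at_right 0. norm (ln (length_gf x 0) - ln (length_gf_approx x 0)) \<le> 400 * x"
      using ev by eventually_elim (use length_gf_approx[of _ 0] in simp)
    show "((\<lambda>x. 400 * x) \<longlongrightarrow> 0) (at_right (0::real))" by real_asymp
  qed
  then have "((\<lambda>x. exp (ln (length_gf x 0) - ln (length_gf_approx x 0))) \<longlongrightarrow> exp 0) (at_right 0)" by (intro tendsto_intros)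
  then have "((\<lambda>x. x * (r1_gf_real x / length_gf x 0) * (exp (ln (length_gf x 0) - ln (length_gf_approx x 0)) * exp (log_prefactor 0)))
     \<longlongrightarrow> ln golden_ratio * (exp 0 * exp (log_prefactor 0))) (at_right 0)"
    by (intro tendsto_mult tendsto_const tendsto_mean_parts)
  also have "?this \<longleftrightarrow> ((\<lambda>x. x * r1_gf_real x * exp (- (pi\<^sup>2 / 15) / x)) \<longlongrightarrow> ln golden_ratio * (exp 0 * exp (log_prefactor 0))) (at_right 0)"
  proof (rule tendsto_cong)
    from ev show "\<forall>\<^sub>F x in at_right 0. x * (r1_gf_real x / length_gf x 0) * (exp (ln (length_gf x 0) - ln (length_gf_approx x 0)) * exp (log_prefactor 0)) =
       x * r1_gf_real x * exp (- (pi\<^sup>2 / 15) / x)"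
    proof eventually_elim
      case (elim x)
      have "exp (ln (length_gf x 0) - ln (length_gf_approx x 0)) * exp (log_prefactor 0) = length_gf x 0 * exp (- (pi\<^sup>2 / 15) / x)"
      proof -
        have "ln (length_gf_approx x 0) = pi\<^sup>2 / 15 / x + log_prefactor 0" by (simp add: length_gf_approx_def saddle_integral_0)
        then have "exp (ln (length_gf x 0) - ln (length_gf_approx x 0)) * exp (log_prefactor 0) = exp (ln (length_gf x 0)) * exp (- (pi\<^sup>2 / 15) / x)"
          by (simp only: exp_add[symmetric]) simp
        then show ?thesis using elim length_gf_pos[of x 0] by simp
      qed
      then show ?case using length_gf_pos[of x 0] elim by simp
    qed
  qed
  finally show ?thesis by (simp add: log_prefactor_0)
qed

section \<open>Coefficients as integrals\<close>

definition r1_gf_complex :: "complex \<Rightarrow> complex" where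
  "r1_gf_complex z = (\<Sum>k. of_nat k * gap2_gf k (exp (- z)))"

lemma r1_gf_complex_sums:
  assumes "0 < Re z"
  shows "(\<lambda>n. of_nat (r1 1 n) * exp (- of_nat n * z)) sums r1_gf_complex z"
proof -
  have "(\<lambda>n. of_nat (r1 1 n) * exp (- z) ^ n) sums r1_gf_complex z"
    unfolding r1_gf_complex_def using assms by (intro r1_gf) auto
  then show ?thesis by (simp add: exp_of_nat_mult[symmetric])
qed

lemma r1_gf_real_sums:
  assumes "0 < x"
  shows "(\<lambda>n. real (r1 1 n) * exp (- real n * x)) sums r1_gf_real x"
proof -
  have "(\<lambda>n. real (r1 1 n) * exp (- x) ^ n) sums r1_gf_real x"
    unfolding r1_gf_real_def using assms by (intro r1_gf) auto
  then show ?thesis by (simp add: exp_of_nat_mult[symmetric])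
qed

lemma r1_gf_real_pos:
  assumes x: "0 < x" shows "0 < r1_gf_real x"
  unfolding r1_gf_real_def
proof (rule suminf_pos2[where i = 1])
  from x show "summable (\<lambda>k. real k * gap2_gf k (exp (- x)))" by (rule summable_r1_gf_real)
  show "0 \<le> real k * gap2_gf k (exp (- x))" for k
    using gap2_gf_pos[of "exp (- x)" k] x by simp
  show "0 < real 1 * gap2_gf 1 (exp (- x))" using gap2_gf_pos[of "exp (- x)" 1] x by simp
qed

lemma norm_r1_gf_complex_term: "norm (of_nat (r1 1 n) * exp (- of_nat n * z) :: complex) = real (r1 1 n) * exp (- real n * Re z)"
  by (simp add: norm_mult)

lemma r1_gf_complex_of_real:
  assumes "0 < x" shows "r1_gf_complex (of_real x) = of_real (r1_gf_real x)"
proof (rule sums_unique2)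
  show "(\<lambda>n. of_nat (r1 1 n) * exp (- of_nat n * complex_of_real x)) sums r1_gf_complex (of_real x)"
    using assms by (intro r1_gf_complex_sums) auto
  have "(\<lambda>n. complex_of_real (real (r1 1 n) * exp (- real n * x))) sums of_real (r1_gf_real x)"
    using r1_gf_real_sums[OF assms] by (rule sums_of_real)
  then show "(\<lambda>n. of_nat (r1 1 n) * exp (- of_nat n * complex_of_real x)) sums of_real (r1_gf_real x)"
  proof (rule sums_cong[THEN iffD1, rotated])
    fix n
    have "complex_of_real (real (r1 1 n) * exp (- real n * x)) = of_nat (r1 1 n) * complex_of_real (exp (- real n * x))"
      by (simp only: of_real_mult of_real_of_nat_eq)
    also have "complex_of_real (exp (- real n * x)) = exp (complex_of_real (- real n * x))"
      by (rule exp_of_real[symmetric])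
    also have "complex_of_real (- real n * x) = - of_nat n * complex_of_real x"
      by (simp only: of_real_mult of_real_of_nat_eq of_real_minus)
    finally show "complex_of_real (real (r1 1 n) * exp (- real n * x)) = of_nat (r1 1 n) * exp (- of_nat n * complex_of_real x)" .
  qed
qed

lemma norm_r1_gf_complex_partial_le:
  assumes "0 < Re z"
  shows "norm (\<Sum>m<N. of_nat (r1 1 m) * exp (- of_nat m * z) :: complex) \<le> r1_gf_real (Re z)"
proof -
  have "norm (\<Sum>m<N. of_nat (r1 1 m) * exp (- of_nat m * z) :: complex) \<le> (\<Sum>m<N. real (r1 1 m) * exp (- real m * Re z))"
    by (rule order_trans[OF norm_sum]) (simp only: norm_r1_gf_complex_term order_refl)
  also have "\<dots> \<le> r1_gf_real (Re z)"
    using r1_gf_real_sums[OF assms] sum_le_suminf[of "\<lambda>m. real (r1 1 m) * exp (- real m * Re z)" "{..<N}"]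
    by (simp add: sums_iff)
  finally show ?thesis .
qed

lemma norm_r1_gf_complex_le:
  assumes "0 < Re z" shows "norm (r1_gf_complex z) \<le> r1_gf_real (Re z)"
proof (rule Lim_norm_ubound)
  show "(\<lambda>N. \<Sum>m<N. of_nat (r1 1 m) * exp (- of_nat m * z)) \<longlonglongrightarrow> r1_gf_complex z"
    using r1_gf_complex_sums[OF assms] by (simp add: sums_def)
qed (use norm_r1_gf_complex_partial_le[OF assms] in auto)

lemma holomorphic_r1_gf_complex: "r1_gf_complex holomorphic_on {z. 0 < Re z}"
proof -
  define P where "P = (\<lambda>w. \<Sum>n. of_nat (r1 1 n) * w ^ n :: complex)"
  have sums: "(\<lambda>n. of_nat (r1 1 n) * w ^ n) sums P w" if "norm w < 1" for w
  proof (cases "w = 0")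
    case False
    then have "summable (\<lambda>n. of_nat (r1 1 n) * w ^ n)"
      using r1_gf[of w] that by (auto simp: sums_iff)
    then show ?thesis unfolding P_def by (rule summable_sums)
  next
    case True
    then show ?thesis using powser_sums_zero[of "\<lambda>n. of_nat (r1 1 n) :: complex"]
      by (simp add: P_def powser_zero)
  qed
  have P: "P holomorphic_on ball 0 1"
    by (rule power_series_holomorphic[where a = "\<lambda>n. of_nat (r1 1 n)"]) (use sums in auto)
  have "(\<lambda>z. P (exp (- z))) holomorphic_on {z. 0 < Re z}"
    by (rule holomorphic_on_compose_gen[unfolded o_def, OF _ P]) (auto intro!: holomorphic_intros)
  moreover have "P (exp (- z)) = r1_gf_complex z" if "0 < Re z" for z
    using sums_unique2[OF sums[of "exp (- z)"]] r1_gf[of "exp (- z)"] that by (simp add: r1_gf_complex_def)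
  ultimately show ?thesis by (rule holomorphic_transform) simp
qed

lemma has_integral_exp_period:
  fixes k :: int and c T :: real
  assumes "0 < c" "c * T = pi" "k \<noteq> 0"
  shows "((\<lambda>s. exp (\<i> * of_real (of_int k * c * s))) has_integral 0) {-T..T}"
proof -
  have T: "0 < T" using assms pi_gt_zero by (metis zero_less_mult_pos)
  let ?w = "\<i> * of_real (of_int k * c) :: complex"
  have w: "?w \<noteq> 0" using assms by simp
  have d: "((\<lambda>s. exp (?w * of_real s) / ?w) has_vector_derivative exp (\<i> * of_real (of_int k * c * s))) (at s within {-T..T})" for s
  proof -
    have "((\<lambda>z. exp (?w * z) / ?w) has_field_derivative exp (?w * of_real s)) (at (of_real s))"
      using w by (auto intro!: derivative_eq_intros)
    then have "((\<lambda>s. exp (?w * of_real s) / ?w) has_vector_derivative exp (?w * of_real s)) (at s)"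
      by (rule has_vector_derivative_real_field)
    then show ?thesis by (simp add: has_vector_derivative_at_within mult.assoc)
  qed
  have "((\<lambda>s. exp (\<i> * of_real (of_int k * c * s))) has_integral
     (exp (?w * of_real T) / ?w - exp (?w * of_real (- T)) / ?w)) {-T..T}"
    by (rule fundamental_theorem_of_calculus) (use T d in auto)
  moreover have "exp (?w * of_real T) = exp (?w * of_real (- T))"
  proof -
    have "?w * of_real T = \<i> * of_real (of_int k * pi)" "?w * of_real (- T) = \<i> * of_real (of_int (- k) * pi)"
      using assms(2) by (simp_all add: mult.assoc flip: of_real_mult)
    then show ?thesis
      by (simp only: cis_conv_exp[symmetric]) (simp add: complex_eq_iff sin_times_pi_eq_0)
  qed
  ultimately show ?thesis by simp
qed

text \<open>Cauchy's coefficient formula on the circle of radius exp (- x), with the angle written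
  as c s so that c can later be \<open>local_scale n\<close>. The partial sums are dominated by the
  constant \<open>r1_gf_real x\<close>, so integrating termwise is allowed.\<close>

lemma r1_eq_integral:
  fixes x c T :: real
  assumes x: "0 < x" and c: "0 < c" "c * T = pi"
  shows "(\<lambda>s. r1_gf_complex (Complex x (- (c * s))) * exp (- \<i> * of_real (of_nat n * c * s))) integrable_on {-T..T}"
    and "integral {-T..T} (\<lambda>s. r1_gf_complex (Complex x (- (c * s))) * exp (- \<i> * of_real (of_nat n * c * s))) =
      of_real (2 * T * (real (r1 1 n) * exp (- real n * x)))"
proof -
  let ?z = "\<lambda>s. Complex x (- (c * s))" and ?e = "\<lambda>s. exp (- \<i> * of_real (of_nat n * c * s)) :: complex"
  let ?f = "\<lambda>N s. (\<Sum>m<N. of_nat (r1 1 m) * exp (- of_nat m * ?z s)) * ?e s"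
  have T: "0 < T" using c pi_gt_zero by (metis zero_less_mult_pos)
  have trm: "of_nat (r1 1 m) * exp (- of_nat m * ?z s) * ?e s =
     of_real (real (r1 1 m) * exp (- real m * x)) * exp (\<i> * of_real (of_int (int m - int n) * c * s))" for m s
  proof -
    have "- of_nat m * ?z s = of_real (- real m * x) + \<i> * of_real (real m * c * s)"
      by (simp add: complex_eq_iff)
    then have "exp (- of_nat m * ?z s) * ?e s = of_real (exp (- real m * x)) * (exp (\<i> * of_real (real m * c * s)) * ?e s)"
      by (simp only: exp_add exp_of_real mult.assoc)
    also have "exp (\<i> * of_real (real m * c * s)) * ?e s = exp (\<i> * of_real (of_int (int m - int n) * c * s))"
      by (simp add: exp_add[symmetric] algebra_simps)
    finally show ?thesis by (simp add: mult.assoc)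
  qed
  have int: "((\<lambda>s. of_nat (r1 1 m) * exp (- of_nat m * ?z s) * ?e s) has_integral
      (if m = n then of_real (2 * T * (real (r1 1 n) * exp (- real n * x))) else 0)) {-T..T}" for m
  proof (cases "m = n")
    case True
    have "((\<lambda>s. of_real (real (r1 1 n) * exp (- real n * x)) :: complex) has_integral
        (T - (- T)) *\<^sub>R of_real (real (r1 1 n) * exp (- real n * x))) {-T..T}"
      by (rule has_integral_const_real[THEN has_integral_eq_rhs]) (use T in simp)
    then show ?thesis unfolding trm using True by (simp add: scaleR_conv_of_real)
  next
    case False
    then show ?thesis unfolding trm
      using has_integral_mult_right[OF has_integral_exp_period[OF c, of "int m - int n"],
        of "of_real (real (r1 1 m) * exp (- real m * x))"] by simp
  qed
  have intN: "(?f N has_integral (\<Sum>m<N. if m = n then of_real (2 * T * (real (r1 1 n) * exp (- real n * x))) else 0)) {-T..T}" for N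
    unfolding sum_distrib_right by (intro has_integral_sum int) auto
  have conv: "(\<lambda>N. ?f N s) \<longlonglongrightarrow> r1_gf_complex (?z s) * ?e s" for s
    using r1_gf_complex_sums[of "?z s"] x by (intro tendsto_mult tendsto_const) (simp add: sums_def)
  have bd: "norm (?f N s) \<le> r1_gf_real x" for N s
    using norm_r1_gf_complex_partial_le[of "?z s" N] x by (simp add: norm_mult)
  note dc = dominated_convergence[where S = "{-T..T}" and f = ?f and h = "\<lambda>_. r1_gf_real x" and g = "\<lambda>s. r1_gf_complex (?z s) * ?e s",
      OF has_integral_integrable[OF intN] integrable_const_ivl bd conv]
  show "(\<lambda>s. r1_gf_complex (?z s) * ?e s) integrable_on {-T..T}" by (rule dc(1))
  have "(\<lambda>N. integral {-T..T} (?f N)) \<longlonglongrightarrow> of_real (2 * T * (real (r1 1 n) * exp (- real n * x)))"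
  proof (rule tendsto_eventually)
    show "\<forall>\<^sub>F N in sequentially. integral {-T..T} (?f N) = of_real (2 * T * (real (r1 1 n) * exp (- real n * x)))"
      using eventually_gt_at_top[of n]
      by eventually_elim (subst integral_unique[OF intN], simp add: sum.delta)
  qed
  with dc(2) show "integral {-T..T} (\<lambda>s. r1_gf_complex (?z s) * ?e s) = of_real (2 * T * (real (r1 1 n) * exp (- real n * x)))"
    by (rule LIMSEQ_unique)
qed

section \<open>Convergence of the moment generating functions\<close>

text \<open>The first is the minimiser of pi^2 / (15 x) + n x over positive x, the second its power
  3/2, the reciprocal order of the fluctuations.\<close>

definition saddle_point :: "nat \<Rightarrow> real" where "saddle_point n = pi / sqrt (15 * real n)"
definition local_scale :: "nat \<Rightarrow> real" where "local_scale n = saddle_point n * sqrt (saddle_point n)"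

text \<open>\<open>mgf n\<close> is the moment generating function of \<open>(N - n) \<cdot> saddle_point n powr (3/2)\<close>, where the random
  number \<open>N\<close> takes the value \<open>m\<close> with probability proportional to \<open>r1 1 m * exp (- m * saddle_point n)\<close>.\<close>

definition mgf :: "nat \<Rightarrow> complex \<Rightarrow> complex" where
  "mgf n w = exp (- of_real (real n * local_scale n) * w) * r1_gf_complex (of_real (saddle_point n) - of_real (local_scale n) * w) / of_real (r1_gf_real (saddle_point n))"

definition real_mgf :: "nat \<Rightarrow> real \<Rightarrow> real" where
  "real_mgf n \<theta> = exp (- real n * local_scale n * \<theta>) * r1_gf_real (saddle_point n - local_scale n * \<theta>) / r1_gf_real (saddle_point n)"

text \<open>This makes \<open>saddle_point n\<close> less than 1 for every positive n, hence
  \<open>local_scale n\<close> less than \<open>saddle_point n\<close>, so that the strip of real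
  parts below 1 in modulus stays inside the half-plane where F is defined.\<close>

lemma pi_less_sqrt_15: "pi < sqrt 15"
proof -
  have "pi \<le> 31415926535899 / 10 ^ 13" by (rule pi_approx(2))
  also have "\<dots> \<le> (3.8 :: real)" by simp
  also have "(3.8::real) < sqrt 15" by (rule real_less_rsqrt) (simp add: power2_eq_square)
  finally show ?thesis .
qed

lemma saddle_point_pos: "0 < n \<Longrightarrow> 0 < saddle_point n"
  by (simp add: saddle_point_def)

lemma saddle_point_less_1: "0 < n \<Longrightarrow> saddle_point n < 1"
proof -
  assume n: "0 < n"
  have "sqrt 15 * 1 \<le> sqrt 15 * sqrt (real n)" using n by (intro mult_left_mono) auto
  then have "pi < sqrt (15 * real n)" using pi_less_sqrt_15 unfolding real_sqrt_mult by linarith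
  then show ?thesis using n by (simp add: saddle_point_def)
qed

lemma saddle_point_square: "0 < n \<Longrightarrow> real n * (saddle_point n)\<^sup>2 = pi\<^sup>2 / 15"
  by (simp add: saddle_point_def power_divide)

lemma saddle_point_tendsto_0: "filterlim saddle_point (at_right 0) sequentially"
proof -
  have "saddle_point \<longlonglongrightarrow> 0" unfolding saddle_point_def by real_asymp
  moreover have "\<forall>\<^sub>F n in sequentially. 0 < saddle_point n"
    using eventually_gt_at_top[of 0] by eventually_elim (rule saddle_point_pos)
  ultimately show ?thesis by (simp add: filterlim_at eventually_conj_iff) (auto elim: eventually_mono)
qed

lemma local_scale_pos: "0 < n \<Longrightarrow> 0 < local_scale n"
  using saddle_point_pos by (simp add: local_scale_def)

lemma local_scale_less_saddle_point: "0 < n \<Longrightarrow> local_scale n < saddle_point n"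
  using saddle_point_pos[of n] saddle_point_less_1[of n] by (simp add: local_scale_def)

text \<open>Amounts to 1/u - 1 - (1 - u) = (1 - u)^2 / u: replacing x by x u changes the exponent A
  / x at the saddle point only to second order.\<close>

lemma real_mgf_exponent:
  fixes x u t A :: real
  assumes "0 < x" "0 < u" "t = (1 - u)\<^sup>2 / x"
  shows "- (A * (1 - u) / x) = (- A / (x * u) - - A / x) + A * t / u"
  unfolding assms(3) using assms(1,2) by (simp add: divide_simps) (simp add: power2_eq_square algebra_simps)

text \<open>The shifted argument is x u with u = 1 - sqrt x * \<theta> tending to 1. At the saddle
  point the exponential factors combine exactly to exp (A \<theta>^2 / u), so only quotients with
  known limits remain.\<close>

lemma real_mgf_tendsto: "(\<lambda>n. real_mgf n \<theta>) \<longlonglongrightarrow> exp (pi\<^sup>2 / 15 * \<theta>\<^sup>2)"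
proof -
  let ?A = "pi\<^sup>2 / 15 :: real" and ?L = "ln golden_ratio * sqrt (golden_ratio / sqrt 5)"
  let ?g = "\<lambda>x. x * r1_gf_real x * exp (- ?A / x)"
  let ?y = "\<lambda>n. saddle_point n - local_scale n * \<theta>" and ?u = "\<lambda>n. 1 - sqrt (saddle_point n) * \<theta>"
  have x0: "saddle_point \<longlonglongrightarrow> 0" using saddle_point_tendsto_0 by (simp add: filterlim_at)
  have "?u \<longlonglongrightarrow> 1 - sqrt 0 * \<theta>" by (intro tendsto_intros x0)
  then have u: "?u \<longlonglongrightarrow> 1" by simp
  then have upos: "\<forall>\<^sub>F n in sequentially. 0 < ?u n" by (rule order_tendstoD) simp
  have yu: "?y n = saddle_point n * ?u n" for n by (simp add: local_scale_def algebra_simps)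
  have "filterlim ?y (at_right 0) sequentially"
  proof -
    have "?y \<longlonglongrightarrow> 0 * 1" unfolding yu by (intro tendsto_mult x0 u)
    moreover have "\<forall>\<^sub>F n in sequentially. 0 < ?y n"
      using upos eventually_gt_at_top[of 0] by eventually_elim (simp only: yu, intro mult_pos_pos saddle_point_pos)
    ultimately show ?thesis by (simp add: filterlim_at eventually_conj_iff) (auto elim: eventually_mono)
  qed
  then have gy: "(\<lambda>n. ?g (?y n)) \<longlonglongrightarrow> ?L" by (rule filterlim_compose[OF r1_gf_real_asymp])
  have gx: "(\<lambda>n. ?g (saddle_point n)) \<longlonglongrightarrow> ?L" by (rule filterlim_compose[OF r1_gf_real_asymp saddle_point_tendsto_0])
  have L: "?L \<noteq> 0" using golden_ratio_gt_1 by simp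
  have "(\<lambda>n. ?g (?y n) / ?g (saddle_point n) / ?u n * exp (?A * \<theta>\<^sup>2 / ?u n)) \<longlonglongrightarrow> ?L / ?L / 1 * exp (?A * \<theta>\<^sup>2 / 1)"
    by (rule tendsto_mult[OF tendsto_divide[OF tendsto_divide[OF gy gx L] u]
          tendsto_exp[OF tendsto_divide[OF tendsto_const u]]]) simp_all
  also have "?L / ?L / 1 * exp (?A * \<theta>\<^sup>2 / 1) = exp (?A * \<theta>\<^sup>2)"
    unfolding divide_self[OF L] by simp
  finally have "(\<lambda>n. ?g (?y n) / ?g (saddle_point n) / ?u n * exp (?A * \<theta>\<^sup>2 / ?u n)) \<longlonglongrightarrow> exp (?A * \<theta>\<^sup>2)" .
  also have "?this \<longleftrightarrow> ?thesis"
  proof (rule tendsto_cong)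
    show "\<forall>\<^sub>F n in sequentially. ?g (?y n) / ?g (saddle_point n) / ?u n * exp (?A * \<theta>\<^sup>2 / ?u n) = real_mgf n \<theta>"
      using upos eventually_gt_at_top[of 0]
    proof eventually_elim
      case (elim n)
      define x u where "x = saddle_point n" and "u = ?u n"
      have x: "0 < x" and u: "0 < u" using elim saddle_point_pos by (simp_all add: x_def u_def)
      have yx: "saddle_point n - local_scale n * \<theta> = x * u" unfolding x_def u_def by (rule yu)
      have F: "r1_gf_real x \<noteq> 0" using r1_gf_real_pos[OF x] by simp
      have s: "sqrt x * \<theta> = 1 - u" "sqrt x \<noteq> 0" using x by (simp_all add: x_def u_def)
      have \<theta>2: "\<theta>\<^sup>2 * x = (1 - u)\<^sup>2" unfolding s(1)[symmetric] power_mult_distrib using x by simp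
      have "real n * local_scale n * \<theta> = real n * x\<^sup>2 * (sqrt x * \<theta>) / x"
        using x by (simp add: local_scale_def x_def[symmetric] power2_eq_square)
      also have "\<dots> = ?A * (1 - u) / x"
        unfolding s(1) using saddle_point_square[OF elim(2), folded x_def] by (simp only:)
      finally have 1: "- real n * local_scale n * \<theta> = - (?A * (1 - u) / x)" by (simp only: mult_minus_left)
      have "\<theta>\<^sup>2 = (1 - u)\<^sup>2 / x" using \<theta>2 x by (simp add: field_simps)
      then have 2: "- (?A * (1 - u) / x) = (- ?A / (x * u) - - ?A / x) + ?A * \<theta>\<^sup>2 / u"
        by (rule real_mgf_exponent[OF x u])
      have "exp (- real n * local_scale n * \<theta>) = exp (- ?A / (x * u)) / exp (- ?A / x) * exp (?A * \<theta>\<^sup>2 / u)"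
        unfolding 1 2 by (simp only: exp_add exp_diff)
      then have "real_mgf n \<theta> = exp (- ?A / (x * u)) / exp (- ?A / x) * exp (?A * \<theta>\<^sup>2 / u) * r1_gf_real (x * u) / r1_gf_real x"
        unfolding real_mgf_def yx by (simp only: x_def)
      also have "\<dots> = (x * u * r1_gf_real (x * u) * exp (- ?A / (x * u))) / (x * r1_gf_real x * exp (- ?A / x)) / u * exp (?A * \<theta>\<^sup>2 / u)"
        using F x u exp_not_eq_zero[of "- ?A / x"] by (simp only: divide_simps) auto
      finally show ?case unfolding yx unfolding u_def[symmetric] unfolding x_def[symmetric] by (rule sym)
    qed
  qed
  finally show ?thesis .
qed

lemma norm_mgf_le:
  assumes n: "0 < n" and w: "\<bar>Re w\<bar> < 1"
  shows "norm (mgf n w) \<le> real_mgf n (Re w)"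
proof -
  have "local_scale n * Re w \<le> local_scale n * 1" using w local_scale_pos[OF n] by (intro mult_left_mono) auto
  then have "local_scale n * Re w < saddle_point n" using local_scale_less_saddle_point[OF n] by linarith
  then have p: "0 < Re (of_real (saddle_point n) - of_real (local_scale n) * w)" by simp
  have "norm (mgf n w) = exp (- real n * local_scale n * Re w) * norm (r1_gf_complex (of_real (saddle_point n) - of_real (local_scale n) * w)) / r1_gf_real (saddle_point n)"
    using r1_gf_real_pos[OF saddle_point_pos[OF n]] by (simp add: mgf_def norm_mult norm_divide)
  also have "\<dots> \<le> exp (- real n * local_scale n * Re w) * r1_gf_real (Re (of_real (saddle_point n) - of_real (local_scale n) * w)) / r1_gf_real (saddle_point n)"
    using r1_gf_real_pos[OF saddle_point_pos[OF n]] norm_r1_gf_complex_le[OF p] by (intro divide_right_mono mult_left_mono) auto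
  finally show ?thesis by (simp add: real_mgf_def)
qed

lemma mgf_of_real:
  assumes n: "0 < n" and w: "\<bar>\<theta>\<bar> < 1"
  shows "mgf n (of_real \<theta>) = of_real (real_mgf n \<theta>)"
proof -
  have "local_scale n * \<theta> \<le> local_scale n * 1" using w local_scale_pos[OF n] by (intro mult_left_mono) auto
  then have p: "0 < saddle_point n - local_scale n * \<theta>" using local_scale_less_saddle_point[OF n] by linarith
  have "exp (- complex_of_real (real n * local_scale n) * of_real \<theta>) = of_real (exp (- real n * local_scale n * \<theta>))"
    by (simp only: exp_of_real[symmetric] of_real_mult of_real_minus mult_minus_left)
  then show ?thesis
    using r1_gf_complex_of_real[OF p] by (simp add: mgf_def real_mgf_def)
qed

text \<open>Termwise, exp (a \<theta>) <= exp a + exp (- a). Together with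
  \<open>norm_mgf_le\<close> this reduces a bound on the whole strip to the two real points 1 and
  -1.\<close>

lemma real_mgf_le:
  assumes n: "0 < n" and t: "\<bar>\<theta>\<bar> \<le> 1"
  shows "real_mgf n \<theta> \<le> real_mgf n 1 + real_mgf n (- 1)"
proof -
  note x = saddle_point_pos[OF n] and c = local_scale_pos[OF n] local_scale_less_saddle_point[OF n]
  have s: "(\<lambda>m. real (r1 1 m) * exp (- real m * saddle_point n) * exp ((real m - real n) * local_scale n * t)) sums
      (exp (- real n * local_scale n * t) * r1_gf_real (saddle_point n - local_scale n * t))" if "\<bar>t\<bar> \<le> 1" for t
  proof -
    have "local_scale n * t \<le> local_scale n * 1" using that c by (intro mult_left_mono) auto
    then have "0 < saddle_point n - local_scale n * t" using c by linarith
    from sums_mult[OF r1_gf_real_sums[OF this], of "exp (- real n * local_scale n * t)"] show ?thesis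
    proof (rule sums_cong[THEN iffD1, rotated])
      fix m
      have "exp (- real n * local_scale n * t) * exp (- real m * (saddle_point n - local_scale n * t)) = exp (- real m * saddle_point n) * exp ((real m - real n) * local_scale n * t)"
        by (simp add: exp_add[symmetric] algebra_simps)
      then show "exp (- real n * local_scale n * t) * (real (r1 1 m) * exp (- real m * (saddle_point n - local_scale n * t))) =
         real (r1 1 m) * exp (- real m * saddle_point n) * exp ((real m - real n) * local_scale n * t)"
        by (simp only: mult_ac)
    qed
  qed
  have "exp (- real n * local_scale n * \<theta>) * r1_gf_real (saddle_point n - local_scale n * \<theta>) \<le>
    exp (- real n * local_scale n * 1) * r1_gf_real (saddle_point n - local_scale n * 1) + exp (- real n * local_scale n * (- 1)) * r1_gf_real (saddle_point n - local_scale n * (- 1))"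
  proof (rule sums_le[OF _ s[OF t] sums_add[OF s s]])
    fix m
    let ?a = "(real m - real n) * local_scale n"
    have "?a * \<theta> \<le> \<bar>?a * \<theta>\<bar>" by (rule abs_ge_self)
    also have "\<dots> \<le> \<bar>?a\<bar> * 1" unfolding abs_mult[of ?a] using t by (intro mult_left_mono) auto
    finally have "?a * \<theta> \<le> \<bar>?a\<bar>" by simp
    then have "exp (?a * \<theta>) \<le> exp \<bar>?a\<bar>" by simp
    also have "\<dots> \<le> exp (?a * 1) + exp (?a * (- 1))" by (cases "0 \<le> ?a") auto
    finally have "real (r1 1 m) * exp (- real m * saddle_point n) * exp (?a * \<theta>) \<le> real (r1 1 m) * exp (- real m * saddle_point n) * (exp (?a * 1) + exp (?a * (- 1)))"
      by (intro mult_left_mono) auto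
    then show "real (r1 1 m) * exp (- real m * saddle_point n) * exp (?a * \<theta>) \<le>
       real (r1 1 m) * exp (- real m * saddle_point n) * exp (?a * 1) + real (r1 1 m) * exp (- real m * saddle_point n) * exp (?a * (- 1))"
      by (simp only: distrib_left)
  qed auto
  then have "exp (- real n * local_scale n * \<theta>) * r1_gf_real (saddle_point n - local_scale n * \<theta>) / r1_gf_real (saddle_point n) \<le>
    (exp (- real n * local_scale n * 1) * r1_gf_real (saddle_point n - local_scale n * 1) + exp (- real n * local_scale n * (- 1)) * r1_gf_real (saddle_point n - local_scale n * (- 1))) / r1_gf_real (saddle_point n)"
    using r1_gf_real_pos[OF x] by (intro divide_right_mono) auto
  then show ?thesis unfolding real_mgf_def add_divide_distrib .
qed

text \<open>Needed because Montel's theorem yields only convergent subsequences, all of which will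
  have the same limit.\<close>

lemma tendsto_from_subseq:
  fixes f :: "nat \<Rightarrow> 'a :: metric_space"
  assumes "\<And>r :: nat \<Rightarrow> nat. strict_mono r \<Longrightarrow> \<exists>r'. strict_mono r' \<and> (\<lambda>n. f (r (r' n))) \<longlonglongrightarrow> l"
  shows "f \<longlonglongrightarrow> l"
proof (rule ccontr)
  assume "\<not> f \<longlonglongrightarrow> l"
  then obtain e where e: "0 < e" "\<And>N. \<exists>n\<ge>N. e \<le> dist (f n) l"
    unfolding lim_sequentially by (auto simp: not_less)
  then have "infinite {n. e \<le> dist (f n) l}"
    unfolding infinite_nat_iff_unbounded_le by auto
  then obtain r :: "nat \<Rightarrow> nat" where r: "strict_mono r" "\<And>n. r n \<in> {n. e \<le> dist (f n) l}"
    using infinite_enumerate by blast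
  from assms[OF r(1)] obtain r' where "(\<lambda>n. f (r (r' n))) \<longlonglongrightarrow> l" by blast
  then have "\<forall>\<^sub>F n in sequentially. dist (f (r (r' n))) l < e" using e(1) by (rule tendstoD)
  then obtain n where "dist (f (r (r' n))) l < e" by (auto simp: eventually_sequentially)
  with r(2)[of "r' n"] show False by simp
qed

text \<open>The moment generating functions converge on a real interval to that of a Gaussian; being
  locally bounded on a strip, they converge on the whole strip (Montel and the identity theorem),
  in particular on the imaginary axis.\<close>

lemma mgf_tendsto:
  assumes w: "\<bar>Re w\<bar> < 1"
  shows "(\<lambda>n. mgf n w) \<longlonglongrightarrow> exp (of_real (pi\<^sup>2 / 15) * w\<^sup>2)"
proof (rule tendsto_from_subseq)
  fix r :: "nat \<Rightarrow> nat" assume r: "strict_mono r"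
  define S where "S = {w. \<bar>Re w\<bar> < 1}"
  have S_eq: "S = {w. - 1 < Re w} \<inter> {w. Re w < 1}" by (auto simp: S_def)
  have oS: "open S" unfolding S_eq by (intro open_Int open_halfspace_Re_gt open_halfspace_Re_lt)
  have cS: "connected S" unfolding S_eq by (intro convex_connected convex_Int convex_halfspace_Re_gt convex_halfspace_Re_lt)
  \<comment> \<open>The shift excludes r 0, which may be 0; at n = 0 the saddle point evaluates to 0
    and \<open>mgf\<close> is not meaningful.\<close>
  define f where "f = (\<lambda>n. mgf (r (Suc n)))"
  have rpos: "0 < r (Suc n)" for n using strict_mono_less[OF r, of 0 "Suc n"] by simp
  have hol: "f n holomorphic_on S" for n
  proof -
    note c = local_scale_pos[OF rpos[of n]] local_scale_less_saddle_point[OF rpos[of n]]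
    have "0 < Re (of_real (saddle_point (r (Suc n))) - of_real (local_scale (r (Suc n))) * w)" if "w \<in> S" for w
    proof -
      have "local_scale (r (Suc n)) * Re w \<le> local_scale (r (Suc n)) * 1" using that c by (intro mult_left_mono) (auto simp: S_def)
      then have "local_scale (r (Suc n)) * Re w < saddle_point (r (Suc n))" using c by linarith
      then show ?thesis by simp
    qed
    then have "(\<lambda>w. r1_gf_complex (of_real (saddle_point (r (Suc n))) - of_real (local_scale (r (Suc n))) * w)) holomorphic_on S"
      by (intro holomorphic_on_compose_gen[unfolded o_def, OF _ holomorphic_r1_gf_complex]) (auto intro!: holomorphic_intros)
    then show ?thesis unfolding f_def mgf_def[abs_def]
      using r1_gf_real_pos[OF saddle_point_pos[OF rpos[of n]]] by (intro holomorphic_intros) auto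
  qed
  \<comment> \<open>Convergence at the points 1 and -1 alone provides a bound that is uniform in n
    and in the strip.\<close>
  have "convergent (\<lambda>n. real_mgf n 1 + real_mgf n (- 1))"
    by (intro convergent_add) (auto simp: convergent_def intro: real_mgf_tendsto)
  from convergent_imp_Bseq[OF this]
  obtain B where B: "\<forall>n. norm (real_mgf n 1 + real_mgf n (- 1)) \<le> B" by (rule BseqE)
  have bound: "norm (f n z) \<le> B" if "z \<in> S" for n z
  proof -
    have z: "\<bar>Re z\<bar> < 1" using that by (simp add: S_def)
    note norm_mgf_le[OF rpos[of n] z]
    also have "real_mgf (r (Suc n)) (Re z) \<le> real_mgf (r (Suc n)) 1 + real_mgf (r (Suc n)) (- 1)"
      using z by (intro real_mgf_le rpos) simp
    also have "\<dots> \<le> B" using B[rule_format, of "r (Suc n)"] unfolding real_norm_def by linarith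
    finally show ?thesis by (simp add: f_def)
  qed
  obtain g r' where g: "g holomorphic_on S" "strict_mono (r' :: nat \<Rightarrow> nat)"
    "\<And>z. z \<in> S \<Longrightarrow> (\<lambda>n. f (r' n) z) \<longlonglongrightarrow> g z"
  proof (rule Montel[OF oS, where \<H> = "range f" and \<F> = f])
    show "h holomorphic_on S" if "h \<in> range f" for h using that hol by auto
    show "\<exists>B. \<forall>h\<in>range f. \<forall>z\<in>K. norm (h z) \<le> B" if "compact K" "K \<subseteq> S" for K
      using that bound by (intro exI[of _ B]) auto
  qed (auto intro: that)
  have sm: "strict_mono (\<lambda>n. Suc (r' n))" using g(2) by (simp add: strict_mono_def)
  have greal: "g (of_real \<theta>) = exp (of_real (pi\<^sup>2 / 15) * (of_real \<theta>)\<^sup>2)" if "\<bar>\<theta>\<bar> < 1" for \<theta>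
  proof (rule LIMSEQ_unique)
    show "(\<lambda>n. f (r' n) (of_real \<theta>)) \<longlonglongrightarrow> g (of_real \<theta>)" using that by (intro g(3)) (simp add: S_def)
    have "strict_mono (r \<circ> (\<lambda>n. Suc (r' n)))" by (rule strict_mono_o[OF r sm])
    from LIMSEQ_subseq_LIMSEQ[OF real_mgf_tendsto this]
    have "(\<lambda>n. complex_of_real (real_mgf (r (Suc (r' n))) \<theta>)) \<longlonglongrightarrow> of_real (exp (pi\<^sup>2 / 15 * \<theta>\<^sup>2))"
      by (intro tendsto_of_real) (simp add: o_def)
    moreover have "f (r' n) (of_real \<theta>) = complex_of_real (real_mgf (r (Suc (r' n))) \<theta>)" for n
      unfolding f_def using mgf_of_real[OF rpos that] .
    moreover have "complex_of_real (exp (pi\<^sup>2 / 15 * \<theta>\<^sup>2)) = exp (of_real (pi\<^sup>2 / 15) * (of_real \<theta>)\<^sup>2)"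
      by (simp only: exp_of_real[symmetric] of_real_mult of_real_power)
    ultimately show "(\<lambda>n. f (r' n) (of_real \<theta>)) \<longlonglongrightarrow> exp (of_real (pi\<^sup>2 / 15) * (of_real \<theta>)\<^sup>2)" by simp
  qed
  have eq: "g z - exp (of_real (pi\<^sup>2 / 15) * z\<^sup>2) = 0" if "z \<in> S" for z
  proof (rule analytic_continuation[of "\<lambda>z. g z - exp (of_real (pi\<^sup>2 / 15) * z\<^sup>2)" S "of_real ` {0<..<1}" 0])
    show "(\<lambda>z. g z - exp (of_real (pi\<^sup>2 / 15) * z\<^sup>2)) holomorphic_on S" by (intro holomorphic_intros g(1))
    show "of_real ` {0<..<1} \<subseteq> S" by (auto simp: S_def)
    show "(0::complex) islimpt of_real ` {0<..<1}"
      unfolding islimpt_sequential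
    proof (intro exI[of _ "\<lambda>n. complex_of_real (1 / (real n + 2))"] conjI allI)
      show "(\<lambda>n. complex_of_real (1 / (real n + 2))) \<longlonglongrightarrow> 0"
        by (rule tendsto_of_real[of _ 0, simplified]) real_asymp
      fix n
      have "1 / (real n + 2) \<in> {0<..<1}" by simp
      then show "complex_of_real (1 / (real n + 2)) \<in> of_real ` {0<..<1} - {0}"
        by (simp only: Diff_iff imageI singleton_iff of_real_eq_0_iff) simp
    qed
  qed (use oS cS that greal in \<open>auto simp: S_def\<close>)
  have "(\<lambda>n. mgf (r (Suc (r' n))) w) \<longlonglongrightarrow> exp (of_real (pi\<^sup>2 / 15) * w\<^sup>2)"
    using g(3)[of w] eq[of w] w by (simp add: f_def S_def)
  with sm show "\<exists>r'. strict_mono r' \<and> (\<lambda>n. mgf (r (r' n)) w) \<longlonglongrightarrow> exp (of_real (pi\<^sup>2 / 15) * w\<^sup>2)"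
    by (intro exI[of _ "\<lambda>n. Suc (r' n)"]) simp
qed

section \<open>Bounds away from the real axis\<close>

lemma sin_ge_two_over_pi:
  assumes "0 \<le> t" "t \<le> pi / 2" shows "2 * t / pi \<le> sin t"
proof -
  have "concave_on {0..pi / 2} sin"
    by (rule f''_le0_imp_concave[where f' = cos and f'' = "\<lambda>x. - sin x"])
      (auto intro!: derivative_eq_intros sin_ge_zero)
  then have "(1 - 2 * t / pi) * sin 0 + (2 * t / pi) * sin (pi / 2) \<le> sin ((1 - 2 * t / pi) *\<^sub>R 0 + (2 * t / pi) *\<^sub>R (pi / 2))"
    using assms by (intro concave_onD) (auto simp: field_simps)
  then show ?thesis by simp
qed

lemma one_minus_cos_ge:
  assumes "\<bar>t\<bar> \<le> pi" shows "2 * t\<^sup>2 / pi\<^sup>2 \<le> 1 - cos t"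
proof -
  have "2 * (\<bar>t\<bar> / 2) / pi \<le> sin (\<bar>t\<bar> / 2)" using assms by (intro sin_ge_two_over_pi) auto
  then have "(\<bar>t\<bar> / pi)\<^sup>2 \<le> (sin (\<bar>t\<bar> / 2))\<^sup>2" by (intro power_mono) auto
  moreover have "cos t = 1 - 2 * (sin (\<bar>t\<bar> / 2))\<^sup>2" using cos_double_sin[of "\<bar>t\<bar> / 2"] by simp
  ultimately show ?thesis by (simp add: power_divide)
qed

lemma sum_squares_ge: "real J ^ 3 / 3 \<le> (\<Sum>j=1..J. (real j)\<^sup>2)"
proof (induction J)
  case (Suc J)
  have "real (Suc J) ^ 3 / 3 \<le> real J ^ 3 / 3 + (real (Suc J))\<^sup>2"
    by (simp add: power3_eq_cube power2_eq_square field_simps)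
  with Suc show ?case by simp
qed simp

text \<open>The Dirichlet kernel, multiplied out so that zeros of sin (y / 2) need no
  exception.\<close>

lemma sum_cos_telescope: "2 * sin (y / 2) * (\<Sum>j=1..J. cos (real j * y)) = sin (real J * y + y / 2) - sin (y / 2)"
proof (induction J)
  case (Suc J)
  have "real J * y + y / 2 = real (Suc J) * y - y / 2" by (simp add: algebra_simps)
  then have "sin (real (Suc J) * y + y / 2) - sin (real J * y + y / 2) = 2 * sin (y / 2) * cos (real (Suc J) * y)"
    by (simp only: sin_add sin_diff) simp
  with Suc show ?case by (simp add: distrib_left)
qed simp

text \<open>If J |y| <= pi, every angle j y lies in [-pi, pi] and the quadratic bound applies to
  each term. Otherwise sin (|y| / 2) is at least 1 / J, and the Dirichlet kernel bounds the sum of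
  cosines by J / 2.\<close>

lemma sum_one_minus_cos_ge:
  assumes y: "\<bar>y\<bar> \<le> pi" and J: "0 < J"
  shows "min (real J / 2) (2 * y\<^sup>2 * real J ^ 3 / (3 * pi\<^sup>2)) \<le> (\<Sum>j=1..J. 1 - cos (real j * y))"
proof (cases "real J * \<bar>y\<bar> \<le> pi")
  case True
  have "2 * y\<^sup>2 * real J ^ 3 / (3 * pi\<^sup>2) = (2 * y\<^sup>2 / pi\<^sup>2) * (real J ^ 3 / 3)" by simp
  also have "\<dots> \<le> (2 * y\<^sup>2 / pi\<^sup>2) * (\<Sum>j=1..J. (real j)\<^sup>2)" by (intro mult_left_mono sum_squares_ge) auto
  also have "\<dots> = (\<Sum>j=1..J. 2 * (real j * y)\<^sup>2 / pi\<^sup>2)"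
    by (simp add: sum_distrib_left sum_divide_distrib power_mult_distrib mult_ac)
  also have "\<dots> \<le> (\<Sum>j=1..J. 1 - cos (real j * y))"
  proof (intro sum_mono one_minus_cos_ge)
    fix j assume "j \<in> {1..J}"
    then have "real j * \<bar>y\<bar> \<le> real J * \<bar>y\<bar>" by (intro mult_right_mono) auto
    with True show "\<bar>real j * y\<bar> \<le> pi" by (simp add: abs_mult)
  qed
  finally show ?thesis by simp
next
  case False
  define z where "z = \<bar>y\<bar>"
  have z: "z \<le> pi" "pi < real J * z" using y False by (auto simp: z_def)
  have z0: "0 < z" using z(2) pi_gt_zero by (cases "z = 0") (auto simp: z_def)
  have s: "z / pi \<le> sin (z / 2)" using sin_ge_two_over_pi[of "z / 2"] z z0 by simp
  define C where "C = (\<Sum>j=1..J. cos (real j * z))"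
  have C: "C = (\<Sum>j=1..J. cos (real j * y))" unfolding C_def z_def
    by (rule sum.cong) (auto simp: abs_if)
  have "2 * sin (z / 2) * C \<le> 1 - sin (z / 2)"
    unfolding C_def sum_cos_telescope by simp
  moreover have "1 \<le> real J * sin (z / 2)"
  proof -
    have "1 \<le> real J * (z / pi)" using z pi_gt_zero by (simp add: field_simps)
    also have "\<dots> \<le> real J * sin (z / 2)" using s by (intro mult_left_mono) auto
    finally show ?thesis .
  qed
  moreover have sp: "0 < sin (z / 2)" using s z0 by (smt (verit) divide_pos_pos pi_gt_zero)
  ultimately have "sin (z / 2) * (2 * C) \<le> sin (z / 2) * real J" by (simp only: mult_ac)
  then have "2 * C \<le> real J" using sp by simp
  then have "real J / 2 \<le> (\<Sum>j=1..J. 1 - cos (real j * y))"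
    using C by (simp add: sum_subtractf)
  then show ?thesis by simp
qed

section \<open>The gain from the denominators off the real axis\<close>

lemma norm_one_minus_cis:
  "(norm (1 - of_real \<rho> * cis t))\<^sup>2 = (1 - \<rho>)\<^sup>2 + 2 * \<rho> * (1 - cos t)"
proof -
  have "(norm (1 - of_real \<rho> * cis t))\<^sup>2 = (1 - \<rho> * cos t)\<^sup>2 + (\<rho> * sin t)\<^sup>2"
    by (simp add: cmod_power2)
  also have "(\<rho> * sin t)\<^sup>2 = \<rho>\<^sup>2 * (1 - (cos t)\<^sup>2)" by (simp add: power_mult_distrib sin_squared_eq)
  finally show ?thesis by (simp add: power2_eq_square algebra_simps)
qed

text \<open>With u = (1 - cos t) / 2 the squared norm is (1 - \<rho>)^2 + 4 \<rho> u, and exp (u /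
  2) <= 1 + u. It remains that (1 - \<rho>)^2 <= 4 \<rho>, which \<rho> >= 3/4 guarantees.\<close>

lemma norm_one_minus_cis_ge:
  assumes \<rho>: "3 / 4 \<le> \<rho>" "\<rho> < 1"
  shows "(1 - \<rho>)\<^sup>2 \<le> exp (- (1 - cos t) / 4) * (norm (1 - of_real \<rho> * cis t))\<^sup>2"
proof -
  define u where "u = (1 - cos t) / 2"
  have u: "0 \<le> u" "u \<le> 1" using cos_le_one[of t] cos_ge_minus_one[of t] by (simp_all add: u_def)
  have "u\<^sup>2 \<le> u" using u by (simp add: power2_eq_square mult_left_le)
  then have eu: "exp (u / 2) \<le> 1 + u"
    using exp_bound[of "u / 2"] u by (simp add: power_divide)
  have r: "(1 - \<rho>)\<^sup>2 \<le> 1 / 16" 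
  proof -
    have "(1 - \<rho>)\<^sup>2 \<le> (1 / 4)\<^sup>2" using \<rho> by (intro power_mono) auto
    then show ?thesis by (simp add: power2_eq_square)
  qed
  have "(1 - \<rho>)\<^sup>2 * exp (u / 2) \<le> (1 - \<rho>)\<^sup>2 * (1 + u)" using eu by (intro mult_left_mono) auto
  also have "\<dots> = (1 - \<rho>)\<^sup>2 + (1 - \<rho>)\<^sup>2 * u" by (simp add: algebra_simps)
  also have "(1 - \<rho>)\<^sup>2 * u \<le> (4 * \<rho>) * u" using r \<rho> u by (intro mult_right_mono) auto
  also have "(1 - \<rho>)\<^sup>2 + (4 * \<rho>) * u = (norm (1 - of_real \<rho> * cis t))\<^sup>2"
    unfolding norm_one_minus_cis u_def by simp
  finally have "(1 - \<rho>)\<^sup>2 * exp (u / 2) \<le> (norm (1 - of_real \<rho> * cis t))\<^sup>2" by simp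
  then have "exp (- (u / 2)) * ((1 - \<rho>)\<^sup>2 * exp (u / 2)) \<le> exp (- (u / 2)) * (norm (1 - of_real \<rho> * cis t))\<^sup>2"
    by (intro mult_left_mono) auto
  moreover have "exp (- (u / 2)) * ((1 - \<rho>)\<^sup>2 * exp (u / 2)) = (1 - \<rho>)\<^sup>2" by (simp add: exp_minus)
  moreover have "- (u / 2) = - (1 - cos t) / 4" unfolding u_def by linarith
  ultimately show ?thesis by (simp only:)
qed

lemma exp_Complex_power: "exp (- Complex x (- y)) ^ j = of_real (exp (- x) ^ j) * cis (real j * y)"
proof -
  have "exp (- Complex x (- y)) = of_real (exp (- x)) * cis y"
    by (simp add: exp_eq_polar)
  then show ?thesis by (simp add: power_mult_distrib Complex.DeMoivre)
qed

text \<open>Each denominator factor grows in norm off the real axis. For j <= J the power exp (- j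
  x) is at least 3/4, so the gain is explicit; its constant 1/8 is half of the 1/4 for squared
  norms. The remaining factors are only bounded by 1.\<close>

lemma norm_gap2_gf_le_small_factors:
  fixes x y :: real
  assumes x: "0 < x" "real J * x \<le> 1 / 4" and k: "J \<le> k"
  shows "norm (gap2_gf k (exp (- Complex x (- y)))) \<le> gap2_gf k (exp (- x)) * exp (- (\<Sum>j=1..J. 1 - cos (real j * y)) / 8)"
proof -
  let ?r = "exp (- x)" and ?q = "exp (- Complex x (- y))"
  have r: "0 < ?r" "?r < 1" using x by auto
  have nq: "norm ?q = ?r" by simp
  have rj: "0 < 1 - ?r ^ j" if "1 \<le> j" for j using r that by (simp add: power_less_one_iff)
  have ge: "1 - ?r ^ j \<le> norm (1 - ?q ^ j)" for j
    using norm_triangle_ineq2[of 1 "?q ^ j"] by (simp add: norm_power)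
  have pos: "0 < norm (1 - ?q ^ j)" if "1 \<le> j" for j using rj[OF that] ge[of j] by linarith
  let ?R = "\<lambda>j. (1 - ?r ^ j) / norm (1 - ?q ^ j)"
  have R1: "?R j \<le> exp (- (1 - cos (real j * y)) / 8)" if "j \<in> {1..J}" for j
  proof -
    have "real j * x \<le> real J * x" using that x by (intro mult_right_mono) auto
    then have "3 / 4 \<le> 1 + - (real j * x)" using x by linarith
    also have "\<dots> \<le> exp (- (real j * x))" by (rule exp_ge_add_one_self)
    also have "\<dots> = ?r ^ j" by (simp add: exp_of_nat_mult[symmetric])
    finally have "3 / 4 \<le> ?r ^ j" .
    moreover have "?r ^ j < 1" using rj[of j] that by simp
    ultimately have "(1 - ?r ^ j)\<^sup>2 \<le> exp (- (1 - cos (real j * y)) / 4) * (norm (1 - ?q ^ j))\<^sup>2"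
      unfolding exp_Complex_power by (rule norm_one_minus_cis_ge)
    also have "\<dots> = (exp (- (1 - cos (real j * y)) / 8) * norm (1 - ?q ^ j))\<^sup>2"
      by (simp add: power_mult_distrib exp_double[symmetric])
    finally have "1 - ?r ^ j \<le> exp (- (1 - cos (real j * y)) / 8) * norm (1 - ?q ^ j)"
      by (rule power2_le_imp_le) simp
    then show ?thesis using pos[of j] that by (simp add: pos_divide_le_eq)
  qed
  have "norm (gap2_gf k ?q) = ?r ^ k\<^sup>2 / (\<Prod>j=1..k. norm (1 - ?q ^ j))"
    by (simp add: gap2_gf_def norm_divide norm_power prod_norm)
  also have "\<dots> = gap2_gf k ?r * (\<Prod>j=1..k. ?R j)"
  proof -
    have "(\<Prod>j=1..k. 1 - ?r ^ j) \<noteq> 0" using rj by (force simp: prod_zero_iff)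
    then show ?thesis by (simp add: gap2_gf_def prod_dividef)
  qed
  also have "(\<Prod>j=1..k. ?R j) \<le> (\<Prod>j=1..k. if j \<le> J then exp (- (1 - cos (real j * y)) / 8) else 1)"
  proof (rule prod_mono)
    fix j assume j: "j \<in> {1..k}"
    then have "0 \<le> ?R j" using rj[of j] by (intro divide_nonneg_nonneg) auto
    moreover have "?R j \<le> 1" using ge[of j] pos[of j] j by (simp add: pos_divide_le_eq)
    ultimately show "0 \<le> ?R j \<and> ?R j \<le> (if j \<le> J then exp (- (1 - cos (real j * y)) / 8) else 1)"
      using R1[of j] j by auto
  qed
  also have "\<dots> = (\<Prod>j\<in>{1..k} \<inter> {j. j \<le> J}. exp (- (1 - cos (real j * y)) / 8))"
    by (simp add: prod.If_cases)
  also have "{1..k} \<inter> {j. j \<le> J} = {1..J}" using k by auto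
  also have "(\<Prod>j=1..J. exp (- (1 - cos (real j * y)) / 8)) = exp (- (\<Sum>j=1..J. 1 - cos (real j * y)) / 8)"
    by (simp add: exp_sum[symmetric] sum_divide_distrib[symmetric] sum_negf[symmetric])
  finally show ?thesis using gap2_gf_pos[OF r, of k] by (simp add: mult_left_mono)
qed

text \<open>The ratio of consecutive terms is at least (1/2) / (1/4): its numerator is at least 1 -
  (2 k + 1) x and its denominator at most (k + 1) x.\<close>

lemma gap2_gf_double:
  assumes x: "0 < x" "real (Suc k) * x \<le> 1 / 4"
  shows "2 * gap2_gf k (exp (- x)) \<le> gap2_gf (Suc k) (exp (- x))"
proof -
  have g: "0 < gap2_gf k (exp (- x))" using x by (intro gap2_gf_pos) auto
  have e: "exp (- x) ^ m = exp (- (real m * x))" for m by (simp add: exp_of_nat_mult[symmetric])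
  have "1 / 2 \<le> 1 + - (real (2 * k + 1) * x)" using x by (simp add: algebra_simps)
  also have "\<dots> \<le> exp (- (real (2 * k + 1) * x))" by (rule exp_ge_add_one_self)
  finally have num: "1 / 2 \<le> exp (- x) ^ (2 * k + 1)" unfolding e .
  have "1 + - (real (Suc k) * x) \<le> exp (- (real (Suc k) * x))" by (rule exp_ge_add_one_self)
  then have den: "1 - exp (- x) ^ Suc k \<le> 1 / 4" unfolding e using x by linarith
  have den0: "0 < 1 - exp (- x) ^ Suc k" unfolding e using x by simp
  have "2 * (1 - exp (- x) ^ Suc k) \<le> 2 * (1 / 4)" using den by (rule mult_left_mono) simp
  also have "\<dots> = 1 / 2" by simp
  also note num
  finally have "2 * (1 - exp (- x) ^ Suc k) \<le> exp (- x) ^ (2 * k + 1)" .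
  then have "2 \<le> exp (- x) ^ (2 * k + 1) / (1 - exp (- x) ^ Suc k)" using den0 by (simp only: pos_le_divide_eq)
  then have "2 * gap2_gf k (exp (- x)) \<le> exp (- x) ^ (2 * k + 1) / (1 - exp (- x) ^ Suc k) * gap2_gf k (exp (- x))"
    using g by (intro mult_right_mono) auto
  then show ?thesis unfolding gap2_gf_Suc .
qed

lemma gap2_gf_double_iter:
  assumes x: "0 < x" "real (k + d) * x \<le> 1 / 4"
  shows "2 ^ d * gap2_gf k (exp (- x)) \<le> gap2_gf (k + d) (exp (- x))"
  using x(2)
proof (induction d)
  case (Suc d)
  have "real (k + d) * x \<le> real (k + Suc d) * x" using x(1) by (intro mult_right_mono) auto
  then have "2 ^ d * gap2_gf k (exp (- x)) \<le> gap2_gf (k + d) (exp (- x))" using Suc by linarith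
  moreover have "2 * gap2_gf (k + d) (exp (- x)) \<le> gap2_gf (Suc (k + d)) (exp (- x))"
    using Suc.prems x(1) by (intro gap2_gf_double) auto
  ultimately show ?case by simp
qed simp

text \<open>Below \<open>1/(4x)\<close> parts the weights at least double with each further part, which makes
  fewer than half as many parts exponentially unlikely.\<close>

lemma sum_few_parts_le:
  assumes x: "0 < x" "real (2 * J) * x \<le> 1 / 4"
  shows "(\<Sum>k<J. real k * gap2_gf k (exp (- x))) \<le> real J / 2 ^ J * r1_gf_real x"
proof (cases "J = 0")
  case False
  have pos: "0 < gap2_gf k (exp (- x))" for k using x by (intro gap2_gf_pos) auto
  have top: "real (2 * J) * gap2_gf (2 * J) (exp (- x)) \<le> r1_gf_real x"
    unfolding r1_gf_real_def
    using sum_le_suminf[OF summable_r1_gf_real[OF x(1)], of "{2 * J}"] pos by (simp add: less_imp_le)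
  \<comment> \<open>At least J doublings separate k from 2 J, and the term at 2 J is itself part of
    \<open>r1_gf_real x\<close>.\<close>
  have "real k * gap2_gf k (exp (- x)) \<le> r1_gf_real x / 2 ^ J" if "k \<in> {..<J}" for k
  proof -
    define d where "d = 2 * J - k"
    have d: "k + d = 2 * J" "J \<le> d" using that by (auto simp: d_def)
    have "2 ^ J * gap2_gf k (exp (- x)) \<le> 2 ^ d * gap2_gf k (exp (- x))"
      using d pos[of k] by (intro mult_right_mono power_increasing) auto
    also have "\<dots> \<le> gap2_gf (2 * J) (exp (- x))"
      using gap2_gf_double_iter[of x k d] x unfolding d(1) by simp
    finally have "real k * (2 ^ J * gap2_gf k (exp (- x))) \<le> real (2 * J) * gap2_gf (2 * J) (exp (- x))"
      using that pos[of k] by (intro mult_mono) auto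
    also note top
    finally show ?thesis by (simp add: field_simps)
  qed
  from sum_bounded_above[of "{..<J}", OF this] show ?thesis by simp
qed simp

text \<open>The first summand bounds the terms with fewer than J parts. The other two are the
  alternatives of the minimum in \<open>sum_one_minus_cos_ge\<close>, divided by 8 in the exponent.
  No restriction to y away from 0 is made.\<close>

lemma norm_r1_gf_complex_le_minor:
  fixes x y :: real
  assumes x: "0 < x" "real (2 * J) * x \<le> 1 / 4" and J: "0 < J" and y: "\<bar>y\<bar> \<le> pi"
  shows "norm (r1_gf_complex (Complex x (- y))) \<le>
    (real J / 2 ^ J + exp (- real J / 16) + exp (- (y\<^sup>2 * real J ^ 3 / (12 * pi\<^sup>2)))) * r1_gf_real x"
proof -
  let ?q = "exp (- Complex x (- y))" and ?r = "exp (- x)"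
  have pos: "0 < gap2_gf k ?r" for k using x by (intro gap2_gf_pos) auto
  have nq: "norm ?q = ?r" by simp
  have "norm ?q < 1" "0 < norm ?q" using x by auto
  then have sn: "summable (\<lambda>k. norm (of_nat k * gap2_gf k ?q))" by (intro summable_norm_gap2_gf)
  define s where "s = (\<Sum>j=1..J. 1 - cos (real j * y))"
  define \<phi> where "\<phi> = exp (- s / 8)"
  have t: "norm (of_nat k * gap2_gf k ?q) \<le> (if k < J then real k * gap2_gf k ?r else 0) + \<phi> * (real k * gap2_gf k ?r)" for k
  proof (cases "k < J")
    case True
    have "norm (gap2_gf k ?q) \<le> gap2_gf k ?r" using norm_gap2_gf_le[of ?q k] x by simp
    then have "real k * norm (gap2_gf k ?q) \<le> real k * gap2_gf k ?r" by (intro mult_left_mono) auto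
    moreover have "0 \<le> \<phi> * (real k * gap2_gf k ?r)" using pos[of k] by (simp add: \<phi>_def)
    ultimately show ?thesis using True by (simp add: norm_mult)
  next
    case False
    have "real J * x \<le> 1 / 4" using x by simp
    then have "norm (gap2_gf k ?q) \<le> gap2_gf k ?r * \<phi>"
      unfolding \<phi>_def s_def using False x by (intro norm_gap2_gf_le_small_factors) auto
    then have "real k * norm (gap2_gf k ?q) \<le> real k * (gap2_gf k ?r * \<phi>)" by (intro mult_left_mono) auto
    then show ?thesis using False by (simp add: norm_mult mult_ac)
  qed
  have S1: "(\<lambda>k. if k < J then real k * gap2_gf k ?r else 0) sums (\<Sum>k<J. real k * gap2_gf k ?r)"
    using sums_If_finite[of "\<lambda>k. k < J" "\<lambda>k. real k * gap2_gf k ?r"] by (simp add: lessThan_def)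
  have S2: "(\<lambda>k. \<phi> * (real k * gap2_gf k ?r)) sums (\<phi> * r1_gf_real x)"
    unfolding r1_gf_real_def by (intro sums_mult summable_sums summable_r1_gf_real x)
  have "norm (r1_gf_complex (Complex x (- y))) \<le> (\<Sum>k. norm (of_nat k * gap2_gf k ?q))"
    unfolding r1_gf_complex_def by (rule summable_norm[OF sn])
  also have "\<dots> \<le> (\<Sum>k<J. real k * gap2_gf k ?r) + \<phi> * r1_gf_real x"
    by (rule sums_le[OF t summable_sums[OF sn] sums_add[OF S1 S2]])
  also have "\<dots> \<le> real J / 2 ^ J * r1_gf_real x + \<phi> * r1_gf_real x"
    by (intro add_right_mono sum_few_parts_le x)
  also have "\<dots> = (real J / 2 ^ J + \<phi>) * r1_gf_real x" by (simp add: algebra_simps)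
  also have "\<dots> \<le> (real J / 2 ^ J + (exp (- real J / 16) + exp (- (y\<^sup>2 * real J ^ 3 / (12 * pi\<^sup>2))))) * r1_gf_real x"
  proof (intro mult_right_mono add_left_mono)
    have "min (real J / 2) (2 * y\<^sup>2 * real J ^ 3 / (3 * pi\<^sup>2)) \<le> s"
      unfolding s_def by (rule sum_one_minus_cos_ge[OF y J])
    then consider "real J / 2 \<le> s" | "2 * y\<^sup>2 * real J ^ 3 / (3 * pi\<^sup>2) \<le> s" by linarith
    then show "\<phi> \<le> exp (- real J / 16) + exp (- (y\<^sup>2 * real J ^ 3 / (12 * pi\<^sup>2)))"
    proof cases
      case 1
      then have "\<phi> \<le> exp (- real J / 16)" by (simp add: \<phi>_def)
      then show ?thesis by (rule order_trans) simp
    next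
      case 2
      have "y\<^sup>2 * real J ^ 3 / (12 * pi\<^sup>2) = (2 * y\<^sup>2 * real J ^ 3 / (3 * pi\<^sup>2)) / 8" by simp
      also have "\<dots> \<le> s / 8" using 2 by (rule divide_right_mono) simp
      finally have "\<phi> \<le> exp (- (y\<^sup>2 * real J ^ 3 / (12 * pi\<^sup>2)))" by (simp add: \<phi>_def)
      then show ?thesis by (rule order_trans) simp
    qed
  qed (use r1_gf_real_pos[OF x(1)] in simp)
  finally show ?thesis by (simp add: add.assoc)
qed

lemma mgf_imaginary:
  "mgf n (\<i> * of_real s) = exp (- \<i> * of_real (of_nat n * local_scale n * s)) * r1_gf_complex (Complex (saddle_point n) (- (local_scale n * s))) / of_real (r1_gf_real (saddle_point n))"
proof -
  have "complex_of_real (saddle_point n) - of_real (local_scale n) * (\<i> * of_real s) = Complex (saddle_point n) (- (local_scale n * s))"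
    by (simp add: complex_eq_iff)
  then show ?thesis unfolding mgf_def by (simp add: mult_ac)
qed

text \<open>With J of order 1 / x and y = \<open>local_scale n\<close> * s, the product y^2 J^3 is
  of order s^2, so the last summand of the bound is Gaussian in s. The other two do not decay in s
  but are exponentially small in J; as s^2 is at most pi^2 / x^3, of order J^3, they are still O(1 /
  (1 + s^2)).\<close>

lemma mgf_dominated:
  obtains \<kappa> C where "0 < \<kappa>" "0 \<le> C"
    "\<forall>\<^sub>F n in sequentially. \<forall>s. local_scale n * \<bar>s\<bar> \<le> pi \<longrightarrow>
       norm (mgf n (\<i> * of_real s)) \<le> exp (- (\<kappa> * s\<^sup>2)) + C * (1 / (1 + s\<^sup>2))"
proof -
  have "(\<lambda>J. real J ^ 3 * (real J / 2 ^ J)) \<longlonglongrightarrow> 0" by real_asymp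
  moreover have "(\<lambda>J. real J ^ 3 * exp (- real J / 16)) \<longlonglongrightarrow> 0" by real_asymp
  ultimately have "(\<lambda>J. real J ^ 3 * (real J / 2 ^ J) + real J ^ 3 * exp (- real J / 16)) \<longlonglongrightarrow> 0 + 0"
    by (rule tendsto_add)
  then have "(\<lambda>J. real J ^ 3 * (real J / 2 ^ J + exp (- real J / 16))) \<longlonglongrightarrow> 0"
    by (simp only: distrib_left add_0_left)
  then have "Bseq (\<lambda>J. real J ^ 3 * (real J / 2 ^ J + exp (- real J / 16)))"
    by (intro convergent_imp_Bseq) (auto simp: convergent_def)
  then obtain B where B: "0 < B" "\<forall>J. norm (real J ^ 3 * (real J / 2 ^ J + exp (- real J / 16))) \<le> B"
    by (rule BseqE)
  define \<kappa> where "\<kappa> = 1 / (12 * 4096 * pi\<^sup>2)"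
  define C where "C = B * 4096 * (1 + pi\<^sup>2)"
  have x0: "saddle_point \<longlonglongrightarrow> 0" using saddle_point_tendsto_0 by (simp add: filterlim_at)
  then have small: "\<forall>\<^sub>F n in sequentially. saddle_point n < 1 / 32" by (rule order_tendstoD) simp
  show ?thesis
  proof
    show "0 < \<kappa>" by (simp add: \<kappa>_def)
    show "0 \<le> C" using B by (simp add: C_def)
    show "\<forall>\<^sub>F n in sequentially. \<forall>s. local_scale n * \<bar>s\<bar> \<le> pi \<longrightarrow>
       norm (mgf n (\<i> * of_real s)) \<le> exp (- (\<kappa> * s\<^sup>2)) + C * (1 / (1 + s\<^sup>2))"
      using small eventually_gt_at_top[of 0]
    proof (eventually_elim, intro allI impI)
      fix n s assume xs: "saddle_point n < 1 / 32" and n: "0 < n" and s: "local_scale n * \<bar>s\<bar> \<le> pi"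
      define x where "x = saddle_point n"
      have x: "0 < x" "x < 1 / 32" using saddle_point_pos[OF n] xs by (simp_all add: x_def)
      have c2: "(local_scale n)\<^sup>2 = x ^ 3" using x by (simp add: local_scale_def x_def power2_eq_square power3_eq_cube)
      \<comment> \<open>The largest J with 2 J x <= 1/4. It is at least 1 / (16 x), and 16^3 = 4096
        is the constant in \<kappa> and C.\<close>
      define J where "J = nat \<lfloor>1 / (8 * x)\<rfloor>"
      have Jle: "real J \<le> 1 / (8 * x)" and Jgt: "1 / (8 * x) - 1 < real J"
        using x unfolding J_def by (auto simp: of_nat_nat)
      have "1 / (16 * x) + 1 \<le> 1 / (8 * x)" using x by (simp add: field_simps)
      with Jgt have Jge: "1 / (16 * x) \<le> real J" by linarith
      have J0: "0 < real J" using Jge x by (smt (verit) divide_pos_pos mult_pos_pos)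
      have Jx: "real (2 * J) * x \<le> 1 / 4" using Jle x by (simp add: field_simps)
      have xJ: "1 \<le> 4096 * (x ^ 3 * real J ^ 3)"
      proof -
        have "1 \<le> 16 * x * real J" using Jge x by (simp add: field_simps)
        then have "1 ^ 3 \<le> (16 * x * real J) ^ 3" by (intro power_mono) auto
        then show ?thesis by (simp add: power_mult_distrib)
      qed
      have t3: "exp (- ((local_scale n * s)\<^sup>2 * real J ^ 3 / (12 * pi\<^sup>2))) \<le> exp (- (\<kappa> * s\<^sup>2))"
      proof -
        have "\<kappa> * s\<^sup>2 * 1 \<le> \<kappa> * s\<^sup>2 * (4096 * (x ^ 3 * real J ^ 3))"
          by (intro mult_left_mono xJ) (simp add: \<kappa>_def)
        also have "\<dots> = (local_scale n * s)\<^sup>2 * real J ^ 3 / (12 * pi\<^sup>2)"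
          unfolding power_mult_distrib c2 by (simp add: \<kappa>_def)
        finally show ?thesis by simp
      qed
      have t12: "real J / 2 ^ J + exp (- real J / 16) \<le> C * (1 / (1 + s\<^sup>2))"
      proof -
        have "(local_scale n * \<bar>s\<bar>)\<^sup>2 \<le> pi\<^sup>2" using s local_scale_pos[OF n] by (intro power_mono) auto
        then have "x ^ 3 * s\<^sup>2 \<le> pi\<^sup>2" by (simp add: power_mult_distrib c2)
        moreover have "x ^ 3 \<le> 1" using x by (intro power_le_one) auto
        ultimately have xs: "x ^ 3 * (1 + s\<^sup>2) \<le> 1 + pi\<^sup>2" by (simp add: algebra_simps)
        let ?e = "real J / 2 ^ J + exp (- real J / 16)"
        have e0: "0 \<le> ?e" by simp
        have s0: "0 < 1 + s\<^sup>2" by (simp add: add_pos_nonneg)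
        have "?e * (1 + s\<^sup>2) * 1 \<le> ?e * (1 + s\<^sup>2) * (4096 * (x ^ 3 * real J ^ 3))"
          using e0 s0 by (intro mult_left_mono xJ) auto
        also have "\<dots> = (real J ^ 3 * ?e) * (4096 * (x ^ 3 * (1 + s\<^sup>2)))" by (simp only: mult_ac)
        also have "\<dots> \<le> B * (4096 * (1 + pi\<^sup>2))"
          using B(1) B(2)[rule_format, of J] xs x s0 by (intro mult_mono) auto
        finally have "?e * (1 + s\<^sup>2) \<le> C" by (simp only: C_def mult.assoc)
        then show ?thesis using s0 by (simp add: pos_le_divide_eq)
      qed
      have F: "0 < r1_gf_real x" using r1_gf_real_pos x by simp
      have y: "\<bar>local_scale n * s\<bar> \<le> pi" using s local_scale_pos[OF n] by (simp add: abs_mult)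
      have "norm (mgf n (\<i> * of_real s)) = norm (r1_gf_complex (Complex x (- (local_scale n * s)))) / r1_gf_real x"
        unfolding mgf_imaginary x_def[symmetric] using F by (simp add: norm_mult norm_divide)
      also have "\<dots> \<le> (real J / 2 ^ J + exp (- real J / 16) + exp (- ((local_scale n * s)\<^sup>2 * real J ^ 3 / (12 * pi\<^sup>2)))) * r1_gf_real x / r1_gf_real x"
        using F J0 by (intro divide_right_mono norm_r1_gf_complex_le_minor x Jx y) auto
      also have "\<dots> = real J / 2 ^ J + exp (- real J / 16) + exp (- ((local_scale n * s)\<^sup>2 * real J ^ 3 / (12 * pi\<^sup>2)))"
        using F by simp
      also have "\<dots> \<le> C * (1 / (1 + s\<^sup>2)) + exp (- (\<kappa> * s\<^sup>2))" by (intro add_mono t12 t3)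
      finally show "norm (mgf n (\<i> * of_real s)) \<le> exp (- (\<kappa> * s\<^sup>2)) + C * (1 / (1 + s\<^sup>2))" by simp
    qed
  qed
qed

section \<open>The asymptotic formula\<close>

lemma has_integral_gaussian:
  fixes a :: real
  assumes a: "0 < a"
  shows "((\<lambda>s. exp (- (a * s\<^sup>2))) has_integral sqrt (pi / a)) UNIV"
proof -
  define \<sigma> where "\<sigma> = sqrt (1 / (2 * a))"
  have \<sigma>: "0 < \<sigma>" "\<sigma>\<^sup>2 = 1 / (2 * a)" using a by (simp_all add: \<sigma>_def)
  have "(normal_density 0 \<sigma> has_integral 1) UNIV"
    using has_integral_integral_lborel[OF integrable_normal_density[OF \<sigma>(1), of 0]] \<sigma>(1) by simp
  then have "((\<lambda>s. sqrt (pi / a) * normal_density 0 \<sigma> s) has_integral sqrt (pi / a) * 1) UNIV"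
    by (rule has_integral_mult_right)
  moreover have "sqrt (pi / a) * normal_density 0 \<sigma> s = exp (- (a * s\<^sup>2))" for s
    using a by (simp add: normal_density_def \<sigma>(2))
  ultimately show ?thesis by simp
qed

lemma integrable_inverse_one_plus_square: "(\<lambda>s::real. 1 / (1 + s\<^sup>2)) integrable_on UNIV"
proof -
  have "set_integrable lborel (einterval (-\<infinity>) \<infinity>) (\<lambda>s::real. 1 / (1 + s\<^sup>2))"
  proof (rule interval_integral_FTC_nonneg[where F = arctan])
    show "DERIV arctan s :> 1 / (1 + s\<^sup>2)" for s
      using DERIV_arctan[of s] by (simp add: inverse_eq_divide)
    show "isCont (\<lambda>s. 1 / (1 + s\<^sup>2)) s" for s :: real
      by (intro continuous_intros) (auto simp: add_nonneg_eq_0_iff)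
    show "((arctan \<circ> real_of_ereal) \<longlongrightarrow> - (pi / 2)) (at_right (- \<infinity>))"
      unfolding ereal_tendsto_simps1 by (rule tendsto_arctan_at_bot)
    show "((arctan \<circ> real_of_ereal) \<longlongrightarrow> pi / 2) (at_left \<infinity>)"
      unfolding ereal_tendsto_simps1 by (rule tendsto_arctan_at_top)
  qed (auto simp: add_nonneg_pos)
  then have "integrable lborel (\<lambda>s::real. 1 / (1 + s\<^sup>2))"
    by (simp add: set_integrable_def)
  from has_integral_integral_lborel[OF this] show ?thesis by blast
qed

text \<open>The interval grows with n, so the integrand is extended by 0 to the whole line. Every
  fixed s eventually lies in the interval, and the pointwise limit there is the Gaussian with
  integral sqrt (15 / pi).\<close>

lemma tendsto_integral_mgf:
  "(\<lambda>n. integral {- (pi / local_scale n)..pi / local_scale n} (\<lambda>s. mgf n (\<i> * of_real s))) \<longlonglongrightarrow> of_real (sqrt (15 / pi))"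
proof -
  obtain \<kappa> C where \<kappa>: "0 < \<kappa>" "0 \<le> C" and dom: "\<forall>\<^sub>F n in sequentially. \<forall>s. local_scale n * \<bar>s\<bar> \<le> pi \<longrightarrow>
       norm (mgf n (\<i> * of_real s)) \<le> exp (- (\<kappa> * s\<^sup>2)) + C * (1 / (1 + s\<^sup>2))"
    by (rule mgf_dominated)
  define h where "h = (\<lambda>s. exp (- (\<kappa> * s\<^sup>2)) + C * (1 / (1 + s\<^sup>2)))"
  have h0: "0 \<le> h s" for s using \<kappa> by (auto simp: h_def intro!: add_nonneg_nonneg divide_nonneg_nonneg)
  have "(\<lambda>s::real. C *\<^sub>R (1 / (1 + s\<^sup>2))) integrable_on UNIV"
    by (intro integrable_cmul integrable_inverse_one_plus_square)
  then have hint: "h integrable_on UNIV"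
    unfolding h_def real_scaleR_def
    by (intro integrable_add has_integral_integrable[OF has_integral_gaussian[OF \<kappa>(1)]])
  obtain N where N: "\<And>n s. n \<ge> N \<Longrightarrow> local_scale n * \<bar>s\<bar> \<le> pi \<Longrightarrow> norm (mgf n (\<i> * of_real s)) \<le> h s"
    using dom unfolding eventually_sequentially h_def by blast
  \<comment> \<open>Shifting the index by M makes the domination valid for every k and keeps the
    index positive.\<close>
  define M where "M = Suc N"
  define T where "T = (\<lambda>n. pi / local_scale n)"
  define f where "f = (\<lambda>k s. if s \<in> {- T (k + M)..T (k + M)} then mgf (k + M) (\<i> * of_real s) else 0)"
  have pos: "0 < k + M" for k by (simp add: M_def)
  have mem: "s \<in> {- T (k + M)..T (k + M)} \<longleftrightarrow> local_scale (k + M) * \<bar>s\<bar> \<le> pi" for k s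
  proof -
    have "s \<in> {- T (k + M)..T (k + M)} \<longleftrightarrow> \<bar>s\<bar> \<le> T (k + M)" by auto
    also have "\<dots> \<longleftrightarrow> \<bar>s\<bar> * local_scale (k + M) \<le> pi" unfolding T_def by (rule pos_le_divide_eq[OF local_scale_pos[OF pos]])
    finally show ?thesis by (simp only: mult.commute)
  qed
  have fint: "f k integrable_on UNIV" for k
  proof -
    note c = local_scale_pos[OF pos[of k]]
    have "(\<lambda>s. r1_gf_complex (Complex (saddle_point (k + M)) (- (local_scale (k + M) * s))) * exp (- \<i> * of_real (of_nat (k + M) * local_scale (k + M) * s)))
       integrable_on {- T (k + M)..T (k + M)}"
      using c by (intro r1_eq_integral(1)[OF saddle_point_pos[OF pos] c]) (simp add: T_def)
    from integrable_on_cmult_left[OF this, of "1 / of_real (r1_gf_real (saddle_point (k + M)))"]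
    have "(\<lambda>s. mgf (k + M) (\<i> * of_real s)) integrable_on {- T (k + M)..T (k + M)}"
      by (simp add: mgf_imaginary mult_ac)
    then show ?thesis unfolding f_def integrable_restrict_UNIV .
  qed
  have bd: "norm (f k s) \<le> h s" for k s
  proof (cases "s \<in> {- T (k + M)..T (k + M)}")
    case True
    then have "norm (mgf (k + M) (\<i> * of_real s)) \<le> h s" using mem by (intro N) (auto simp: M_def)
    with True show ?thesis by (simp only: f_def if_True)
  next
    case False
    then show ?thesis using h0[of s] by (simp only: f_def if_False norm_zero)
  qed
  have conv: "(\<lambda>k. f k s) \<longlonglongrightarrow> of_real (exp (- (pi\<^sup>2 / 15 * s\<^sup>2)))" for s
  proof -
    have "(\<lambda>n. mgf n (\<i> * of_real s)) \<longlonglongrightarrow> exp (of_real (pi\<^sup>2 / 15) * (\<i> * of_real s)\<^sup>2)"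
      by (rule mgf_tendsto) simp
    also have "of_real (pi\<^sup>2 / 15) * (\<i> * of_real s)\<^sup>2 = (of_real (- (pi\<^sup>2 / 15 * s\<^sup>2)) :: complex)"
      by (simp add: power_mult_distrib)
    finally have "(\<lambda>n. mgf n (\<i> * of_real s)) \<longlonglongrightarrow> of_real (exp (- (pi\<^sup>2 / 15 * s\<^sup>2)))"
      unfolding exp_of_real .
    then have "(\<lambda>k. mgf (k + M) (\<i> * of_real s)) \<longlonglongrightarrow> of_real (exp (- (pi\<^sup>2 / 15 * s\<^sup>2)))"
      by (rule LIMSEQ_ignore_initial_segment)
    moreover have "\<forall>\<^sub>F k in sequentially. mgf (k + M) (\<i> * of_real s) = f k s"
    proof -
      have x0: "saddle_point \<longlonglongrightarrow> 0" using saddle_point_tendsto_0 by (simp add: filterlim_at)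
      then have "(\<lambda>n. saddle_point n * sqrt (saddle_point n) * \<bar>s\<bar>) \<longlonglongrightarrow> 0 * sqrt 0 * \<bar>s\<bar>" by (intro tendsto_intros)
      then have "(\<lambda>n. local_scale n * \<bar>s\<bar>) \<longlonglongrightarrow> 0" by (simp add: local_scale_def)
      then have "(\<lambda>k. local_scale (k + M) * \<bar>s\<bar>) \<longlonglongrightarrow> 0" by (rule LIMSEQ_ignore_initial_segment)
      then have "\<forall>\<^sub>F k in sequentially. local_scale (k + M) * \<bar>s\<bar> < pi" by (rule order_tendstoD) simp
      then show ?thesis
      proof eventually_elim
        case (elim k)
        then have "s \<in> {- T (k + M)..T (k + M)}" unfolding mem by simp
        then show ?case by (simp only: f_def if_True)
      qed
    qed
    ultimately show ?thesis by (rule Lim_transform_eventually)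
  qed
  have "(\<lambda>k. integral UNIV (f k)) \<longlonglongrightarrow> integral UNIV (\<lambda>s. complex_of_real (exp (- (pi\<^sup>2 / 15 * s\<^sup>2))))"
    by (rule dominated_convergence(2)[OF fint hint bd conv])
  moreover have "integral UNIV (\<lambda>s. complex_of_real (exp (- (pi\<^sup>2 / 15 * s\<^sup>2)))) = of_real (sqrt (15 / pi))"
  proof (rule integral_unique)
    have "((\<lambda>s. exp (- (pi\<^sup>2 / 15 * s\<^sup>2))) has_integral sqrt (pi / (pi\<^sup>2 / 15))) UNIV"
      by (rule has_integral_gaussian) simp
    also have "pi / (pi\<^sup>2 / 15) = 15 / pi" by (simp add: power2_eq_square)
    finally show "((\<lambda>s. complex_of_real (exp (- (pi\<^sup>2 / 15 * s\<^sup>2)))) has_integral of_real (sqrt (15 / pi))) UNIV"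
      by (rule has_integral_of_real)
  qed
  moreover have "integral UNIV (f k) = integral {- (pi / local_scale (k + M))..pi / local_scale (k + M)} (\<lambda>s. mgf (k + M) (\<i> * of_real s))" for k
    unfolding f_def T_def by (rule integral_restrict_UNIV)
  ultimately have "(\<lambda>k. integral {- (pi / local_scale (k + M))..pi / local_scale (k + M)} (\<lambda>s. mgf (k + M) (\<i> * of_real s))) \<longlonglongrightarrow> of_real (sqrt (15 / pi))"
    by simp
  then show ?thesis by (rule LIMSEQ_offset)
qed

lemma integral_mgf:
  assumes n: "0 < n"
  shows "integral {- (pi / local_scale n)..pi / local_scale n} (\<lambda>s. mgf n (\<i> * of_real s)) =
    of_real (2 * (pi / local_scale n) * (real (r1 1 n) * exp (- real n * saddle_point n)) / r1_gf_real (saddle_point n))"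
proof -
  note c = local_scale_pos[OF n]
  have "(\<lambda>s. mgf n (\<i> * of_real s)) = (\<lambda>s. 1 / of_real (r1_gf_real (saddle_point n)) *
      (r1_gf_complex (Complex (saddle_point n) (- (local_scale n * s))) * exp (- \<i> * of_real (of_nat n * local_scale n * s))))"
    by (simp add: mgf_imaginary mult_ac)
  then have "integral {- (pi / local_scale n)..pi / local_scale n} (\<lambda>s. mgf n (\<i> * of_real s)) = 1 / of_real (r1_gf_real (saddle_point n)) *
     integral {- (pi / local_scale n)..pi / local_scale n} (\<lambda>s. r1_gf_complex (Complex (saddle_point n) (- (local_scale n * s))) * exp (- \<i> * of_real (of_nat n * local_scale n * s)))"
    by (simp only: integral_mult_right)
  also have "integral {- (pi / local_scale n)..pi / local_scale n} (\<lambda>s. r1_gf_complex (Complex (saddle_point n) (- (local_scale n * s))) * exp (- \<i> * of_real (of_nat n * local_scale n * s)))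
     = of_real (2 * (pi / local_scale n) * (real (r1 1 n) * exp (- real n * saddle_point n)))"
    using c by (intro r1_eq_integral(2)[OF saddle_point_pos[OF n] c]) simp
  finally show ?thesis by simp
qed

definition r1_main :: "nat \<Rightarrow> real" where
  "r1_main n = 3 powr (1/4) * golden_ratio powr (1/2) * ln golden_ratio / (2 * pi)
                * real n powr (-1/4) * exp (2 * pi * sqrt (real n / 15))"

lemma powr_quarter: "0 \<le> x \<Longrightarrow> x powr (1 / 4) = sqrt (sqrt x)"
proof -
  assume "0 \<le> x"
  then have "sqrt (sqrt x) = (x powr (1 / 2)) powr (1 / 2)" by (simp add: powr_half_sqrt)
  also have "\<dots> = x powr (1 / 4)" by (simp add: powr_powr)
  finally show ?thesis by simp
qed

text \<open>Multiplying the limit of the integral by the asymptotics of \<open>r1_gf_real\<close> at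
  the saddle point x cancels \<open>r1_gf_real x\<close>. Since pi^2 / (15 x) = n x there, the
  exponentials combine to exp (- 2 n x).\<close>

lemma r1_1_div_main_tendsto: "(\<lambda>n. real (r1 1 n) / r1_main n) \<longlonglongrightarrow> 1"
proof -
  let ?g = golden_ratio
  define L where "L = ln ?g * sqrt (?g / sqrt 5)"
  have g: "1 < ?g" by (rule golden_ratio_gt_1)
  define D where "D = sqrt (sqrt 3) * sqrt ?g * ln ?g"
  have Dpos: "0 < D" using g by (simp add: D_def)
  have "(\<lambda>n. of_real (2 * (pi / local_scale n) * (real (r1 1 n) * exp (- real n * saddle_point n)) / r1_gf_real (saddle_point n)) :: complex) \<longlonglongrightarrow> of_real (sqrt (15 / pi))"
  proof (rule Lim_transform_eventually[OF tendsto_integral_mgf])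
    show "\<forall>\<^sub>F n in sequentially. integral {- (pi / local_scale n)..pi / local_scale n} (\<lambda>s. mgf n (\<i> * of_real s)) =
        of_real (2 * (pi / local_scale n) * (real (r1 1 n) * exp (- real n * saddle_point n)) / r1_gf_real (saddle_point n))"
      using eventually_gt_at_top[of 0] by eventually_elim (rule integral_mgf)
  qed
  then have 1: "(\<lambda>n. 2 * (pi / local_scale n) * (real (r1 1 n) * exp (- real n * saddle_point n)) / r1_gf_real (saddle_point n)) \<longlonglongrightarrow> sqrt (15 / pi)"
    by (simp only: tendsto_of_real_iff)
  have 2: "(\<lambda>n. saddle_point n * r1_gf_real (saddle_point n) * exp (- (pi\<^sup>2 / 15) / saddle_point n)) \<longlonglongrightarrow> L"
    unfolding L_def by (rule filterlim_compose[OF r1_gf_real_asymp saddle_point_tendsto_0])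
  have "(\<lambda>n. (2 * (pi / local_scale n) * (real (r1 1 n) * exp (- real n * saddle_point n)) / r1_gf_real (saddle_point n)) *
      (saddle_point n * r1_gf_real (saddle_point n) * exp (- (pi\<^sup>2 / 15) / saddle_point n)) * (sqrt pi / sqrt (sqrt 15) / D)) \<longlonglongrightarrow>
      sqrt (15 / pi) * L * (sqrt pi / sqrt (sqrt 15) / D)"
    by (intro tendsto_mult 1 2 tendsto_const)
  also have "sqrt (15 / pi) * L * (sqrt pi / sqrt (sqrt 15) / D) = 1"
  proof -
    \<comment> \<open>Fourth roots of 5 and 3: a cancels completely, and b is the factor 3^(1/4) of
      the formula.\<close>
    define a b where "a = sqrt (sqrt 5)" and "b = sqrt (sqrt 3)"
    have ab: "sqrt (sqrt 15) = a * b" "sqrt 15 = a\<^sup>2 * b\<^sup>2" "0 < a" "0 < b"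
      by (simp_all add: a_def b_def real_sqrt_mult[symmetric])
    have "a\<^sup>2 * b\<^sup>2 / P * (l * (G / a)) * (P / (a * b) / (b * G * l)) = 1"
      if "0 < P" "0 < G" "0 < l" for P G l :: real
      using that ab(3,4) by (simp add: power2_eq_square)
    from this[of "sqrt pi" "sqrt ?g" "ln ?g"] show ?thesis
      unfolding L_def D_def real_sqrt_divide ab(1) b_def[symmetric] a_def[symmetric] unfolding ab(2) using g by simp
  qed
  finally show ?thesis
  proof (rule Lim_transform_eventually)
    show "\<forall>\<^sub>F n in sequentially. (2 * (pi / local_scale n) * (real (r1 1 n) * exp (- real n * saddle_point n)) / r1_gf_real (saddle_point n)) *
      (saddle_point n * r1_gf_real (saddle_point n) * exp (- (pi\<^sup>2 / 15) / saddle_point n)) * (sqrt pi / sqrt (sqrt 15) / D) = real (r1 1 n) / r1_main n"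
      using eventually_gt_at_top[of 0]
    proof eventually_elim
      case (elim n)
      define x where "x = saddle_point n"
      have x: "0 < x" unfolding x_def by (rule saddle_point_pos[OF elim])
      have F: "r1_gf_real x \<noteq> 0" using r1_gf_real_pos[OF x] by simp
      have nn: "0 < real n" using elim by simp
      have e1: "real n * x = pi * sqrt (real n / 15)"
      proof -
        have "real n * x = pi / sqrt 15 * (real n / sqrt (real n))" by (simp add: x_def saddle_point_def real_sqrt_mult)
        then show ?thesis by (simp only: real_div_sqrt[of "real n"] real_sqrt_divide) simp
      qed
      have e2: "(pi\<^sup>2 / 15) / x = real n * x"
        using saddle_point_square[OF elim] x by (simp add: x_def[symmetric] field_simps power2_eq_square)
      have e: "exp (- real n * x) * exp (- (pi\<^sup>2 / 15) / x) = 1 / exp (2 * pi * sqrt (real n / 15))"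
      proof -
        have "- real n * x + - (pi\<^sup>2 / 15) / x = - (2 * pi * sqrt (real n / 15))"
          using e1 e2 by simp
        then show ?thesis by (simp only: exp_add[symmetric] exp_minus inverse_eq_divide)
      qed
      have sx: "sqrt x = sqrt pi / (sqrt (sqrt 15) * sqrt (sqrt (real n)))"
        by (simp add: x_def saddle_point_def real_sqrt_divide real_sqrt_mult)
      have m: "r1_main n = D / (2 * pi) / sqrt (sqrt (real n)) * exp (2 * pi * sqrt (real n / 15))"
      proof -
        have "real n powr (- 1 / 4) = inverse (real n powr (1 / 4))" using powr_minus[of "real n" "1 / 4"] by simp
        also have "real n powr (1 / 4) = sqrt (sqrt (real n))" by (rule powr_quarter) simp
        finally have "real n powr (- 1 / 4) = inverse (sqrt (sqrt (real n)))" .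
        moreover have "3 powr (1 / 4) = sqrt (sqrt (3::real))" by (rule powr_quarter) simp
        moreover have "?g powr (1 / 2) = sqrt ?g" using g by (intro powr_half_sqrt) simp
        ultimately show ?thesis unfolding r1_main_def D_def by (simp only: divide_inverse mult_ac)
      qed
      have "2 * (pi / local_scale n) * (real (r1 1 n) * exp (- real n * x)) / r1_gf_real x * (x * r1_gf_real x * exp (- (pi\<^sup>2 / 15) / x)) =
          2 * pi * real (r1 1 n) / sqrt x * (exp (- real n * x) * exp (- (pi\<^sup>2 / 15) / x))"
        using x F by (simp add: local_scale_def x_def[symmetric])
      also have "\<dots> = 2 * pi * real (r1 1 n) * (sqrt (sqrt 15) * sqrt (sqrt (real n))) / sqrt pi / exp (2 * pi * sqrt (real n / 15))"
        unfolding e sx by simp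
      finally show ?case unfolding x_def[symmetric] m using Dpos nn by (simp add: mult_ac)
    qed
  qed
qed

section \<open>Comparison of 1-hooks and 2-hooks\<close>

lemma r1_main_pos: "0 < n \<Longrightarrow> 0 < r1_main n"
  using golden_ratio_gt_1 by (simp add: r1_main_def)

lemma power_div_r1_1_tendsto_0: "(\<lambda>n. (real n + 1) ^ M / real (r1 1 n)) \<longlonglongrightarrow> 0"
proof -
  define D where "D = 3 powr (1/4) * golden_ratio powr (1/2) * ln golden_ratio / (2 * pi)"
  have D: "0 < D" using golden_ratio_gt_1 by (simp add: D_def)
  have "(\<lambda>n. (real n + 1) ^ M * (sqrt (sqrt (real n)) * exp (- (2 * pi * sqrt (real n / 15))))) \<longlonglongrightarrow> 0"
    by real_asymp
  then have "(\<lambda>n. (real n + 1) ^ M * (sqrt (sqrt (real n)) * exp (- (2 * pi * sqrt (real n / 15)))) * (1 / D)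
      * inverse (real (r1 1 n) / r1_main n)) \<longlonglongrightarrow> 0 * (1 / D) * inverse 1"
    by (rule tendsto_mult[OF tendsto_mult[OF _ tendsto_const] tendsto_inverse[OF r1_1_div_main_tendsto]]) simp
  then have "(\<lambda>n. (real n + 1) ^ M * (sqrt (sqrt (real n)) * exp (- (2 * pi * sqrt (real n / 15)))) * (1 / D)
      * inverse (real (r1 1 n) / r1_main n)) \<longlonglongrightarrow> 0" by simp
  then show ?thesis
  proof (rule Lim_transform_eventually)
    show "\<forall>\<^sub>F n in sequentially. (real n + 1) ^ M * (sqrt (sqrt (real n)) * exp (- (2 * pi * sqrt (real n / 15)))) * (1 / D)
      * inverse (real (r1 1 n) / r1_main n) = (real n + 1) ^ M / real (r1 1 n)"
      using eventually_gt_at_top[of 0]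
    proof eventually_elim
      case (elim n)
      have "real n powr (- 1 / 4) = inverse (real n powr (1 / 4))" using powr_minus[of "real n" "1 / 4"] by simp
      also have "real n powr (1 / 4) = sqrt (sqrt (real n))" by (rule powr_quarter) simp
      finally have "r1_main n = D / sqrt (sqrt (real n)) * exp (2 * pi * sqrt (real n / 15))"
        unfolding r1_main_def D_def by (simp only: divide_inverse)
      moreover have "(c * inverse e) * (1 / D) = 1 / (D / c * e)" for c e :: real
        by (simp add: inverse_eq_divide)
      ultimately have "(sqrt (sqrt (real n)) * exp (- (2 * pi * sqrt (real n / 15)))) * (1 / D) = 1 / r1_main n"
        by (simp only: exp_minus)
      then have "(real n + 1) ^ M * (sqrt (sqrt (real n)) * exp (- (2 * pi * sqrt (real n / 15)))) * (1 / D)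
         * inverse (real (r1 1 n) / r1_main n) = (real n + 1) ^ M * (1 / r1_main n) * inverse (real (r1 1 n) / r1_main n)"
        by (simp only: mult.assoc)
      also have "\<dots> = (real n + 1) ^ M / real (r1 1 n)"
        unfolding inverse_eq_divide using r1_main_pos[OF elim] by simp
      finally show ?case .
    qed
  qed
qed

lemma eventually_r1_1_pos: "\<forall>\<^sub>F n in sequentially. 0 < r1 1 n"
proof -
  have "\<forall>\<^sub>F n in sequentially. 0 < real (r1 1 n) / r1_main n"
    using r1_1_div_main_tendsto by (rule order_tendstoD) simp
  then show ?thesis
  proof eventually_elim
    case (elim n)
    then have "real (r1 1 n) \<noteq> 0" by (metis div_0 less_irrefl)
    then show ?case by (simp only: of_nat_eq_0_iff neq0_conv)
  qed
qed

text \<open>\<open>card_gap2_partitions_le\<close> bounds the quotient by 1 / M + M (n + 1)^M /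
  \<open>r1 1 n\<close>. First M is fixed to make 1 / M at most e / 2, then n grows, and
  \<open>r1 1 n\<close> outgrows the polynomial.\<close>

lemma card_gap2_partitions_div_r1_1_tendsto_0: "(\<lambda>n. real (card (gap2_partitions n)) / real (r1 1 n)) \<longlonglongrightarrow> 0"
proof (rule tendstoI)
  fix e :: real assume e: "0 < e"
  define M where "M = nat \<lceil>2 / e\<rceil>"
  have M: "2 / e \<le> real M" unfolding M_def by linarith
  have M0: "0 < real M" using M e by (smt (verit) divide_pos_pos)
  have Me: "1 / real M \<le> e / 2" using M M0 e by (simp add: field_simps)
  have "(\<lambda>n. real M * ((real n + 1) ^ M / real (r1 1 n))) \<longlonglongrightarrow> real M * 0"
    by (intro tendsto_mult tendsto_const power_div_r1_1_tendsto_0)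
  then have "\<forall>\<^sub>F n in sequentially. real M * ((real n + 1) ^ M / real (r1 1 n)) < e / 2"
    by (rule order_tendstoD) (use e in simp)
  then show "\<forall>\<^sub>F n in sequentially. dist (real (card (gap2_partitions n)) / real (r1 1 n)) 0 < e"
    using eventually_r1_1_pos
  proof eventually_elim
    case (elim n)
    have "real (M * card (gap2_partitions n)) \<le> real (r1 1 n + M * M * (n + 1) ^ M)"
      by (simp only: of_nat_le_iff card_gap2_partitions_le)
    then have "real M * real (card (gap2_partitions n)) \<le> real (r1 1 n) + real M * (real M * (real n + 1) ^ M)"
      by (simp add: mult.assoc add.commute)
    then have "real (card (gap2_partitions n)) \<le> (real (r1 1 n) + real M * (real M * (real n + 1) ^ M)) / real M"
      using M0 by (simp add: pos_le_divide_eq mult.commute)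
    also have "\<dots> = real (r1 1 n) * (1 / real M) + real M * (real n + 1) ^ M"
      using M0 by (simp add: add_divide_distrib)
    finally have "real (card (gap2_partitions n)) / real (r1 1 n) \<le>
       (real (r1 1 n) * (1 / real M) + real M * (real n + 1) ^ M) / real (r1 1 n)"
      by (intro divide_right_mono) auto
    also have "\<dots> = 1 / real M + real M * ((real n + 1) ^ M / real (r1 1 n))"
      using elim(2) by (simp add: add_divide_distrib)
    also have "\<dots> < e / 2 + e / 2" using Me elim(1) by linarith
    finally show ?case by simp
  qed
qed

lemma r1_2_div_r1_1_tendsto: "(\<lambda>n. real (r1 2 n) / real (r1 1 n)) \<longlonglongrightarrow> 1"
proof (rule tendsto_sandwich)
  show "\<forall>\<^sub>F n in sequentially. 1 - real (card (gap2_partitions n)) / real (r1 1 n) \<le> real (r1 2 n) / real (r1 1 n)"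
    using eventually_r1_1_pos
  proof eventually_elim
    case (elim n)
    have "real (r1 1 n) \<le> real (r1 2 n) + real (card (gap2_partitions n))"
      using r1_1_le[of n] by (simp only: of_nat_add[symmetric] of_nat_le_iff)
    then have "real (r1 1 n) / real (r1 1 n) \<le> (real (r1 2 n) + real (card (gap2_partitions n))) / real (r1 1 n)"
      by (rule divide_right_mono) simp
    then show ?case using elim by (simp add: add_divide_distrib)
  qed
  show "\<forall>\<^sub>F n in sequentially. real (r1 2 n) / real (r1 1 n) \<le> 1"
    using eventually_r1_1_pos by eventually_elim (use r1_2_le in simp)
  have "(\<lambda>n. 1 - real (card (gap2_partitions n)) / real (r1 1 n)) \<longlonglongrightarrow> 1 - 0"
    by (intro tendsto_diff tendsto_const card_gap2_partitions_div_r1_1_tendsto_0)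
  then show "(\<lambda>n. 1 - real (card (gap2_partitions n)) / real (r1 1 n)) \<longlonglongrightarrow> 1" by simp
qed auto

theorem theorem1p3:
  shows "(\<lambda>n. real (r1 1 n)) \<sim>[at_top] (\<lambda>n. real (r1 2 n))
     \<and> (\<lambda>n. real (r1 2 n)) \<sim>[at_top]
         (\<lambda>n. 3 powr (1/4) * golden_ratio powr (1/2) * ln golden_ratio / (2 * pi)
                * real n powr (-1/4) * exp (2 * pi * sqrt (real n / 15)))"
proof -
  have 21: "(\<lambda>n. real (r1 2 n)) \<sim>[at_top] (\<lambda>n. real (r1 1 n))"
    by (rule asymp_equivI'[OF r1_2_div_r1_1_tendsto])
  have 1: "(\<lambda>n. real (r1 1 n)) \<sim>[at_top] r1_main"
    by (rule asymp_equivI'[OF r1_1_div_main_tendsto])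
  show ?thesis
    using asymp_equiv_symI[OF 21] asymp_equiv_trans[OF 21 1] unfolding r1_main_def[abs_def] by (rule conjI)
qed

end
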